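(* Let $a,b,c,d,\tau,\eta\in\mathbb{R}$ with $ad-bc=1$ and $b>0$, and let $O_A$ be the offset linear canonical transform with parameter $A=\left[\begin{array}{cc|c} a & b & \tau\\ c & d & \eta\end{array}\right]$. Let $f\in L^2(\mathbb{R})$ with $\|f\|_2=1$. Then $$E(|f|^2)+E(|O_Af|^2)\ge\ln(\pi e b),$$ where $E(\rho)=-\int_{\mathbb{R}}\rho(t)\ln\rho(t)\,\mathrm{d}t$ denotes the Shannon entropy of a probability density function $\rho$ on $\mathbb{R}$.
   Context: Here $j$ denotes the imaginary unit and $\|\cdot\|_2$ is the $L^2(\mathbb{R})$ norm. For real parameters $a,b,c,d,\tau,\eta$ with $ad-bc=1$ and $b>0$, the offset linear canonical transform (OLCT) of a function $f$ on $\mathbb{R}$ is $$O_Af(u)=\int_{-\infty}^{+\infty}f(t)K_A(t,u)\,\mathrm{d}t,\qquad K_A(t,u)=\frac{1}{\sqrt{j2\pi b}}\,e^{j\frac{a}{2b}t^2-j\frac{1}{b}t(u-\tau)-j\frac{1}{b}u(d\tau-b\eta)+j\frac{d}{2b}(u^2+\tau^2)}.$$ For $f\in L^2(\mathbb{R})$ the integral is understood in the usual $L^2$ sense, as for the Fourier transform on $L^2(\mathbb{R})$. If $\|f\|_2=1$ then $\|O_Af\|_2=1$, so $|f|^2$ and $|O_Af|^2$ are both probability density functions on $\mathbb{R}$. In the Shannon entropy the convention $0\ln 0=0$ is used. *)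

theory Defs
  imports "HOL-Analysis.Analysis"
begin

definition L2 :: "(real \<Rightarrow> complex) set" where
  "L2 = {f \<in> borel_measurable lebesgue. integrable lebesgue (\<lambda>t. (cmod (f t))\<^sup>2)}"

definition L2_norm :: "(real \<Rightarrow> complex) \<Rightarrow> real" where
  "L2_norm f = sqrt (\<integral>t. (cmod (f t))\<^sup>2 \<partial>lebesgue)"

definition olct_kernel ::
    "real \<Rightarrow> real \<Rightarrow> real \<Rightarrow> real \<Rightarrow> real \<Rightarrow> real \<Rightarrow> real \<Rightarrow> real \<Rightarrow> complex" where
  "olct_kernel a b c d \<tau> \<eta> t u =
     1 / csqrt (\<i> * of_real (2 * pi * b)) *
     exp (\<i> * of_real (a / (2 * b) * t\<^sup>2 - 1 / b * t * (u - \<tau>)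
                     - 1 / b * u * (d * \<tau> - b * \<eta>) + d / (2 * b) * (u\<^sup>2 + \<tau>\<^sup>2)))"

definition olct_trunc ::
    "real \<Rightarrow> real \<Rightarrow> real \<Rightarrow> real \<Rightarrow> real \<Rightarrow> real \<Rightarrow> real \<Rightarrow> (real \<Rightarrow> complex) \<Rightarrow> real \<Rightarrow> complex" where
  "olct_trunc a b c d \<tau> \<eta> T f u =
     (LINT t:{-T..T}|lebesgue. f t * olct_kernel a b c d \<tau> \<eta> t u)"

text \<open>
  On \<open>L\<^sup>2\<close> the transform is the limit in the mean, as \<open>T\<close> tends to infinity, of the integrals over
  \<open>[-T, T]\<close> (which converge absolutely because \<open>f\<close> is integrable on bounded intervals).
  The limit is determined only up to a null set, so \<open>olct\<close> picks some representative.
\<close>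

definition is_olct ::
    "real \<Rightarrow> real \<Rightarrow> real \<Rightarrow> real \<Rightarrow> real \<Rightarrow> real \<Rightarrow> (real \<Rightarrow> complex) \<Rightarrow> (real \<Rightarrow> complex) \<Rightarrow> bool" where
  "is_olct a b c d \<tau> \<eta> f g \<longleftrightarrow>
     g \<in> L2 \<and> (\<forall>T. olct_trunc a b c d \<tau> \<eta> T f \<in> L2) \<and>
     ((\<lambda>T. L2_norm (\<lambda>u. olct_trunc a b c d \<tau> \<eta> T f u - g u)) \<longlongrightarrow> 0) at_top"

definition olct ::
    "real \<Rightarrow> real \<Rightarrow> real \<Rightarrow> real \<Rightarrow> real \<Rightarrow> real \<Rightarrow> (real \<Rightarrow> complex) \<Rightarrow> real \<Rightarrow> complex" where
  "olct a b c d \<tau> \<eta> f = (SOME g. is_olct a b c d \<tau> \<eta> f g)"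

text \<open>
  The integrand \<open>- \<rho> ln \<rho>\<close> need not be integrable, even for \<open>\<rho> = |f|\<^sup>2\<close> with \<open>f\<close> in \<open>L\<^sup>2\<close>; the
  entropy is therefore an extended real, the integral of the positive part of the integrand minus
  the integral of its negative part (\<^term>\<open>ennreal\<close> sends negative numbers to \<open>0\<close>). The convention
  \<open>0 ln 0 = 0\<close> holds since \<open>0 * x = 0\<close>. In \<^typ>\<open>ereal\<close>, \<open>\<infinity> - \<infinity> = \<infinity>\<close> and \<open>\<infinity> + (-\<infinity>) = \<infinity>\<close>, so
  a lower bound on a sum of two entropies says nothing when an entropy or the sum is undefined,
  and has its usual meaning in all other cases, infinite values included.
\<close>

definition shannon_entropy :: "(real \<Rightarrow> real) \<Rightarrow> ereal" where
  "shannon_entropy \<rho> =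
     enn2ereal (\<integral>\<^sup>+t. ennreal (- (\<rho> t * ln (\<rho> t))) \<partial>lebesgue) -
     enn2ereal (\<integral>\<^sup>+t. ennreal (\<rho> t * ln (\<rho> t)) \<partial>lebesgue)"

lemma shannon_entropy_eq_integral:
  assumes "integrable lebesgue (\<lambda>t. \<rho> t * ln (\<rho> t))"
  shows "shannon_entropy \<rho> = ereal (- (\<integral>t. \<rho> t * ln (\<rho> t) \<partial>lebesgue))"
proof -
  let ?h = "\<lambda>t. \<rho> t * ln (\<rho> t)"
  let ?P = "\<integral>\<^sup>+t. ennreal (- ?h t) \<partial>lebesgue" and ?N = "\<integral>\<^sup>+t. ennreal (?h t) \<partial>lebesgue"
  have fin: "?P \<noteq> \<infinity>" "?N \<noteq> \<infinity>"
    using real_integrable_def[of lebesgue ?h] assms by auto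
  have "(\<integral>t. ?h t \<partial>lebesgue) = enn2real ?N - enn2real ?P"
    by (rule real_lebesgue_integral_def[OF assms])
  moreover have "enn2ereal ?P = ereal (enn2real ?P)" "enn2ereal ?N = ereal (enn2real ?N)"
    using fin by (metis enn2ereal_ennreal enn2real_nonneg ennreal_enn2real infinity_ennreal_def top.not_eq_extremum)+
  ultimately show ?thesis
    by (simp add: shannon_entropy_def)
qed

end

theory Submission
  imports Defs "HOL-Probability.Probability" "HOL-Real_Asymp.Real_Asymp"
begin

text \<open>
  The bound is the derivative at \<open>p = 2\<close> of Beckner's sharp Hausdorff--Young inequality, which is an
  equality there. On the two-point space, \<open>a + b \<epsilon> \<mapsto> a + \<i> w b \<epsilon>\<close> with \<open>w\<^sup>2 = p - 1\<close> is a contraction from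
  \<open>L\<^sup>p\<close> to its dual \<open>L\<^sup>q\<close>; this tensorizes to the discrete cube, and the products
  \<open>\<Prod> (1 + \<i> \<theta> \<epsilon>\<^sub>k / \<surd>n)\<close> turn in the central limit into Gaussian characters, on which the limiting
  operator is a Fourier transform.

  For \<open>f\<close> and \<open>g = O\<^sub>A f\<close> of norm \<open>1\<close> and subprobability densities \<open>m\<close>, \<open>m'\<close>, the inequality
  is applied to \<open>f * m powr (s / 2)\<close> and \<open>g * m' powr (s / 2)\<close> with \<open>p = 2 / (1 + s)\<close>; both lie in the
  unit ball of \<open>L\<^sup>p\<close>. As \<open>s\<close> tends to \<open>0\<close> this gives
  \<open>- \<integral> |f|\<^sup>2 ln m - \<integral> |g|\<^sup>2 ln m' \<ge> ln (\<pi> e b)\<close>. Taking for \<open>m\<close>, \<open>m'\<close> the densities \<open>|f|\<^sup>2\<close>, \<open>|g|\<^sup>2\<close>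
  clipped at height \<open>n\<close> and letting \<open>n\<close> tend to infinity covers arbitrary square integrable \<open>f\<close>.
\<close>

subsection \<open>The two-point inequality\<close>

text \<open>The bound is a derivative at \<open>p = 2\<close>, but \<open>f\<close> need not lie in
  any L^p with \<open>p < 2\<close>, so its own L^p norm cannot be differentiated. The weight
  \<open>m\<close> repairs this: Young's inequality bounds
  \<open>|f|\<^sup>p m powr (1 - p / 2)\<close> by a convex combination of
  \<open>|f|\<^sup>2\<close> and \<open>m\<close>, two functions of integral at most 1, and
  differentiation yields cross entropies with \<open>ln m\<close>. The inequality is used in
  bilinear form with the same \<open>p\<close> on both factors, so that norms of the dual exponent
  occur on two points only. Tilting both factors at once costs the product of two L2 distances, each
  o(sqrt s), hence o(s), which the derivative does not see. At \<open>s = 0\<close> both sides equal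
  1, and the sharp constant has the derivative \<open>- ln (pi * exp 1 * b) / 2\<close>. The central
  limit reaches only finite sums of characters. The sharp inequality is therefore proved first for
  trigonometric polynomials times \<open>exp (- t\<^sup>2 / (2 * p))\<close>, whose p-th power is a
  multiple of the normal density, and extended by their density in L1 and L2 at once.\<close>

definition mean2 :: "real \<Rightarrow> real \<Rightarrow> real \<Rightarrow> real" where
  "mean2 r s t = ((s powr r + t powr r) / 2) powr (1 / r)"

lemma mean2_nonneg [simp]: "0 \<le> mean2 r s t"
  by (simp add: mean2_def)

lemma mean2_eq_0_iff: "r > 0 \<Longrightarrow> mean2 r s t = 0 \<longleftrightarrow> s = 0 \<and> t = 0"
  by (auto simp: mean2_def add_nonneg_eq_0_iff)

lemma mean2_powr: "r > 0 \<Longrightarrow> mean2 r s t powr r = (s powr r + t powr r) / 2"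
  by (simp add: mean2_def powr_powr)

lemma mean2_scale: "\<lbrakk>r > 0; k \<ge> 0; s \<ge> 0; t \<ge> 0\<rbrakk> \<Longrightarrow> mean2 r (k * s) (k * t) = k * mean2 r s t"
proof -
  assume a: "r > 0" "k \<ge> 0" "s \<ge> 0" "t \<ge> 0"
  have "((k * s) powr r + (k * t) powr r) / 2 = k powr r * ((s powr r + t powr r) / 2)"
    using a by (simp add: powr_mult field_simps)
  then show ?thesis unfolding mean2_def using a by (simp only: powr_mult powr_powr) (simp add: powr_powr powr_mult)
qed

lemma mean2_const [simp]: "r > 0 \<Longrightarrow> s \<ge> 0 \<Longrightarrow> mean2 r s s = s"
  by (simp add: mean2_def powr_powr)

section \<open>Minkowski's inequality for two-point means, and its reverse below exponent 1\<close>

lemma convex_powr: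
  fixes r :: real
  assumes "r \<ge> 1" "l \<ge> 0" "l \<le> 1" "x \<ge> 0" "y \<ge> 0"
  shows "(l * x + (1 - l) * y) powr r \<le> l * x powr r + (1 - l) * y powr r"
proof (cases "0 < x \<and> 0 < y")
  case True
  then show ?thesis
    using convex_onD[OF powr_convex[OF assms(1)], of "1-l" x y] assms by (simp add: algebra_simps)
next
  case False
  \<comment> \<open>With a zero argument only one term is left, and the claim becomes
    \<open>k powr r \<le> k\<close> for a weight \<open>k\<close> in [0, 1].\<close>
  have *: "k powr r * z powr r \<le> k * z powr r" if "0 \<le> k" "k \<le> 1" for k z :: real
    using that powr_le_one_le[of k r] assms(1) by (cases "k = 0") (auto intro!: mult_right_mono)
  show ?thesis
    using False assms *[of l x] *[of "1 - l" y] by (auto simp: powr_mult not_less)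
qed

text \<open>Homogeneity: scaled by their own means, both pairs have mean 1, and
  \<open>(s + u) / (A + B)\<close> is the convex combination of \<open>s / A\<close> and
  \<open>u / B\<close> with weights \<open>A / (A + B)\<close> and \<open>B / (A + B)\<close>.
  Convexity of the r-th power does the rest.\<close>

lemma mean2_triangle:
  assumes r: "r \<ge> 1" and nn: "s \<ge> 0" "t \<ge> 0" "u \<ge> 0" "v \<ge> 0"
  shows "mean2 r (s + u) (t + v) \<le> mean2 r s t + mean2 r u v"
proof (cases "mean2 r s t = 0 \<or> mean2 r u v = 0")
  case True
  then show ?thesis using r by (auto simp: mean2_eq_0_iff)
next
  case False
  define A B where "A = mean2 r s t" and "B = mean2 r u v"
  have pos: "A > 0" "B > 0" using False by (auto simp: A_def B_def order.strict_iff_order)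
  define l where "l = A / (A + B)"
  have l: "0 \<le> l" "l \<le> 1" "1 - l = B / (A + B)" using pos by (auto simp: l_def field_simps)
  have split: "((x + y) / (A + B)) powr r \<le> l * (x powr r / A powr r) + (1 - l) * (y powr r / B powr r)"
    if "x \<ge> 0" "y \<ge> 0" for x y
  proof -
    have "(x + y) / (A + B) = l * (x / A) + (1 - l) * (y / B)"
      using pos unfolding l(3) by (simp add: l_def add_divide_distrib)
    then show ?thesis
      using convex_powr[OF r l(1,2), of "x/A" "y/B"] pos that by (simp add: powr_divide)
  qed
  have AB: "A powr r = (s powr r + t powr r) / 2" "B powr r = (u powr r + v powr r) / 2"
    using r by (simp_all add: A_def B_def mean2_powr)
  have "((s + u) / (A + B)) powr r + ((t + v) / (A + B)) powr r
      \<le> l * ((s powr r + t powr r) / A powr r) + (1 - l) * ((u powr r + v powr r) / B powr r)"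
    using split[of s u] split[of t v] nn by (simp add: algebra_simps add_divide_distrib)
  also have "\<dots> = 2"
  proof -
    have "A powr r > 0" "B powr r > 0" using pos by auto
    then have "(s powr r + t powr r) / A powr r = 2" "(u powr r + v powr r) / B powr r = 2"
      unfolding AB by (auto simp: field_simps)
    then show ?thesis by simp
  qed
  finally have "((s + u) powr r + (t + v) powr r) / 2 \<le> (A + B) powr r"
    using pos nn by (simp add: powr_divide field_simps)
  then have "mean2 r (s + u) (t + v) \<le> ((A + B) powr r) powr (1 / r)"
    unfolding mean2_def using r by (intro powr_mono2) auto
  also have "\<dots> = A + B" using pos r by (simp add: powr_powr)
  finally show ?thesis by (simp add: A_def B_def)
qed

text \<open>The case \<open>r \<le> 1\<close> follows from the exponent \<open>1/r \<ge> 1\<close> applied to the \<open>r\<close>-th powers.\<close>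
lemma mean2_triangle_reverse:
  assumes r: "0 < r" "r \<le> 1" and nn: "s \<ge> 0" "t \<ge> 0" "c \<ge> 0"
  shows "mean2 r s t + c \<le> mean2 r (s + c) (t + c)"
proof -
  define m where "m = mean2 r s t"
  have m: "m \<ge> 0" "m powr r = (s powr r + t powr r) / 2"
    using r by (simp_all add: m_def mean2_powr)
  have half: "mean2 (1 / r) (x powr r) (y powr r) = ((x + y) / 2) powr r" if "x \<ge> 0" "y \<ge> 0" for x y
    using that r by (simp add: mean2_def powr_powr)
  have "mean2 (1 / r) (s powr r + t powr r) (c powr r + c powr r)
      \<le> mean2 (1 / r) (s powr r) (c powr r) + mean2 (1 / r) (t powr r) (c powr r)"
    using r by (intro mean2_triangle) auto
  moreover have "mean2 (1 / r) (s powr r + t powr r) (c powr r + c powr r) = 2 * mean2 (1 / r) (m powr r) (c powr r)"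
  proof -
    have "s powr r + t powr r = 2 * m powr r" by (simp add: m)
    then show ?thesis using r by (subst mean2_scale [symmetric]) simp_all
  qed
  ultimately have "2 * ((m + c) / 2) powr r \<le> ((s + c) / 2) powr r + ((t + c) / 2) powr r"
    by (simp only: half nn m(1))
  then have "(m + c) powr r \<le> ((s + c) powr r + (t + c) powr r) / 2"
    using nn m by (simp add: powr_divide field_simps)
  then have "((m + c) powr r) powr (1 / r) \<le> mean2 r (s + c) (t + c)"
    unfolding mean2_def using r by (intro powr_mono2) auto
  then show ?thesis using nn m r by (simp add: powr_powr m_def)
qed

section \<open>Bonami's two-point inequality, its dual and its complex form\<close>

lemma bonami_unit:
  fixes p x :: real
  assumes p: "1 < p" "p < 2" and x: "0 \<le> x" "x \<le> 1"
  shows "1 + p * (p - 1) / 2 * x\<^sup>2 \<le> ((1 + x) powr p + (1 - x) powr p) / 2"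
proof -
  define f where "f x = ((1 + x) powr p + (1 - x) powr p) / 2 - 1 - p * (p - 1) / 2 * x\<^sup>2" for x
  define g where "g x = p / 2 * ((1 + x) powr (p - 1) - (1 - x) powr (p - 1)) - p * (p - 1) * x" for x
  have fd: "(f has_real_derivative g t) (at t)" if "0 < t" "t < 1" for t
    unfolding f_def g_def using that by (auto intro!: derivative_eq_intros simp: field_simps)
  have gd: "(g has_real_derivative (p * (p - 1) * (((1 + t) powr (p - 2) + (1 - t) powr (p - 2)) / 2 - 1))) (at t)"
    if "0 < t" "t < 1" for t
    unfolding g_def using that by (auto intro!: derivative_eq_intros simp: field_simps)
  \<comment> \<open>This is the second derivative of the difference of the two sides, whose value
    and first derivative vanish at 0. Since \<open>p - 2 < 0\<close>, the product of the two powers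
    is \<open>(1 - t\<^sup>2) powr (p - 2) \<ge> 1\<close>, so by AM-GM their mean is at least
    1.\<close>
  have gnn: "0 \<le> p * (p - 1) * (((1 + t) powr (p - 2) + (1 - t) powr (p - 2)) / 2 - 1)"
    if t: "0 < t" "t < 1" for t
  proof -
    define a b where "a = (1 + t) powr (p - 2)" and "b = (1 - t) powr (p - 2)"
    have ab: "a > 0" "b > 0" using t by (auto simp: a_def b_def)
    have "a * b = (1 - t\<^sup>2) powr (p - 2)"
      using t by (simp add: a_def b_def powr_mult [symmetric] power2_eq_square algebra_simps)
    also have "\<dots> \<ge> 1 powr (p - 2)"
      using t p by (intro powr_mono2') (auto simp: power_le_one abs_square_less_1)
    finally have "1 \<le> a * b" by simp
    moreover have "4 * (a * b) \<le> (a + b)\<^sup>2" using zero_le_power2[of "a - b"] by (simp add: power2_eq_square algebra_simps)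
    ultimately have "2\<^sup>2 \<le> (a + b)\<^sup>2" by simp
    then have "2 \<le> a + b" by (rule power2_le_imp_le) (use ab in auto)
    then show ?thesis using p by (simp add: a_def b_def)
  qed
  have gpos: "0 \<le> g t" if "0 \<le> t" "t < 1" for t
  proof -
    have "g 0 \<le> g t"
    proof (rule DERIV_nonneg_imp_increasing_open[OF that(1)])
      show "continuous_on {0..t} g" unfolding g_def using that p by (intro continuous_intros) auto
      show "\<exists>y. (g has_real_derivative y) (at x) \<and> 0 \<le> y" if "0 < x" "x < t" for x
        using gd[of x] gnn[of x] that \<open>t < 1\<close> by (intro exI conjI) auto
    qed
    then show ?thesis by (simp add: g_def)
  qed
  have "f 0 \<le> f x"
  proof (rule DERIV_nonneg_imp_increasing_open[OF x(1)])
    show "continuous_on {0..x} f" unfolding f_def using x p by (intro continuous_intros continuous_on_powr') auto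
    show "\<exists>y. (f has_real_derivative y) (at t) \<and> 0 \<le> y" if "0 < t" "t < x" for t
      using fd[of t] gpos[of t] that x by (intro exI conjI) auto
  qed
  moreover have "f 0 = 0" by (simp add: f_def)
  ultimately show ?thesis unfolding f_def by linarith
qed

text \<open>Homogeneity and symmetry reduce to \<open>a = 1\<close> and
  \<open>0 \<le> x \<le> 1\<close>, where Bernoulli's inequality for the exponent
  \<open>p / 2 \<le> 1\<close> linearises the left side and \<open>bonami_unit\<close> applies. With
  \<open>w\<^sup>2 = p - 1\<close> this says that
  \<open>a + x \<epsilon> \<mapsto> a + w x \<epsilon>\<close> is a contraction from L^p to
  L2.\<close>

lemma bonami_sq:
  fixes p a x :: real
  assumes p: "1 < p" "p < 2"
  shows "a\<^sup>2 + (p - 1) * x\<^sup>2 \<le> (mean2 p \<bar>a + x\<bar> \<bar>a - x\<bar>)\<^sup>2"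
proof -
  have unit: "1 + (p - 1) * t\<^sup>2 \<le> (mean2 p (1 + t) (1 - t))\<^sup>2" if t: "0 \<le> t" "t \<le> 1" for t
  proof -
    have "(1 + (p - 1) * t\<^sup>2) powr (p / 2) \<le> 1 + (p / 2) * ((p - 1) * t\<^sup>2)"
    proof -
      define z where "z = (p - 1) * t\<^sup>2"
      have z: "z \<ge> 0" using p by (simp add: z_def)
      have "(1 + z) powr (p / 2) = ((1 + z) powr (p / 2)) * 1 powr (1 - p / 2)" by simp
      also have "\<dots> \<le> (p / 2) * (1 + z) + (1 - p / 2) * 1"
        using p z Youngs_inequality_0[of "p / 2" "1 - p / 2" "1 + z" 1] by simp
      finally show ?thesis by (simp add: z_def algebra_simps)
    qed
    also have "\<dots> \<le> ((1 + t) powr p + (1 - t) powr p) / 2"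
    proof -
      have "p / 2 * ((p - 1) * t\<^sup>2) = p * (p - 1) / 2 * t\<^sup>2" by simp
      then show ?thesis using bonami_unit[OF p t] by (simp only:)
    qed
    also have "\<dots> = mean2 p (1 + t) (1 - t) powr p"
      using p by (simp add: mean2_powr)
    finally have "((1 + (p - 1) * t\<^sup>2) powr (p / 2)) powr (2 / p) \<le> (mean2 p (1 + t) (1 - t) powr p) powr (2 / p)"
      using p by (intro powr_mono2) auto
    moreover have "1 + (p - 1) * t\<^sup>2 > 0" using p by (intro add_pos_nonneg) auto
    ultimately show ?thesis using p by (simp add: powr_powr powr_numeral)
  qed
  have main: "u\<^sup>2 + (p - 1) * v\<^sup>2 \<le> (mean2 p (u + v) (u - v))\<^sup>2" if uv: "0 \<le> v" "v \<le> u" for u v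
  proof (cases "u = 0")
    case True
    then show ?thesis using uv by simp
  next
    case False
    then have u: "u > 0" using uv by simp
    have "mean2 p (u + v) (u - v) = mean2 p (u * (1 + v / u)) (u * (1 - v / u))"
      using u by (simp add: algebra_simps)
    also have "\<dots> = u * mean2 p (1 + v / u) (1 - v / u)"
      using u uv p by (intro mean2_scale) auto
    finally have "(mean2 p (u + v) (u - v))\<^sup>2 = u\<^sup>2 * (mean2 p (1 + v / u) (1 - v / u))\<^sup>2"
      by (simp add: power_mult_distrib)
    moreover have "u\<^sup>2 * (1 + (p - 1) * (v / u)\<^sup>2) = u\<^sup>2 + (p - 1) * v\<^sup>2"
      using u by (simp add: field_simps)
    moreover have "u\<^sup>2 * (1 + (p - 1) * (v / u)\<^sup>2) \<le> u\<^sup>2 * (mean2 p (1 + v / u) (1 - v / u))\<^sup>2"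
      using unit[of "v / u"] u uv by (intro mult_left_mono) auto
    ultimately show ?thesis by simp
  qed
  have comm: "mean2 p s t = mean2 p t s" for s t by (simp add: mean2_def add.commute)
  have abs_eq: "mean2 p \<bar>a + x\<bar> \<bar>a - x\<bar> = mean2 p (\<bar>a\<bar> + \<bar>x\<bar>) \<bar>\<bar>a\<bar> - \<bar>x\<bar>\<bar>"
  proof (cases "(a \<ge> 0) = (x \<ge> 0)")
    case True
    then have "\<bar>a + x\<bar> = \<bar>a\<bar> + \<bar>x\<bar>" "\<bar>a - x\<bar> = \<bar>\<bar>a\<bar> - \<bar>x\<bar>\<bar>" by auto
    then show ?thesis by simp
  next
    case False
    then have "\<bar>a - x\<bar> = \<bar>a\<bar> + \<bar>x\<bar>" "\<bar>a + x\<bar> = \<bar>\<bar>a\<bar> - \<bar>x\<bar>\<bar>" by auto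
    then show ?thesis by (simp add: comm)
  qed
  show ?thesis
  proof (cases "\<bar>x\<bar> \<le> \<bar>a\<bar>")
    case True
    then show ?thesis unfolding abs_eq using main[of "\<bar>x\<bar>" "\<bar>a\<bar>"] by simp
  next
    \<comment> \<open>Exchanging \<open>a\<close> and \<open>x\<close> leaves the mean unchanged
      and, as \<open>p - 1 < 1\<close>, only enlarges the left side.\<close>
    case False
    then have "a\<^sup>2 \<le> x\<^sup>2" by (simp add: abs_le_square_iff [symmetric])
    then have "0 \<le> (2 - p) * (x\<^sup>2 - a\<^sup>2)" using p by (intro mult_nonneg_nonneg) auto
    then have "a\<^sup>2 + (p - 1) * x\<^sup>2 \<le> x\<^sup>2 + (p - 1) * a\<^sup>2" by (simp add: algebra_simps)
    also have "\<dots> \<le> (mean2 p (\<bar>x\<bar> + \<bar>a\<bar>) (\<bar>x\<bar> - \<bar>a\<bar>))\<^sup>2"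
      using main[of "\<bar>a\<bar>" "\<bar>x\<bar>"] False by simp
    finally show ?thesis unfolding abs_eq using False by (simp add: add.commute)
  qed
qed

lemma mean2_holder:
  assumes pq: "p > 1" "q > 1" "1 / p + 1 / q = (1::real)" and nn: "s \<ge> 0" "t \<ge> 0" "u \<ge> 0" "v \<ge> 0"
  shows "(s * u + t * v) / 2 \<le> mean2 p s t * mean2 q u v"
proof (cases "mean2 p s t = 0 \<or> mean2 q u v = 0")
  case True
  then show ?thesis using pq by (auto simp: mean2_eq_0_iff)
next
  case False
  define A B where "A = mean2 p s t" and "B = mean2 q u v"
  have pos: "A > 0" "B > 0" using False by (auto simp: A_def B_def order.strict_iff_order)
  have AB: "s powr p + t powr p = 2 * A powr p" "u powr q + v powr q = 2 * B powr q"
    using pq by (simp_all add: A_def B_def mean2_powr)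
  have "(s / A) * (u / B) \<le> (s / A) powr p / p + (u / B) powr q / q"
       "(t / A) * (v / B) \<le> (t / A) powr p / p + (v / B) powr q / q"
    using Youngs_inequality[OF pq, of "s / A" "u / B"] Youngs_inequality[OF pq, of "t / A" "v / B"] nn pos by auto
  then have "(s / A) * (u / B) + (t / A) * (v / B)
      \<le> (s powr p + t powr p) / A powr p / p + (u powr q + v powr q) / B powr q / q"
    using nn pos by (simp add: powr_divide add_divide_distrib)
  also have "\<dots> = 2 * (1 / p + 1 / q)" unfolding AB using pos by simp
  finally have "(s / A) * (u / B) + (t / A) * (v / B) \<le> 2" using pq by simp
  then have "(s * u + t * v) / 2 \<le> A * B" using pos by (simp add: field_simps)
  then show ?thesis by (simp add: A_def B_def)
qed

text \<open>The map \<open>a + x \<epsilon> \<mapsto> a + w x \<epsilon>\<close> is self-adjoint, so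
  the contraction from L^p to L2 in \<open>bonami_sq\<close> transposes to one from L2 to L^q. The
  transposition is written out: pairing with the Hoelder extremiser, then Cauchy-Schwarz.\<close>

lemma bonami_dual_sq:
  fixes p q a y w :: real
  assumes p: "1 < p" "p < 2" and q: "1 / p + 1 / q = 1" "q > 1" and w: "w\<^sup>2 = p - 1"
  shows "(mean2 q \<bar>a + w * y\<bar> \<bar>a - w * y\<bar>)\<^sup>2 \<le> a\<^sup>2 + y\<^sup>2"
proof -
  define s t where "s = a + w * y" and "t = a - w * y"
  define N where "N = mean2 q \<bar>s\<bar> \<bar>t\<bar>"
  \<comment> \<open>The extremiser of Hoelder's inequality for \<open>(s, t)\<close>: both
    \<open>s * u\<close> and \<open>\<bar>u\<bar> powr p\<close> equal
    \<open>\<bar>s\<bar> powr q\<close>, since \<open>(q - 1) * p = q\<close>.\<close>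
  define u v where "u = sgn s * \<bar>s\<bar> powr (q - 1)" and "v = sgn t * \<bar>t\<bar> powr (q - 1)"
  define a' x' where "a' = (u + v) / 2" and "x' = (u - v) / 2"
  have absu: "\<bar>z\<bar> * \<bar>z\<bar> powr (q - 1) = \<bar>z\<bar> powr q" for z
    by (cases "z = 0") (auto simp: powr_diff)
  have su: "s * u = \<bar>s\<bar> powr q" "t * v = \<bar>t\<bar> powr q"
    unfolding absu [symmetric] u_def v_def
    by (cases "s \<ge> 0"; simp add: sgn_if) (cases "t \<ge> 0"; simp add: sgn_if)
  have "(q - 1) * p = q" using p q by (simp add: field_simps)
  then have up: "\<bar>u\<bar> powr p = \<bar>s\<bar> powr q" "\<bar>v\<bar> powr p = \<bar>t\<bar> powr q"
    by (auto simp: u_def v_def abs_mult powr_mult powr_powr sgn_if)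
  have "N powr q = (s * u + t * v) / 2" using q by (simp add: N_def mean2_powr su)
  also have "\<dots> = a * a' + y * (w * x')"
    by (simp add: a'_def x'_def s_def t_def field_simps)
  also have "\<dots> \<le> sqrt (a\<^sup>2 + y\<^sup>2) * sqrt (a'\<^sup>2 + (w * x')\<^sup>2)"
  proof -
    have "(a * a' + y * (w * x'))\<^sup>2 \<le> (a\<^sup>2 + y\<^sup>2) * (a'\<^sup>2 + (w * x')\<^sup>2)"
      using zero_le_power2[of "a * (w * x') - y * a'"] by (simp add: power2_eq_square algebra_simps)
    then show ?thesis by (metis real_le_rsqrt real_sqrt_mult)
  qed
  also have "sqrt (a'\<^sup>2 + (w * x')\<^sup>2) \<le> mean2 p \<bar>a' + x'\<bar> \<bar>a' - x'\<bar>"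
    using bonami_sq[OF p, of a' x'] by (intro real_le_lsqrt) (auto simp: power_mult_distrib w)
  also have "mean2 p \<bar>a' + x'\<bar> \<bar>a' - x'\<bar> = mean2 p \<bar>u\<bar> \<bar>v\<bar>"
    by (simp add: a'_def x'_def field_simps)
  also have "\<dots> = (N powr q) powr (1 / p)"
    using q by (simp add: mean2_def[of p] up N_def mean2_powr)
  finally have *: "N powr q \<le> sqrt (a\<^sup>2 + y\<^sup>2) * N powr (q / p)"
    by (simp add: powr_powr mult_left_mono)
  have "N \<le> sqrt (a\<^sup>2 + y\<^sup>2)"
  proof (cases "N = 0")
    case False
    then have N: "N > 0" by (simp add: N_def order.strict_iff_order)
    have "q = 1 + q / p" using p q by (simp add: field_simps)
    then have "N powr q = N * N powr (q / p)" using N by (metis powr_add powr_one less_imp_le)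
    then show ?thesis using * N by simp
  qed simp
  then show ?thesis using q sqrt_le_D
    by (metis N_def s_def t_def mean2_nonneg power_mono real_sqrt_pow2 sum_power2_ge_zero)
qed

text \<open>Multiplication by \<open>\<i>\<close> puts \<open>y = Im b\<close> next to
  \<open>a\<close> on the left, while on the right \<open>x = Re b\<close> stands there. Minkowski
  at exponent \<open>q / 2 \<ge> 1\<close> pulls \<open>x\<close> out, \<open>bonami_dual_sq\<close>
  settles \<open>y\<close>, \<open>bonami_sq\<close> moves \<open>x\<close> next to
  \<open>a\<close>, and the reverse inequality at exponent \<open>p / 2 \<le> 1\<close> pulls
  \<open>y\<close> back in.\<close>

lemma two_point_real:
  fixes p q a w :: real and b :: complex
  assumes p: "1 < p" "p < 2" and q: "1 / p + 1 / q = 1" "q > 1" and w: "w\<^sup>2 = p - 1"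
  shows "mean2 q (cmod (of_real a - \<i> * w * b)) (cmod (of_real a + \<i> * w * b))
       \<le> mean2 p (cmod (of_real a + b)) (cmod (of_real a - b))"
proof -
  define x y where "x = Re b" and "y = Im b"
  have "2 * (p - 1) \<le> q * (p - 1)" using p q by (simp add: field_simps)
  then have q2: "q \<ge> 2" using p mult_le_cancel_right_pos[of "p - 1" 2 q] by linarith
  have half: "mean2 r (sqrt s) (sqrt t) ^ 2 = mean2 (r / 2) s t" if "s \<ge> 0" "t \<ge> 0" "r > 0" for r s t
    using that by (simp add: mean2_def powr_powr powr_half_sqrt [symmetric] powr_numeral [symmetric])
  have sq: "mean2 r \<bar>s\<bar> \<bar>t\<bar> ^ 2 = mean2 (r / 2) (s\<^sup>2) (t\<^sup>2)" if "r > 0" for r s t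
    using half[of "s\<^sup>2" "t\<^sup>2" r] that by simp
  have "(mean2 q (cmod (of_real a - \<i> * w * b)) (cmod (of_real a + \<i> * w * b)))\<^sup>2
      = mean2 (q / 2) ((a + w * y)\<^sup>2 + w\<^sup>2 * x\<^sup>2) ((a - w * y)\<^sup>2 + w\<^sup>2 * x\<^sup>2)"
    unfolding cmod_def using q by (subst half) (auto simp: x_def y_def power_mult_distrib)
  also have "\<dots> \<le> mean2 (q / 2) ((a + w * y)\<^sup>2) ((a - w * y)\<^sup>2) + mean2 (q / 2) (w\<^sup>2 * x\<^sup>2) (w\<^sup>2 * x\<^sup>2)"
    using q2 by (intro mean2_triangle) auto
  also have "\<dots> = (mean2 q \<bar>a + w * y\<bar> \<bar>a - w * y\<bar>)\<^sup>2 + (p - 1) * x\<^sup>2"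
    using q p by (simp add: sq w)
  also have "\<dots> \<le> a\<^sup>2 + y\<^sup>2 + (p - 1) * x\<^sup>2"
    using bonami_dual_sq[OF p q w] by simp
  also have "\<dots> \<le> (mean2 p \<bar>a + x\<bar> \<bar>a - x\<bar>)\<^sup>2 + y\<^sup>2"
    using bonami_sq[OF p, of a x] by simp
  also have "\<dots> = mean2 (p / 2) ((a + x)\<^sup>2) ((a - x)\<^sup>2) + y\<^sup>2"
    using p by (simp add: sq)
  also have "\<dots> \<le> mean2 (p / 2) ((a + x)\<^sup>2 + y\<^sup>2) ((a - x)\<^sup>2 + y\<^sup>2)"
    using p by (intro mean2_triangle_reverse) auto
  also have "\<dots> = (mean2 p (cmod (of_real a + b)) (cmod (of_real a - b)))\<^sup>2"
    unfolding cmod_def using p by (subst half) (auto simp: x_def y_def)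
  finally show ?thesis by (rule power2_le_imp_le) simp
qed

text \<open>All moduli are invariant under a common rotation, so \<open>a\<close> may be taken real
  and nonnegative. For \<open>a = 0\<close> the rotation is set to 1, since \<open>sgn 0 = 0\<close>
  is not unimodular.\<close>

lemma two_point:
  fixes p q w :: real and a b :: complex
  assumes p: "1 < p" "p < 2" and q: "1 / p + 1 / q = 1" "q > 1" and w: "w\<^sup>2 = p - 1"
  shows "mean2 q (cmod (a - \<i> * w * b)) (cmod (a + \<i> * w * b)) \<le> mean2 p (cmod (a + b)) (cmod (a - b))"
proof -
  define c where "c = (if a = 0 then 1 else cnj (sgn a))"
  have c: "cmod c = 1" by (simp add: c_def norm_sgn)
  have ca: "c * a = of_real (cmod a)"
    by (simp add: c_def sgn_eq complex_norm_square [symmetric] mult.commute[of "cnj a"] power2_eq_square)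
  have "cmod (a + z) = cmod (of_real (cmod a) + c * z)" for z
    using c by (metis (no_types) ca distrib_left mult_1 norm_mult)
  moreover have "cmod (a - z) = cmod (of_real (cmod a) - c * z)" for z
    using c by (metis (no_types) ca right_diff_distrib mult_1 norm_mult)
  ultimately show ?thesis
    using two_point_real[OF p q w, of "cmod a" "c * b"] by (simp add: mult.assoc mult.left_commute)
qed

subsection \<open>Tensorization over the discrete cube\<close>

abbreviation cube :: "nat \<Rightarrow> bool list set" where "cube n \<equiv> {x. length x = n}"

definition cube_mean :: "nat \<Rightarrow> (bool list \<Rightarrow> 'a::real_normed_field) \<Rightarrow> 'a" where
  "cube_mean n F = (\<Sum>x\<in>cube n. F x) / 2 ^ n"

lemma finite_cube [simp]: "finite (cube n)"
  using finite_lists_length_eq[of "UNIV :: bool set" n] by simp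

lemma cube_mean_0 [simp]: "cube_mean 0 F = F []"
  by (simp add: cube_mean_def)

lemma cube_mean_Suc:
  "cube_mean (Suc n) F = (cube_mean n (\<lambda>x. F (True # x)) + cube_mean n (\<lambda>x. F (False # x))) / 2"
proof -
  have "cube (Suc n) = Cons True ` cube n \<union> Cons False ` cube n"
    by (auto simp: length_Suc_conv image_iff)
  moreover have "(\<Sum>x\<in>Cons True ` cube n \<union> Cons False ` cube n. F x)
      = (\<Sum>x\<in>cube n. F (True # x)) + (\<Sum>x\<in>cube n. F (False # x))"
    by (subst sum.union_disjoint) (auto simp: sum.reindex)
  ultimately show ?thesis by (simp add: cube_mean_def add_divide_distrib mult.commute)
qed

lemma cube_mean_mono:
  fixes F :: "bool list \<Rightarrow> real"
  shows "(\<And>x. F x \<le> G x) \<Longrightarrow> cube_mean n F \<le> cube_mean n G"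
  unfolding cube_mean_def by (intro divide_right_mono sum_mono) auto

lemma cube_mean_nonneg:
  fixes F :: "bool list \<Rightarrow> real"
  shows "(\<And>x. 0 \<le> F x) \<Longrightarrow> 0 \<le> cube_mean n F"
  unfolding cube_mean_def by (intro divide_nonneg_nonneg sum_nonneg) auto

lemma cube_mean_add: "cube_mean n (\<lambda>x. F x + G x) = cube_mean n F + cube_mean n G"
  by (simp add: cube_mean_def sum.distrib add_divide_distrib)

lemma cube_mean_mult: "cube_mean n (\<lambda>x. c * F x) = c * cube_mean n F"
  by (simp add: cube_mean_def sum_distrib_left)

lemma card_cube: "card (cube n) = 2 ^ n"
  using card_lists_length_eq[of "UNIV :: bool set" n] by simp

lemma cube_mean_const [simp]: "cube_mean n (\<lambda>_. c) = c"
  by (simp add: cube_mean_def card_cube)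

text \<open>Minkowski's integral inequality, by repeated use of the triangle inequality. It
  exchanges the mean over the first coordinate with the mean over the others in
  \<open>cube_form_bound\<close>, at exponent \<open>q / p\<close>.\<close>

lemma mean2_cube_mean:
  assumes r: "r \<ge> 1" and nn: "\<And>x. F x \<ge> 0" "\<And>x. G x \<ge> 0"
  shows "mean2 r (cube_mean n F) (cube_mean n G) \<le> cube_mean n (\<lambda>x. mean2 r (F x) (G x))"
  using nn
proof (induction n arbitrary: F G)
  case (Suc n)
  have "mean2 r (cube_mean (Suc n) F) (cube_mean (Suc n) G)
     = (1 / 2) * mean2 r (cube_mean n (\<lambda>x. F (True # x)) + cube_mean n (\<lambda>x. F (False # x)))
          (cube_mean n (\<lambda>x. G (True # x)) + cube_mean n (\<lambda>x. G (False # x)))"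
    using r Suc.prems by (subst mean2_scale [symmetric]) (auto simp: cube_mean_Suc cube_mean_nonneg)
  also have "\<dots> \<le> (1 / 2) * (mean2 r (cube_mean n (\<lambda>x. F (True # x))) (cube_mean n (\<lambda>x. G (True # x)))
      + mean2 r (cube_mean n (\<lambda>x. F (False # x))) (cube_mean n (\<lambda>x. G (False # x))))"
    using r Suc.prems by (intro mult_left_mono mean2_triangle) (auto simp: cube_mean_nonneg)
  also have "\<dots> \<le> (1 / 2) * (cube_mean n (\<lambda>x. mean2 r (F (True # x)) (G (True # x)))
      + cube_mean n (\<lambda>x. mean2 r (F (False # x)) (G (False # x))))"
    using Suc by (intro mult_left_mono add_mono Suc.IH) auto
  finally show ?case by (simp add: cube_mean_Suc)
qed simp

text \<open>The pairing of \<open>G\<close> with the image of \<open>F\<close> under the n-fold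
  tensor power of \<open>a + b \<epsilon> \<mapsto> a - \<i> w b \<epsilon>\<close>, averaged over
  the cube. Splitting off the first coordinate keeps the tensor power implicit and is the form in
  which the inductions use it.\<close>

primrec cube_form :: "nat \<Rightarrow> real \<Rightarrow> (bool list \<Rightarrow> complex) \<Rightarrow> (bool list \<Rightarrow> complex) \<Rightarrow> complex" where
  "cube_form 0 w F G = F [] * G []"
| "cube_form (Suc n) w F G =
    (cube_form n w (\<lambda>x. (F (True # x) + F (False # x)) / 2 - \<i> * w * ((F (True # x) - F (False # x)) / 2)) (\<lambda>x. G (True # x))
   + cube_form n w (\<lambda>x. (F (True # x) + F (False # x)) / 2 + \<i> * w * ((F (True # x) - F (False # x)) / 2)) (\<lambda>x. G (False # x))) / 2"

text \<open>The induction hypothesis bounds both halves and Hoelder's inequality on two points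
  combines them. What remains is the two-point L^q norm of the L^p norms of \<open>H\<close> and
  \<open>K\<close>; as \<open>q \<ge> p\<close>, Minkowski moves it inside, where
  \<open>two_point\<close> applies at every \<open>x\<close>.\<close>

theorem cube_form_bound:
  fixes p q w :: real
  assumes p: "1 < p" "p < 2" and q: "1 / p + 1 / q = 1" "q > 1" and w: "w\<^sup>2 = p - 1"
  shows "cmod (cube_form n w F G)
    \<le> cube_mean n (\<lambda>x. cmod (F x) powr p) powr (1 / p) * cube_mean n (\<lambda>x. cmod (G x) powr p) powr (1 / p)"
proof (induction n arbitrary: F G)
  case 0
  then show ?case using p by (simp add: powr_powr norm_mult)
next
  case (Suc n)
  define L where "L F = cube_mean n (\<lambda>x. cmod (F x) powr p) powr (1 / p)" for F
  define a b where "a x = (F (True # x) + F (False # x)) / 2" and "b x = (F (True # x) - F (False # x)) / 2" for x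
  have ab: "a x + b x = F (True # x)" "a x - b x = F (False # x)" for x
    by (auto simp: a_def b_def field_simps)
  define H K where "H x = a x - \<i> * w * b x" and "K x = a x + \<i> * w * b x" for x
  have "2 * (p - 1) \<le> q * (p - 1)" using p q by (simp add: field_simps)
  then have qp: "q / p \<ge> 1" using p mult_le_cancel_right_pos[of "p - 1" 2 q] by simp
  have Lp: "L F powr p = cube_mean n (\<lambda>x. cmod (F x) powr p)" for F
    using p by (simp add: L_def powr_powr cube_mean_nonneg)
  have L0: "L F \<ge> 0" for F by (simp add: L_def)
  have "cmod (cube_form (Suc n) w F G)
      \<le> (cmod (cube_form n w H (\<lambda>x. G (True # x))) + cmod (cube_form n w K (\<lambda>x. G (False # x)))) / 2"
    unfolding cube_form.simps H_def K_def a_def b_def norm_divide norm_numeral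
    by (intro divide_right_mono norm_triangle_ineq) auto
  also have "\<dots> \<le> (L H * L (\<lambda>x. G (True # x)) + L K * L (\<lambda>x. G (False # x))) / 2"
    using Suc.IH unfolding L_def by (intro divide_right_mono add_mono) auto
  also have "\<dots> \<le> mean2 q (L H) (L K) * mean2 p (L (\<lambda>x. G (True # x))) (L (\<lambda>x. G (False # x)))"
    using mean2_holder[of q p "L H" "L K" "L (\<lambda>x. G (True # x))" "L (\<lambda>x. G (False # x))"] p q L0
    by (simp add: add.commute)
  also have "mean2 p (L (\<lambda>x. G (True # x))) (L (\<lambda>x. G (False # x)))
      = cube_mean (Suc n) (\<lambda>x. cmod (G x) powr p) powr (1 / p)"
    by (simp add: mean2_def Lp cube_mean_Suc)
  also have "mean2 q (L H) (L K) \<le> cube_mean (Suc n) (\<lambda>x. cmod (F x) powr p) powr (1 / p)"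
  proof -
    have conv: "mean2 q s t = mean2 (q / p) (s powr p) (t powr p) powr (1 / p)" for s t
      using p q by (simp add: mean2_def powr_powr)
    have "mean2 (q / p) (L H powr p) (L K powr p)
        \<le> cube_mean n (\<lambda>x. mean2 (q / p) (cmod (H x) powr p) (cmod (K x) powr p))"
      unfolding Lp by (rule mean2_cube_mean[OF qp]) auto
    also have "\<dots> = cube_mean n (\<lambda>x. mean2 q (cmod (H x)) (cmod (K x)) powr p)"
      unfolding conv using p by (simp add: powr_powr)
    also have "\<dots> \<le> cube_mean n (\<lambda>x. mean2 p (cmod (F (True # x))) (cmod (F (False # x))) powr p)"
      using two_point[OF p q w, of "a x" "b x" for x] p unfolding ab H_def K_def
      by (intro cube_mean_mono powr_mono2) auto
    also have "\<dots> = cube_mean (Suc n) (\<lambda>x. cmod (F x) powr p)"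
      using p cube_mean_mult[of n "1/2" "\<lambda>x. cmod (F (True # x)) powr p + cmod (F (False # x)) powr p"]
      by (simp add: mean2_powr cube_mean_Suc cube_mean_add)
    finally show ?thesis unfolding conv using p by (intro powr_mono2) auto
  qed
  finally show ?case by (simp add: mult_right_mono)
qed

lemma cube_form_scale: "cube_form n w (\<lambda>x. c * F x) (\<lambda>x. d * G x) = c * d * cube_form n w F G"
proof (induction n arbitrary: F G)
  case (Suc n)
  have *: "(c * s + c * t) / 2 - \<i> * w * ((c * s - c * t) / 2) = c * ((s + t) / 2 - \<i> * w * ((s - t) / 2))"
    "(c * s + c * t) / 2 + \<i> * w * ((c * s - c * t) / 2) = c * ((s + t) / 2 + \<i> * w * ((s - t) / 2))" for s t
    by (simp_all add: field_simps)
  show ?case by (simp only: cube_form.simps * Suc) (simp add: field_simps)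
qed simp

lemma cube_form_add_left: "cube_form n w (\<lambda>x. F x + F' x) G = cube_form n w F G + cube_form n w F' G"
proof (induction n arbitrary: F F' G)
  case (Suc n)
  have *: "((s + s') + (t + t')) / 2 - \<i> * w * (((s + s') - (t + t')) / 2)
      = ((s + t) / 2 - \<i> * w * ((s - t) / 2)) + ((s' + t') / 2 - \<i> * w * ((s' - t') / 2))"
    "((s + s') + (t + t')) / 2 + \<i> * w * (((s + s') - (t + t')) / 2)
      = ((s + t) / 2 + \<i> * w * ((s - t) / 2)) + ((s' + t') / 2 + \<i> * w * ((s' - t') / 2))" for s t s' t'
    by (simp_all add: field_simps)
  show ?case by (simp only: cube_form.simps * Suc) (simp add: field_simps)
qed (simp add: algebra_simps)

lemma cube_form_add_right: "cube_form n w F (\<lambda>x. G x + G' x) = cube_form n w F G + cube_form n w F G'"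
proof (induction n arbitrary: F G G')
  case (Suc n)
  show ?case by (simp only: cube_form.simps Suc) (simp add: field_simps)
qed (simp add: algebra_simps)

lemma cube_form_0_left: "cube_form n w (\<lambda>x. 0) G = 0"
  using cube_form_scale[of n w 0 "\<lambda>_. 0" 1 G] by simp

lemma cube_form_0_right: "cube_form n w F (\<lambda>x. 0) = 0"
  using cube_form_scale[of n w 1 F 0 "\<lambda>_. 0"] by simp

lemma cube_form_sum_left:
  "finite A \<Longrightarrow> cube_form n w (\<lambda>x. \<Sum>j\<in>A. F j x) G = (\<Sum>j\<in>A. cube_form n w (F j) G)"
  by (induction A rule: finite_induct) (simp_all add: cube_form_0_left cube_form_add_left)

lemma cube_form_sum_right:
  "finite A \<Longrightarrow> cube_form n w F (\<lambda>x. \<Sum>j\<in>A. G j x) = (\<Sum>j\<in>A. cube_form n w F (G j))"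
  by (induction A rule: finite_induct) (simp_all add: cube_form_0_right cube_form_add_right)

section \<open>Product functions on the cube and the sum of the signs\<close>

primrec char_prod :: "complex \<Rightarrow> bool list \<Rightarrow> complex" where
  "char_prod z [] = 1"
| "char_prod z (b # x) = (if b then 1 + z else 1 - z) * char_prod z x"

text \<open>Everything factorises over the coordinates: \<open>1 + z \<epsilon>\<close> goes to
  \<open>1 - \<i> w z \<epsilon>\<close>, whose mean against \<open>1 + v \<epsilon>\<close> is
  \<open>1 - \<i> w z v\<close>.\<close>

lemma cube_form_char_prod: "cube_form n w (char_prod z) (char_prod v) = (1 - \<i> * w * z * v) ^ n"
proof (induction n)
  case (Suc n)
  have *: "((1 + z) * s + (1 - z) * s) / 2 - \<i> * w * (((1 + z) * s - (1 - z) * s) / 2) = (1 - \<i> * w * z) * s"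
    "((1 + z) * s + (1 - z) * s) / 2 + \<i> * w * (((1 + z) * s - (1 - z) * s) / 2) = (1 + \<i> * w * z) * s" for s
    by (simp_all add: field_simps)
  show ?case
    by (simp only: cube_form.simps char_prod.simps if_True if_False * cube_form_scale Suc) (simp add: field_simps)
qed simp

primrec walk :: "bool list \<Rightarrow> real" where
  "walk [] = 0"
| "walk (b # x) = (if b then 1 else - 1) + walk x"

lemma cube_mean_walk_sq: "cube_mean n (\<lambda>x. (walk x)\<^sup>2) = n"
proof (induction n)
  case (Suc n)
  have "cube_mean (Suc n) (\<lambda>x. (walk x)\<^sup>2)
      = (cube_mean n (\<lambda>x. (1 + walk x)\<^sup>2) + cube_mean n (\<lambda>x. (- 1 + walk x)\<^sup>2)) / 2"
    by (simp add: cube_mean_Suc)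
  also have "\<dots> = cube_mean n (\<lambda>x. (1 / 2) * ((1 + walk x)\<^sup>2 + (- 1 + walk x)\<^sup>2))"
    by (simp only: cube_mean_mult cube_mean_add)
  also have "(\<lambda>x. (1 / 2) * ((1 + walk x)\<^sup>2 + (- 1 + walk x)\<^sup>2)) = (\<lambda>x. 1 + (walk x)\<^sup>2)"
    by (simp add: fun_eq_iff power2_eq_square algebra_simps)
  finally show ?case by (simp add: cube_mean_add Suc)
qed simp

lemma cube_mean_cis_walk: "cube_mean n (\<lambda>x. cis (t * walk x)) = of_real (cos t) ^ n"
proof (induction n)
  case (Suc n)
  have "cis (t * (1 + s)) = cis t * cis (t * s)" "cis (t * (- 1 + s)) = cis (- t) * cis (t * s)" for s
    by (simp_all add: cis_mult algebra_simps)
  then have "cube_mean (Suc n) (\<lambda>x. cis (t * walk x)) = (cis t + cis (- t)) / 2 * of_real (cos t) ^ n"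
    by (simp only: cube_mean_Suc walk.simps if_True if_False cube_mean_mult Suc) (simp add: algebra_simps add_divide_distrib)
  also have "(cis t + cis (- t)) / 2 = of_real (cos t)" by (simp add: complex_eq_iff)
  finally show ?case by simp
qed simp

text \<open>The factors \<open>1 + \<i> y\<close> and \<open>1 - \<i> y\<close> share their modulus
  and have the arguments \<open>arctan y\<close> and \<open>- arctan y\<close>. Hence the product
  depends on \<open>x\<close> only through its length and its walk, which lets the central limit
  theorem act.\<close>

lemma char_prod_imaginary:
  "char_prod (\<i> * of_real y) x = of_real (sqrt (1 + y\<^sup>2)) ^ length x * cis (arctan y * walk x)"
proof (induction x)
  case (Cons b x)
  have pos: "sqrt (1 + y\<^sup>2) \<noteq> 0" by (smt (verit) real_sqrt_eq_zero_cancel_iff zero_le_power2)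
  have "1 + \<i> * of_real y = of_real (sqrt (1 + y\<^sup>2)) * cis (arctan y)"
    "1 - \<i> * of_real y = of_real (sqrt (1 + y\<^sup>2)) * cis (- arctan y)"
    using pos by (auto simp: complex_eq_iff cos_arctan sin_arctan)
  moreover have "cis (arctan y * (1 + s)) = cis (arctan y) * cis (arctan y * s)"
    "cis (arctan y * (- 1 + s)) = cis (- arctan y) * cis (arctan y * s)" for s
    by (simp_all add: cis_mult algebra_simps)
  ultimately show ?case using Cons by (cases b) (simp_all only: char_prod.simps walk.simps if_True if_False list.size, simp_all)
qed simp

subsection \<open>Passage to the Gaussian limit\<close>

lemma sqrt_mult_arctan_tendsto: "(\<lambda>n::nat. sqrt n * arctan (y / sqrt n)) \<longlonglongrightarrow> y"
proof -
  consider "y = 0" | "y > 0" | "y < 0" by linarith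
  then show ?thesis by cases (simp, real_asymp+)
qed

lemma sqrt_power_tendsto_exp: "(\<lambda>n::nat. sqrt (1 + (y / sqrt n)\<^sup>2) ^ n) \<longlonglongrightarrow> exp (y\<^sup>2 / 2)"
proof -
  consider "y = 0" | "y > 0" | "y < 0" by linarith
  then show ?thesis by cases (simp, real_asymp+)
qed

lemma cos_power_tendsto_exp: "(\<lambda>n::nat. cos (y / sqrt n) ^ n) \<longlonglongrightarrow> exp (- y\<^sup>2 / 2)"
proof -
  have "(\<lambda>n::nat. cos (y / sqrt n) ^ n) \<longlonglongrightarrow> exp (- (y * y / 2))"
  proof -
    consider "y = 0" | "y > 0" | "y < 0" by linarith
    then show ?thesis by cases (simp, real_asymp+)
  qed
  then show ?thesis by (simp add: power2_eq_square)
qed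

lemma isCont_cis: "isCont cis x"
  unfolding cis_conv_exp by (intro continuous_intros)

lemma borel_measurable_cis [measurable]: "cis \<in> borel_measurable borel"
  by (intro borel_measurable_continuous_onI continuous_at_imp_continuous_on ballI isCont_cis)

text \<open>In polar form the modulus \<open>sqrt (1 + (y / n)\<^sup>2) ^ n\<close> tends to 1 and
  the argument \<open>n * arctan (y / n)\<close> to \<open>y\<close>.\<close>

lemma power_imaginary_tendsto_cis: "(\<lambda>n::nat. (1 + \<i> * of_real (y / n)) ^ n) \<longlonglongrightarrow> cis y"
proof -
  have a: "(\<lambda>n::nat. n * arctan (y / n)) \<longlonglongrightarrow> y"
  proof -
    consider "y = 0" | "y > 0" | "y < 0" by linarith
    then show ?thesis by cases (simp, real_asymp+)
  qed
  have r: "(\<lambda>n::nat. sqrt (1 + (y / n)\<^sup>2) ^ n) \<longlonglongrightarrow> 1"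
  proof -
    consider "y = 0" | "y > 0" | "y < 0" by linarith
    then show ?thesis by cases (simp, real_asymp+)
  qed
  have eq: "(1 + \<i> * of_real u) ^ n = of_real (sqrt (1 + u\<^sup>2) ^ n) * cis (n * arctan u)" for u and n :: nat
  proof -
    have pos: "sqrt (1 + u\<^sup>2) \<noteq> 0" by (smt (verit) real_sqrt_eq_zero_cancel_iff zero_le_power2)
    have "1 + \<i> * of_real u = of_real (sqrt (1 + u\<^sup>2)) * cis (arctan u)"
      using pos by (auto simp: complex_eq_iff cos_arctan sin_arctan)
    then show ?thesis by (simp only: power_mult_distrib Complex.DeMoivre of_real_power)
  qed
  have "(\<lambda>n::nat. of_real (sqrt (1 + (y / n)\<^sup>2) ^ n) * cis (n * arctan (y / n))) \<longlonglongrightarrow> of_real 1 * cis y"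
    by (intro tendsto_mult tendsto_of_real r isCont_tendsto_compose[OF _ a] isCont_cis)
  then show ?thesis unfolding eq by simp
qed

section \<open>The central limit theorem for the normalised walk\<close>

definition walk_distr :: "nat \<Rightarrow> real measure" where
  "walk_distr n = distr (measure_pmf (pmf_of_set (cube n))) borel (\<lambda>x. walk x / sqrt n)"

lemma cube_nonempty [simp]: "cube n \<noteq> {}"
  using Ex_list_of_length by auto

lemma integral_walk_distr:
  fixes h :: "real \<Rightarrow> 'a::{banach, second_countable_topology, real_normed_field}"
  assumes [measurable]: "h \<in> borel_measurable borel"
  shows "integral\<^sup>L (walk_distr n) h = cube_mean n (\<lambda>x. h (walk x / sqrt n))"
proof -
  have "integral\<^sup>L (walk_distr n) h = measure_pmf.expectation (pmf_of_set (cube n)) (\<lambda>x. h (walk x / sqrt n))"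
    unfolding walk_distr_def by (subst integral_distr) auto
  also have "\<dots> = cube_mean n (\<lambda>x. h (walk x / sqrt n))"
    by (subst integral_measure_pmf[where A = "cube n"])
      (simp_all add: pmf_of_set[OF cube_nonempty finite_cube] set_pmf_of_set[OF cube_nonempty finite_cube]
        cube_mean_def card_cube scaleR_conv_of_real sum_divide_distrib)
  finally show ?thesis .
qed

lemma walk_distr_weak_conv: "weak_conv_m walk_distr std_normal_distribution"
proof (rule levy_continuity)
  show "real_distribution (walk_distr n)" for n
    unfolding walk_distr_def by (intro prob_space.real_distribution_distr measure_pmf.prob_space_axioms) auto
  show "real_distribution std_normal_distribution" by (rule real_dist_normal_dist)
  have "char (walk_distr n) t = of_real (cos (t / sqrt n) ^ n)" for n t
    unfolding char_def cis_conv_exp [symmetric]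
    by (subst integral_walk_distr) (use cube_mean_cis_walk[of n "t / sqrt n"] in auto)
  then show "(\<lambda>n. char (walk_distr n) t) \<longlonglongrightarrow> char std_normal_distribution t" for t
    unfolding char_std_normal_distribution by (simp only: tendsto_of_real cos_power_tendsto_exp)
qed

lemma abs_powr_diff_le:
  fixes u v K p :: real
  assumes "p \<ge> 1" "0 \<le> u" "u \<le> K" "0 \<le> v" "v \<le> K"
  shows "\<bar>u powr p - v powr p\<bar> \<le> p * K powr (p - 1) * \<bar>u - v\<bar>"
proof -
  have *: "b powr p - a powr p \<le> p * K powr (p - 1) * (b - a)" if ab: "0 \<le> a" "a < b" "b \<le> K" for a b
  proof -
    have "continuous_on {a..b} (\<lambda>x. x powr p)" using that assms(1) by (intro continuous_on_powr' continuous_intros) auto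
    moreover have "((\<lambda>x. x powr p) has_real_derivative (p * x powr (p - 1))) (at x)" if "a < x" for x
      using that \<open>0 \<le> a\<close> by (auto intro!: derivative_eq_intros)
    ultimately obtain z where z: "a < z" "z < b" "b powr p - a powr p = p * z powr (p - 1) * (b - a)"
      using mvt[of a b "\<lambda>x. x powr p" "\<lambda>x. (*) (p * x powr (p - 1))"] ab(2)
      by (auto simp: has_field_derivative_def)
    moreover have "z powr (p - 1) \<le> K powr (p - 1)" using z that assms by (intro powr_mono2) auto
    ultimately show ?thesis using that assms(1) by (simp add: mult_left_mono mult_right_mono)
  qed
  show ?thesis
  proof (cases u v rule: linorder_cases)
    case less
    then have "u powr p \<le> v powr p" using assms by (intro powr_mono2) auto
    then show ?thesis using *[of u v] less assms by simp
  next
    case greater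
    then have "v powr p \<le> u powr p" using assms by (intro powr_mono2) auto
    then show ?thesis using *[of v u] greater assms by simp
  qed simp
qed

lemma cis_diff_le: "cmod (cis a - cis b) \<le> \<bar>a - b\<bar>"
proof -
  have "cis a - cis b = cis b * (cis (a - b) - 1)" by (simp add: cis_mult algebra_simps)
  then have "cmod (cis a - cis b) = cmod (iexp (a - b) - 1)" by (simp add: norm_mult cis_conv_exp)
  also have "\<dots> \<le> \<bar>a - b\<bar>" using iexp_approx1[of "a - b" 0] by simp
  finally show ?thesis .
qed

text \<open>From \<open>\<bar>t\<bar> \<le> (1 + t\<^sup>2) / 2\<close> and unit variance. The
  replacement error in \<open>cube_mean_powr_tendsto_gaussian\<close> grows linearly with the walk;
  this moment keeps it small on average.\<close>

lemma cube_mean_abs_walk: "cube_mean n (\<lambda>x. \<bar>walk x / sqrt n\<bar>) \<le> 1"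
proof (cases "n = 0")
  case False
  have "\<bar>t\<bar> \<le> (1 + t\<^sup>2) / 2" for t :: real
    using zero_le_power2[of "\<bar>t\<bar> - 1"] by (simp add: power2_eq_square algebra_simps)
  then have "cube_mean n (\<lambda>x. \<bar>walk x / sqrt n\<bar>) \<le> cube_mean n (\<lambda>x. (1 / 2) * (1 + (1 / n) * (walk x)\<^sup>2))"
    by (intro cube_mean_mono) (metis (no_types, opaque_lifting) divide_inverse mult.commute mult_1 of_nat_0_le_iff power_divide real_sqrt_pow2)
  also have "\<dots> = 1" using False by (simp only: cube_mean_mult cube_mean_add cube_mean_walk_sq cube_mean_const) simp
  finally show ?thesis .
qed simp

text \<open>By \<open>char_prod_imaginary\<close> each product has modulus near
  \<open>exp (\<theta>\<^sup>2 / 2)\<close> and argument near \<open>\<theta>\<close> times the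
  normalised walk. Replacing it by this limit leaves a bounded continuous function of the walk, to
  which weak convergence applies. The limit is the Hermite generating function
  \<open>exp (z * t - z\<^sup>2 / 2)\<close> at \<open>z = \<i> * \<theta>\<close>.\<close>

lemma cube_mean_powr_tendsto_gaussian:
  fixes c :: "'i \<Rightarrow> complex" and \<theta> :: "'i \<Rightarrow> real"
  assumes p: "p \<ge> 1" and A: "finite A"
  shows "(\<lambda>n. cube_mean n (\<lambda>x. cmod (\<Sum>j\<in>A. c j * char_prod (\<i> * of_real (\<theta> j / sqrt n)) x) powr p))
    \<longlonglongrightarrow> (\<integral>t. cmod (\<Sum>j\<in>A. c j * of_real (exp ((\<theta> j)\<^sup>2 / 2)) * cis (\<theta> j * t)) powr p \<partial>std_normal_distribution)"
proof -
  define F where "F t = (\<Sum>j\<in>A. c j * of_real (exp ((\<theta> j)\<^sup>2 / 2)) * cis (\<theta> j * t))" for t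
  define Fn where "Fn n x = (\<Sum>j\<in>A. c j * char_prod (\<i> * of_real (\<theta> j / sqrt n)) x)" for n :: nat and x
  define R where "R n j = sqrt (1 + (\<theta> j / sqrt n)\<^sup>2) ^ n" for n :: nat and j
  define al where "al n j = sqrt n * arctan (\<theta> j / sqrt n)" for n :: nat and j
  \<comment> \<open>The summand 1 makes \<open>K\<close> a bound not only for \<open>F\<close> but
    eventually also for all values of \<open>Fn\<close>.\<close>
  define K where "K = (\<Sum>j\<in>A. cmod (c j) * (exp ((\<theta> j)\<^sup>2 / 2) + 1))"
  \<comment> \<open>\<open>D\<close> collects the errors in modulus and \<open>B\<close> those in
    phase; the latter get multiplied by the size of the walk.\<close>
  define D where "D n = (\<Sum>j\<in>A. cmod (c j) * \<bar>R n j - exp ((\<theta> j)\<^sup>2 / 2)\<bar>)" for n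
  define B where "B n = (\<Sum>j\<in>A. cmod (c j) * exp ((\<theta> j)\<^sup>2 / 2) * \<bar>al n j - \<theta> j\<bar>)" for n
  have Rlim: "(\<lambda>n. R n j) \<longlonglongrightarrow> exp ((\<theta> j)\<^sup>2 / 2)" for j unfolding R_def by (rule sqrt_power_tendsto_exp)
  have allim: "(\<lambda>n. al n j) \<longlonglongrightarrow> \<theta> j" for j unfolding al_def by (rule sqrt_mult_arctan_tendsto)
  have "D \<longlonglongrightarrow> (\<Sum>j\<in>A. cmod (c j) * \<bar>exp ((\<theta> j)\<^sup>2 / 2) - exp ((\<theta> j)\<^sup>2 / 2)\<bar>)"
    unfolding D_def by (intro tendsto_intros Rlim)
  then have Dlim: "D \<longlonglongrightarrow> 0" by simp
  have "B \<longlonglongrightarrow> (\<Sum>j\<in>A. cmod (c j) * exp ((\<theta> j)\<^sup>2 / 2) * \<bar>\<theta> j - \<theta> j\<bar>)"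
    unfolding B_def by (intro tendsto_intros allim)
  then have Blim: "B \<longlonglongrightarrow> 0" by simp
  have K0: "0 \<le> K" unfolding K_def by (intro sum_nonneg) (auto intro: add_nonneg_nonneg)
  have Fbd: "cmod (F t) \<le> K" for t
    unfolding F_def K_def by (intro sum_norm_le) (auto simp: norm_mult intro!: mult_left_mono)
  have Fcont: "isCont F t" for t unfolding F_def
    by (intro continuous_intros isCont_o2[OF _ isCont_cis])
  have Fmeas [measurable]: "F \<in> borel_measurable borel"
    using Fcont by (intro borel_measurable_continuous_onI) (simp add: continuous_at_imp_continuous_on)
  have weak: "(\<lambda>n. cube_mean n (\<lambda>x. cmod (F (walk x / sqrt n)) powr p))
      \<longlonglongrightarrow> (\<integral>t. cmod (F t) powr p \<partial>std_normal_distribution)"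
  proof -
    have "(\<lambda>n. integral\<^sup>L (walk_distr n) (\<lambda>t. cmod (F t) powr p))
        \<longlonglongrightarrow> (\<integral>t. cmod (F t) powr p \<partial>std_normal_distribution)"
    proof (rule weak_conv_imp_integral_bdd_continuous_conv[where B = "K powr p"])
      show "real_distribution (walk_distr n)" for n
        unfolding walk_distr_def by (intro prob_space.real_distribution_distr measure_pmf.prob_space_axioms) auto
      show "isCont (\<lambda>t. cmod (F t) powr p) x" for x
        using p Fcont by (intro continuous_at_imp_continuous_on continuous_intros) auto
      show "norm (cmod (F t) powr p) \<le> K powr p" for t
        using p Fbd by (auto intro!: powr_mono2)
    qed (use real_dist_normal_dist walk_distr_weak_conv in auto)
    then show ?thesis by (simp add: integral_walk_distr)
  qed
  have close: "cmod (Fn n x - F (walk x / sqrt n)) \<le> D n + B n * \<bar>walk x / sqrt n\<bar>"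
    if n: "n > 0" and x: "length x = n" for n x
  proof -
    define s where "s = walk x / sqrt n"
    have cp: "char_prod (\<i> * of_real (\<theta> j / sqrt n)) x = of_real (R n j) * cis (al n j * s)" for j
      unfolding char_prod_imaginary x R_def al_def s_def using n by simp
    have "cmod (c j * (of_real (R n j) * cis (al n j * s)) - c j * of_real (exp ((\<theta> j)\<^sup>2 / 2)) * cis (\<theta> j * s))
        \<le> cmod (c j) * \<bar>R n j - exp ((\<theta> j)\<^sup>2 / 2)\<bar> + cmod (c j) * exp ((\<theta> j)\<^sup>2 / 2) * \<bar>al n j - \<theta> j\<bar> * \<bar>s\<bar>" for j
    proof -
      have "c j * (of_real (R n j) * cis (al n j * s)) - c j * of_real (exp ((\<theta> j)\<^sup>2 / 2)) * cis (\<theta> j * s)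
        = c j * (of_real (R n j - exp ((\<theta> j)\<^sup>2 / 2)) * cis (al n j * s)
            + of_real (exp ((\<theta> j)\<^sup>2 / 2)) * (cis (al n j * s) - cis (\<theta> j * s)))"
        by (simp add: algebra_simps)
      also have "cmod \<dots> \<le> cmod (c j) * (\<bar>R n j - exp ((\<theta> j)\<^sup>2 / 2)\<bar> + exp ((\<theta> j)\<^sup>2 / 2) * cmod (cis (al n j * s) - cis (\<theta> j * s)))"
        unfolding norm_mult
        by (intro mult_left_mono order_trans[OF norm_triangle_ineq]) (auto simp: norm_mult simp flip: of_real_diff)
      also have "\<dots> \<le> cmod (c j) * (\<bar>R n j - exp ((\<theta> j)\<^sup>2 / 2)\<bar> + exp ((\<theta> j)\<^sup>2 / 2) * (\<bar>al n j - \<theta> j\<bar> * \<bar>s\<bar>))"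
        using cis_diff_le[of "al n j * s" "\<theta> j * s"]
        by (intro mult_left_mono add_left_mono) (auto simp: abs_mult [symmetric] algebra_simps)
      finally show ?thesis by (simp add: algebra_simps)
    qed
    then have "cmod (Fn n x - F s) \<le> (\<Sum>j\<in>A. cmod (c j) * \<bar>R n j - exp ((\<theta> j)\<^sup>2 / 2)\<bar>
        + cmod (c j) * exp ((\<theta> j)\<^sup>2 / 2) * \<bar>al n j - \<theta> j\<bar> * \<bar>s\<bar>)"
      unfolding Fn_def F_def cp sum_subtractf [symmetric] by (intro sum_norm_le) auto
    also have "\<dots> = D n + B n * \<bar>s\<bar>" by (simp add: D_def B_def sum.distrib sum_distrib_right)
    finally show ?thesis by (simp add: s_def)
  qed
  have Fnbd: "\<forall>\<^sub>F n in sequentially. \<forall>x. length x = n \<longrightarrow> cmod (Fn n x) \<le> K"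
  proof -
    have "\<forall>\<^sub>F n in sequentially. \<forall>j\<in>A. R n j < exp ((\<theta> j)\<^sup>2 / 2) + 1"
      using A Rlim by (intro eventually_ball_finite ballI order_tendstoD(2)) auto
    then show ?thesis
    proof eventually_elim
      case (elim n)
      then show ?case unfolding Fn_def K_def char_prod_imaginary
        by (auto intro!: sum_norm_le mult_left_mono simp: norm_mult norm_power R_def)
          (auto simp: less_imp_le)
    qed
  qed
  define C where "C = p * K powr (p - 1)"
  have C0: "C \<ge> 0" using p by (simp add: C_def)
  have diff: "(\<lambda>n. cube_mean n (\<lambda>x. cmod (Fn n x) powr p) - cube_mean n (\<lambda>x. cmod (F (walk x / sqrt n)) powr p))
     \<longlonglongrightarrow> 0"
  proof (rule Lim_null_comparison[where g = "\<lambda>n. C * (D n + B n)"])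
    show "(\<lambda>n. C * (D n + B n)) \<longlonglongrightarrow> 0"
      using tendsto_mult[OF tendsto_const[of C] tendsto_add[OF Dlim Blim]] by simp
    show "\<forall>\<^sub>F n in sequentially. norm (cube_mean n (\<lambda>x. cmod (Fn n x) powr p)
        - cube_mean n (\<lambda>x. cmod (F (walk x / sqrt n)) powr p)) \<le> C * (D n + B n)"
      using Fnbd eventually_gt_at_top[of 0]
    proof eventually_elim
      case (elim n)
      have B0: "B n \<ge> 0" unfolding B_def by (intro sum_nonneg) auto
      have "norm (cube_mean n (\<lambda>x. cmod (Fn n x) powr p) - cube_mean n (\<lambda>x. cmod (F (walk x / sqrt n)) powr p))
         = norm (\<Sum>x\<in>cube n. cmod (Fn n x) powr p - cmod (F (walk x / sqrt n)) powr p) / 2 ^ n"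
        by (simp add: cube_mean_def sum_subtractf diff_divide_distrib [symmetric] abs_divide)
      also have "\<dots> \<le> (\<Sum>x\<in>cube n. C * (D n + B n * \<bar>walk x / sqrt n\<bar>)) / 2 ^ n"
      proof (intro divide_right_mono sum_norm_le)
        fix x assume x: "x \<in> cube n"
        have "norm (cmod (Fn n x) powr p - cmod (F (walk x / sqrt n)) powr p)
            \<le> C * \<bar>cmod (Fn n x) - cmod (F (walk x / sqrt n))\<bar>"
          unfolding C_def real_norm_def using elim x Fbd by (intro abs_powr_diff_le[OF p]) auto
        also have "\<dots> \<le> C * cmod (Fn n x - F (walk x / sqrt n))"
          by (intro mult_left_mono norm_triangle_ineq3 C0)
        also have "\<dots> \<le> C * (D n + B n * \<bar>walk x / sqrt n\<bar>)"
          using close[of n x] elim x by (intro mult_left_mono C0) auto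
        finally show "norm (cmod (Fn n x) powr p - cmod (F (walk x / sqrt n)) powr p)
            \<le> C * (D n + B n * \<bar>walk x / sqrt n\<bar>)" .
      qed simp
      also have "\<dots> = cube_mean n (\<lambda>x. C * (D n + B n * \<bar>walk x / sqrt n\<bar>))" by (simp add: cube_mean_def)
      also have "\<dots> = C * (D n + B n * cube_mean n (\<lambda>x. \<bar>walk x / sqrt n\<bar>))"
        by (simp only: cube_mean_mult cube_mean_add cube_mean_const)
      also have "\<dots> \<le> C * (D n + B n * 1)"
        using B0 C0 cube_mean_abs_walk[of n] by (intro mult_left_mono add_left_mono) auto
      finally show ?case by simp
    qed
  qed
  from tendsto_add[OF diff weak] show ?thesis by (simp add: Fn_def F_def)
qed

text \<open>The limit of \<open>cube_form_bound\<close> for products with parameters of size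
  \<open>1 / sqrt n\<close>: the two factors \<open>\<i>\<close> in the parameters multiply to -1,
  so the form tends to sums of the Fourier kernel \<open>cis (w * \<theta> * \<phi>)\<close>, while
  the norms become Gaussian.\<close>

theorem gaussian_form_bound:
  fixes p q w :: real and c d :: "nat \<Rightarrow> complex" and \<theta> \<phi> :: "nat \<Rightarrow> real"
  assumes p: "1 < p" "p < 2" and q: "1 / p + 1 / q = 1" "q > 1" and w: "w\<^sup>2 = p - 1"
    and A: "finite A" "finite B"
  shows "cmod (\<Sum>j\<in>A. \<Sum>k\<in>B. c j * d k * cis (w * \<theta> j * \<phi> k))
    \<le> (\<integral>t. cmod (\<Sum>j\<in>A. c j * of_real (exp ((\<theta> j)\<^sup>2 / 2)) * cis (\<theta> j * t)) powr p \<partial>std_normal_distribution) powr (1 / p)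
     * (\<integral>t. cmod (\<Sum>k\<in>B. d k * of_real (exp ((\<phi> k)\<^sup>2 / 2)) * cis (\<phi> k * t)) powr p \<partial>std_normal_distribution) powr (1 / p)"
proof -
  define F where "F n x = (\<Sum>j\<in>A. c j * char_prod (\<i> * of_real (\<theta> j / sqrt n)) x)" for n :: nat and x
  define G where "G n x = (\<Sum>k\<in>B. d k * char_prod (\<i> * of_real (\<phi> k / sqrt n)) x)" for n :: nat and x
  have form: "cube_form n w (F n) (G n) = (\<Sum>j\<in>A. \<Sum>k\<in>B. c j * d k * (1 + \<i> * of_real (w * \<theta> j * \<phi> k / n)) ^ n)" for n
  proof -
    have "cube_form n w (F n) (G n) = (\<Sum>j\<in>A. \<Sum>k\<in>B. c j * d k * (1 - \<i> * w * (\<i> * of_real (\<theta> j / sqrt n)) * (\<i> * of_real (\<phi> k / sqrt n))) ^ n)"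
      unfolding F_def G_def
      by (simp only: cube_form_sum_left[OF A(1)] cube_form_sum_right[OF A(2)] cube_form_scale cube_form_char_prod)
    moreover have "1 - \<i> * w * (\<i> * of_real (\<theta> j / sqrt n)) * (\<i> * of_real (\<phi> k / sqrt n))
        = 1 + \<i> * of_real (w * \<theta> j * \<phi> k / n)" for j k
    proof -
      have "of_real (\<theta> j / sqrt n) * of_real (\<phi> k / sqrt n) = (of_real (\<theta> j * \<phi> k / n) :: complex)"
        by (simp flip: of_real_mult)
      then show ?thesis by (simp add: mult_ac)
    qed
    ultimately show ?thesis by (simp only:)
  qed
  have lim: "(\<lambda>n. cmod (cube_form n w (F n) (G n))) \<longlonglongrightarrow> cmod (\<Sum>j\<in>A. \<Sum>k\<in>B. c j * d k * cis (w * \<theta> j * \<phi> k))"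
    unfolding form by (intro tendsto_intros power_imaginary_tendsto_cis)
  show ?thesis
  proof (rule LIMSEQ_le[OF lim])
    show "(\<lambda>n. cube_mean n (\<lambda>x. cmod (F n x) powr p) powr (1 / p) * cube_mean n (\<lambda>x. cmod (G n x) powr p) powr (1 / p))
      \<longlonglongrightarrow> (\<integral>t. cmod (\<Sum>j\<in>A. c j * of_real (exp ((\<theta> j)\<^sup>2 / 2)) * cis (\<theta> j * t)) powr p \<partial>std_normal_distribution) powr (1 / p)
     * (\<integral>t. cmod (\<Sum>k\<in>B. d k * of_real (exp ((\<phi> k)\<^sup>2 / 2)) * cis (\<phi> k * t)) powr p \<partial>std_normal_distribution) powr (1 / p)"
      unfolding F_def G_def using p A
      by (intro tendsto_mult tendsto_powr' tendsto_const cube_mean_powr_tendsto_gaussian)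
        (auto intro!: always_eventually cube_mean_nonneg)
    show "\<exists>N. \<forall>n\<ge>N. cmod (cube_form n w (F n) (G n))
       \<le> cube_mean n (\<lambda>x. cmod (F n x) powr p) powr (1 / p) * cube_mean n (\<lambda>x. cmod (G n x) powr p) powr (1 / p)"
      using cube_form_bound[OF p q w] by blast
  qed
qed

subsection \<open>Trigonometric polynomials times a Gaussian\<close>

definition fourier :: "(real \<Rightarrow> complex) \<Rightarrow> real \<Rightarrow> complex" where
  "fourier f u = (LBINT t. f t * cis (- (t * u)))"

definition gauss_mode :: "real \<Rightarrow> real \<Rightarrow> real \<Rightarrow> complex" where
  "gauss_mode a \<theta> t = of_real (exp (- (a * t\<^sup>2))) * cis (\<theta> * t)"

lemma has_integral_std_normal_mode:
  "has_bochner_integral lborel (\<lambda>t. gauss_mode (1 / 2) \<theta> t) (of_real (sqrt (2 * pi) * exp (- \<theta>\<^sup>2 / 2)))"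
proof -
  have eq: "gauss_mode (1 / 2) \<theta> t = of_real (sqrt (2 * pi)) * (std_normal_density t *\<^sub>R cis (\<theta> * t))" for t
    by (simp add: gauss_mode_def std_normal_density_def scaleR_conv_of_real)
  have int: "integrable lborel (\<lambda>t. std_normal_density t *\<^sub>R cis (\<theta> * t))"
    by (rule Bochner_Integration.integrable_bound[OF integrable_std_normal_moment[of 0]]) auto
  have "(LBINT t. std_normal_density t *\<^sub>R cis (\<theta> * t)) = char std_normal_distribution \<theta>"
    unfolding char_def by (subst integral_density) (auto simp: cis_conv_exp)
  also have "\<dots> = of_real (exp (- \<theta>\<^sup>2 / 2))" by (simp add: char_std_normal_distribution)
  finally have "has_bochner_integral lborel (\<lambda>t. std_normal_density t *\<^sub>R cis (\<theta> * t)) (of_real (exp (- \<theta>\<^sup>2 / 2)))"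
    using int by (simp add: has_bochner_integral_iff)
  then show ?thesis unfolding eq of_real_mult by (rule has_bochner_integral_mult_right)
qed

lemma has_integral_gauss_mode:
  assumes a: "a > 0"
  shows "has_bochner_integral lborel (gauss_mode a \<theta>) (of_real (sqrt (pi / a) * exp (- \<theta>\<^sup>2 / (4 * a))))"
proof -
  define k where "k = sqrt (2 * a)"
  have k: "k > 0" "k\<^sup>2 = 2 * a" using a by (simp_all add: k_def)
  have "gauss_mode (1 / 2) (\<theta> / k) (0 + k * t) = gauss_mode a \<theta> t" for t
    using k by (simp add: gauss_mode_def power_mult_distrib)
  then have "has_bochner_integral lborel (gauss_mode a \<theta>) (of_real (sqrt (2 * pi) * exp (- (\<theta> / k)\<^sup>2 / 2)) /\<^sub>R \<bar>k\<bar>)"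
    using lborel_has_bochner_integral_real_affine_iff[of k "gauss_mode (1 / 2) (\<theta> / k)" _ 0] k
      has_integral_std_normal_mode[of "\<theta> / k"] by simp
  moreover have "sqrt (2 * pi) / k = sqrt (pi / a)" using a by (simp add: k_def real_sqrt_divide [symmetric])
  moreover have "- (\<theta> / k)\<^sup>2 / 2 = - \<theta>\<^sup>2 / (4 * a)" using k by (simp add: power_divide)
  moreover have "(of_real (sqrt (2 * pi) * E) /\<^sub>R \<bar>k\<bar> :: complex) = of_real (sqrt (2 * pi) / k * E)" for E
    using k by (simp add: scaleR_conv_of_real field_simps)
  ultimately show ?thesis by (simp only:)
qed

lemma integrable_gauss_mode [simp]: "a > 0 \<Longrightarrow> integrable lborel (gauss_mode a \<theta>)"
  using has_integral_gauss_mode[of a \<theta>] by (simp add: has_bochner_integral_iff)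

lemma integral_gauss_mode:
  "a > 0 \<Longrightarrow> (LBINT t. gauss_mode a \<theta> t) = of_real (sqrt (pi / a) * exp (- \<theta>\<^sup>2 / (4 * a)))"
  using has_integral_gauss_mode[of a \<theta>] by (simp add: has_bochner_integral_iff)

lemma gauss_mode_mult_cis: "gauss_mode a \<theta> t * cis (- (t * u)) = gauss_mode a (\<theta> - u) t"
  by (simp add: gauss_mode_def cis_mult mult.assoc algebra_simps)

lemma borel_measurable_gauss_mode [measurable]: "gauss_mode a \<theta> \<in> borel_measurable borel"
  unfolding gauss_mode_def[abs_def] by measurable

lemma fourier_gauss_mode:
  "a > 0 \<Longrightarrow> fourier (gauss_mode a \<theta>) u = of_real (sqrt (pi / a) * exp (- (\<theta> - u)\<^sup>2 / (4 * a)))"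
  unfolding fourier_def gauss_mode_mult_cis by (rule integral_gauss_mode)

text \<open>The width \<open>1 / (2 * p)\<close> makes the p-th power of the weight a multiple of
  the normal density. With the dilation \<open>w / p\<close>, the relation
  \<open>w\<^sup>2 = p - 1\<close> completes the exponents to a Gaussian of unit variance centred at
  \<open>w * \<theta>\<close>; integrating the mode \<open>\<phi>\<close> against it gives the phase
  \<open>cis (w * \<theta> * \<phi>)\<close>.\<close>

lemma gauss_mode_form:
  fixes p w :: real
  assumes p: "p > 1" and w: "w\<^sup>2 = p - 1"
  shows "has_bochner_integral lborel (\<lambda>u. gauss_mode (1 / (2 * p)) \<phi> u * fourier (gauss_mode (1 / (2 * p)) \<theta>) (w / p * u))
    (of_real (2 * pi * sqrt p * (exp (- \<theta>\<^sup>2 / 2) * exp (- \<phi>\<^sup>2 / 2))) * cis (w * \<theta> * \<phi>))"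
proof -
  have expo: "- (1 / (2 * p) * u\<^sup>2) + - (\<theta> - w / p * u)\<^sup>2 / (4 * (1 / (2 * p))) = - (u - w * \<theta>)\<^sup>2 / 2 - \<theta>\<^sup>2 / 2" for u
  proof -
    have "- (1 / (2 * p) * u\<^sup>2) + - (\<theta> - w / p * u)\<^sup>2 / (4 * (1 / (2 * p)))
      = - u\<^sup>2 / (2 * p) - p * \<theta>\<^sup>2 / 2 + w * \<theta> * u - w\<^sup>2 * u\<^sup>2 / (2 * p)"
      using p by (simp add: field_simps power2_eq_square)
    also have "\<dots> = - (u\<^sup>2 * (1 + w\<^sup>2) / (2 * p)) - p * \<theta>\<^sup>2 / 2 + w * \<theta> * u"
      using p by (simp add: field_simps)
    also have "\<dots> = - (u\<^sup>2 / 2) - (1 + w\<^sup>2) * \<theta>\<^sup>2 / 2 + w * \<theta> * u"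
      using p by (simp add: w)
    finally show ?thesis by (simp add: power2_eq_square algebra_simps add_divide_distrib diff_divide_distrib)
  qed
  have eq: "gauss_mode (1 / (2 * p)) \<phi> u * fourier (gauss_mode (1 / (2 * p)) \<theta>) (w / p * u)
      = of_real (sqrt (2 * pi * p) * exp (- \<theta>\<^sup>2 / 2)) * cis (w * \<theta> * \<phi>) * gauss_mode (1 / 2) \<phi> (- (w * \<theta>) + 1 * u)" for u
  proof -
    have "gauss_mode (1 / (2 * p)) \<phi> u * fourier (gauss_mode (1 / (2 * p)) \<theta>) (w / p * u)
      = of_real (sqrt (2 * pi * p) * exp (- (1 / (2 * p) * u\<^sup>2) + - (\<theta> - w / p * u)\<^sup>2 / (4 * (1 / (2 * p))))) * cis (\<phi> * u)"
      using p unfolding exp_add by (subst fourier_gauss_mode) (simp_all add: gauss_mode_def mult_ac)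
    also have "\<dots> = of_real (sqrt (2 * pi * p) * (exp (- \<theta>\<^sup>2 / 2) * exp (- (u - w * \<theta>)\<^sup>2 / 2))) * cis (\<phi> * u)"
    proof -
      have "- (u - w * \<theta>)\<^sup>2 / 2 - \<theta>\<^sup>2 / 2 = - \<theta>\<^sup>2 / 2 + - (u - w * \<theta>)\<^sup>2 / 2" by simp
      then show ?thesis unfolding expo by (simp only: exp_add)
    qed
    also have "cis (\<phi> * u) = cis (w * \<theta> * \<phi>) * cis (\<phi> * (u - w * \<theta>))"
      by (simp add: cis_mult algebra_simps)
    finally show ?thesis by (simp add: gauss_mode_def[of "1 / 2"] mult_ac)
  qed
  have "has_bochner_integral lborel (\<lambda>u. gauss_mode (1 / 2) \<phi> (- (w * \<theta>) + 1 * u)) (of_real (sqrt (2 * pi) * exp (- \<phi>\<^sup>2 / 2)))"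
    using lborel_has_bochner_integral_real_affine_iff[of 1 "gauss_mode (1 / 2) \<phi>" _ "- (w * \<theta>)"]
      has_integral_std_normal_mode[of \<phi>] by simp
  then have "has_bochner_integral lborel (\<lambda>u. gauss_mode (1 / (2 * p)) \<phi> u * fourier (gauss_mode (1 / (2 * p)) \<theta>) (w / p * u))
     (of_real (sqrt (2 * pi * p) * exp (- \<theta>\<^sup>2 / 2)) * cis (w * \<theta> * \<phi>) * of_real (sqrt (2 * pi) * exp (- \<phi>\<^sup>2 / 2)))"
    unfolding eq by (rule has_bochner_integral_mult_right)
  moreover have "sqrt (2 * pi * p) * sqrt (2 * pi) = 2 * pi * sqrt p"
    using p by (simp add: real_sqrt_mult mult_ac)
  then have "(of_real (sqrt (2 * pi * p)) * of_real (sqrt (2 * pi)) :: complex) = of_real (2 * pi * sqrt p)"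
    by (metis of_real_mult)
  then have "of_real (sqrt (2 * pi * p) * exp (- \<theta>\<^sup>2 / 2)) * cis (w * \<theta> * \<phi>) * of_real (sqrt (2 * pi) * exp (- \<phi>\<^sup>2 / 2))
    = of_real (2 * pi * sqrt p * (exp (- \<theta>\<^sup>2 / 2) * exp (- \<phi>\<^sup>2 / 2))) * cis (w * \<theta> * \<phi>)"
  proof -
    assume S: "(of_real (sqrt (2 * pi * p)) * of_real (sqrt (2 * pi)) :: complex) = of_real (2 * pi * sqrt p)"
    have "of_real (sqrt (2 * pi * p) * E) * c * of_real (sqrt (2 * pi) * E')
        = (of_real (sqrt (2 * pi * p)) * of_real (sqrt (2 * pi)) :: complex) * (of_real E * of_real E') * c" for E E' c
      by (simp only: of_real_mult mult_ac)
    then show ?thesis by (simp only: S of_real_mult)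
  qed
  ultimately show ?thesis by (simp only:)
qed

lemma gauss_mode_inner:
  assumes a: "a > 0"
  shows "has_bochner_integral lborel (\<lambda>t. gauss_mode a \<theta> t * cnj (gauss_mode a \<phi> t))
      (of_real (sqrt (pi / (2 * a)) * exp (- (\<theta> - \<phi>)\<^sup>2 / (8 * a))))"
proof -
  have "gauss_mode a \<theta> t * cnj (gauss_mode a \<phi> t) = gauss_mode (2 * a) (\<theta> - \<phi>) t" for t
  proof -
    have "exp (- (a * t\<^sup>2)) * exp (- (a * t\<^sup>2)) = exp (- (2 * a * t\<^sup>2))" by (simp flip: exp_add)
    then have "(of_real (exp (- (a * t\<^sup>2))) * of_real (exp (- (a * t\<^sup>2))) :: complex) = of_real (exp (- (2 * a * t\<^sup>2)))"
      by (metis of_real_mult)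
    moreover have "cis (\<theta> * t) * cis (- (\<phi> * t)) = cis ((\<theta> - \<phi>) * t)" by (simp add: cis_mult algebra_simps)
    moreover have r: "(E * C) * (E * D) = (E * E) * (C * D)" for C D E :: complex by (simp only: mult_ac)
    ultimately show ?thesis unfolding gauss_mode_def complex_cnj_mult complex_cnj_complex_of_real cis_cnj
      by (simp only: r[of "of_real (exp (- (a * t\<^sup>2)))"])
  qed
  then show ?thesis using has_integral_gauss_mode[of "2 * a" "\<theta> - \<phi>"] a by simp
qed

text \<open>The transforms are Gaussians around \<open>\<theta>\<close> and \<open>\<phi>\<close>,
  and their product is a Gaussian around the midpoint times
  \<open>exp (- (\<theta> - \<phi>)\<^sup>2 / (8 * a))\<close>. Compared with
  \<open>gauss_mode_inner\<close> only the factor \<open>2 * pi\<close> appears, which is Plancherel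
  for two modes.\<close>

lemma fourier_gauss_mode_inner:
  assumes a: "a > 0"
  shows "has_bochner_integral lborel (\<lambda>u. fourier (gauss_mode a \<theta>) u * cnj (fourier (gauss_mode a \<phi>) u))
      (of_real (2 * pi) * of_real (sqrt (pi / (2 * a)) * exp (- (\<theta> - \<phi>)\<^sup>2 / (8 * a))))"
proof -
  have expo: "- (\<theta> - u)\<^sup>2 / (4 * a) + - (\<phi> - u)\<^sup>2 / (4 * a)
      = - (1 / (2 * a) * (u - (\<theta> + \<phi>) / 2)\<^sup>2) + - (\<theta> - \<phi>)\<^sup>2 / (8 * a)" for u
    using a by (simp add: field_simps power2_eq_square)
  have eq: "fourier (gauss_mode a \<theta>) u * cnj (fourier (gauss_mode a \<phi>) u)
      = of_real (pi / a * exp (- (\<theta> - \<phi>)\<^sup>2 / (8 * a))) * gauss_mode (1 / (2 * a)) 0 (- ((\<theta> + \<phi>) / 2) + 1 * u)" for u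
  proof -
    have "sqrt (pi / a) * exp (- (\<theta> - u)\<^sup>2 / (4 * a)) * (sqrt (pi / a) * exp (- (\<phi> - u)\<^sup>2 / (4 * a)))
       = pi / a * exp (- (\<theta> - u)\<^sup>2 / (4 * a) + - (\<phi> - u)\<^sup>2 / (4 * a))"
      unfolding exp_add using a by (simp add: mult_ac) (simp add: mult.assoc [symmetric])
    also have "\<dots> = pi / a * exp (- (\<theta> - \<phi>)\<^sup>2 / (8 * a)) * exp (- (1 / (2 * a) * (u - (\<theta> + \<phi>) / 2)\<^sup>2))"
      unfolding expo exp_add by simp
    finally show ?thesis
      unfolding fourier_gauss_mode[OF a] complex_cnj_complex_of_real of_real_mult [symmetric]
      by (simp add: gauss_mode_def)
  qed
  have "has_bochner_integral lborel (gauss_mode (1 / (2 * a)) 0) (of_real (sqrt (2 * pi * a)))"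
    using has_integral_gauss_mode[of "1 / (2 * a)" 0] a by (simp add: mult_ac)
  then have "has_bochner_integral lborel (\<lambda>u. gauss_mode (1 / (2 * a)) 0 (- ((\<theta> + \<phi>) / 2) + 1 * u)) (of_real (sqrt (2 * pi * a)))"
    using lborel_has_bochner_integral_real_affine_iff[of 1 "gauss_mode (1 / (2 * a)) 0" _ "- ((\<theta> + \<phi>) / 2)"] by simp
  then have "has_bochner_integral lborel (\<lambda>u. fourier (gauss_mode a \<theta>) u * cnj (fourier (gauss_mode a \<phi>) u))
      (of_real (pi / a * exp (- (\<theta> - \<phi>)\<^sup>2 / (8 * a))) * of_real (sqrt (2 * pi * a)))"
    unfolding eq by (rule has_bochner_integral_mult_right)
  moreover have "pi / a * sqrt (2 * pi * a) = 2 * pi * sqrt (pi / (2 * a))"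
  proof -
    have "sqrt (2 * pi * a) = sqrt ((2 * a)\<^sup>2 * (pi / (2 * a)))" using a by (simp add: power2_eq_square field_simps)
    also have "\<dots> = 2 * a * sqrt (pi / (2 * a))" using a by (simp only: real_sqrt_mult real_sqrt_abs abs_of_pos mult_pos_pos zero_less_numeral)
    finally show ?thesis using a by simp
  qed
  then have "of_real (pi / a * exp (- (\<theta> - \<phi>)\<^sup>2 / (8 * a))) * of_real (sqrt (2 * pi * a))
      = (of_real (2 * pi) * of_real (sqrt (pi / (2 * a)) * exp (- (\<theta> - \<phi>)\<^sup>2 / (8 * a))) :: complex)"
  proof -
    assume S: "pi / a * sqrt (2 * pi * a) = 2 * pi * sqrt (pi / (2 * a))"
    have "pi / a * E * sqrt (2 * pi * a) = 2 * pi * (sqrt (pi / (2 * a)) * E)" for E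
    proof -
      have "pi / a * E * sqrt (2 * pi * a) = pi / a * sqrt (2 * pi * a) * E" by (simp only: mult_ac)
      also have "\<dots> = 2 * pi * (sqrt (pi / (2 * a)) * E)" unfolding S by (simp only: mult_ac)
      finally show ?thesis .
    qed
    then show ?thesis by (simp only: of_real_mult [symmetric])
  qed
  ultimately show ?thesis by simp
qed

text \<open>The frequencies are arbitrary reals and may repeat, so sums, multiples and products
  become list operations; the sum over indices matches the finite sums of
  \<open>gaussian_form_bound\<close>.\<close>

definition trig_poly :: "(complex \<times> real) list \<Rightarrow> real \<Rightarrow> complex" where
  "trig_poly xs t = (\<Sum>j<length xs. fst (xs ! j) * cis (snd (xs ! j) * t))"

definition gauss_trig :: "real \<Rightarrow> (complex \<times> real) list \<Rightarrow> real \<Rightarrow> complex" where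
  "gauss_trig a xs t = of_real (exp (- (a * t\<^sup>2))) * trig_poly xs t"

lemma gauss_trig_eq: "gauss_trig a xs t = (\<Sum>j<length xs. fst (xs ! j) * gauss_mode a (snd (xs ! j)) t)"
  by (simp add: gauss_trig_def trig_poly_def gauss_mode_def sum_distrib_left mult_ac)

lemma borel_measurable_trig_poly [measurable]: "trig_poly xs \<in> borel_measurable borel"
  unfolding trig_poly_def[abs_def] by measurable

lemma borel_measurable_gauss_trig [measurable]: "gauss_trig a xs \<in> borel_measurable borel"
  unfolding gauss_trig_def[abs_def] by measurable

abbreviation lpnorm :: "real \<Rightarrow> (real \<Rightarrow> complex) \<Rightarrow> real" where
  "lpnorm p f \<equiv> (LBINT t. cmod (f t) powr p) powr (1 / p)"

lemma integrable_mult_cis: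
  fixes f :: "real \<Rightarrow> complex"
  assumes "integrable lborel f"
  shows "integrable lborel (\<lambda>t. f t * cis (- (t * u)))"
proof (rule Bochner_Integration.integrable_bound[OF assms])
  have [measurable]: "f \<in> borel_measurable lborel" using assms by simp
  show "(\<lambda>t. f t * cis (- (t * u))) \<in> borel_measurable lborel" by measurable
qed (simp add: norm_mult)

lemma fourier_gauss_trig:
  "a > 0 \<Longrightarrow> fourier (gauss_trig a xs) u = (\<Sum>j<length xs. fst (xs ! j) * fourier (gauss_mode a (snd (xs ! j))) u)"
proof -
  assume a: "a > 0"
  have "fourier (gauss_trig a xs) u
      = (LBINT t. (\<Sum>j<length xs. fst (xs ! j) * (gauss_mode a (snd (xs ! j)) t * cis (- (t * u)))))"
    unfolding fourier_def gauss_trig_eq by (simp only: sum_distrib_right mult.assoc)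
  also have "\<dots> = (\<Sum>j<length xs. \<integral>t. fst (xs ! j) * (gauss_mode a (snd (xs ! j)) t * cis (- (t * u))) \<partial>lborel)"
    by (rule Bochner_Integration.integral_sum) (intro integrable_mult_right integrable_mult_cis integrable_gauss_mode a)
  also have "\<dots> = (\<Sum>j<length xs. fst (xs ! j) * fourier (gauss_mode a (snd (xs ! j))) u)"
    unfolding fourier_def by (simp only: integral_mult_right_zero)
  finally show ?thesis .
qed

lemma trig_poly_bounded: "cmod (trig_poly xs t) \<le> (\<Sum>j<length xs. cmod (fst (xs ! j)))"
  unfolding trig_poly_def by (intro sum_norm_le) (simp add: norm_mult)

lemma integrable_gauss: "a > 0 \<Longrightarrow> integrable lborel (\<lambda>t. exp (- (a * t\<^sup>2)) :: real)"
  using integrable_norm[OF integrable_gauss_mode[of a 0]] by (simp add: gauss_mode_def norm_mult)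

lemma integrable_gauss_trig_powr:
  assumes a: "a > 0" and p: "p > 0"
  shows "integrable lborel (\<lambda>t. cmod (gauss_trig a xs t) powr p)"
proof -
  define K where "K = (\<Sum>j<length xs. cmod (fst (xs ! j)))"
  have "integrable lborel (\<lambda>t. K powr p * exp (- (a * p * t\<^sup>2)))"
    using integrable_gauss[of "a * p"] a p by auto
  then show ?thesis
  proof (rule Bochner_Integration.integrable_bound)
    have "cmod (gauss_trig a xs t) powr p \<le> K powr p * exp (- (a * p * t\<^sup>2))" for t
    proof -
      have "cmod (gauss_trig a xs t) powr p = exp (- (a * p * t\<^sup>2)) * cmod (trig_poly xs t) powr p"
        by (simp add: gauss_trig_def norm_mult powr_mult powr_def[of "exp _"] mult_ac)
      also have "\<dots> \<le> exp (- (a * p * t\<^sup>2)) * K powr p"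
        using p trig_poly_bounded[of xs t] unfolding K_def by (intro mult_left_mono powr_mono2) auto
      finally show ?thesis by (simp add: mult.commute)
    qed
    then show "AE t in lborel. norm (cmod (gauss_trig a xs t) powr p) \<le> norm (K powr p * exp (- (a * p * t\<^sup>2)))" by simp
  qed simp
qed

text \<open>\<open>gauss_mode_form\<close> contributes \<open>exp (- \<theta>\<^sup>2 / 2)\<close>
  for each frequency; put into the coefficients \<open>c'\<close> and \<open>d'\<close>, these
  factors cancel the growth \<open>exp (\<theta>\<^sup>2 / 2)\<close> in
  \<open>gaussian_form_bound\<close>. Passing from the normal density to Lebesgue measure gives
  \<open>(2 * pi) powr (- 1 / (2 * p))\<close> for each of the two norms.\<close>

theorem hausdorff_young_gauss_trig:
  fixes p q w :: real
  assumes p: "1 < p" "p < 2" and q: "1 / p + 1 / q = 1" "q > 1" and w: "w\<^sup>2 = p - 1"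
  shows "cmod (LBINT u. gauss_trig (1 / (2 * p)) ys u * fourier (gauss_trig (1 / (2 * p)) xs) (w / p * u))
    \<le> 2 * pi * sqrt p * (2 * pi) powr (- 1 / p)
      * (LBINT t. cmod (gauss_trig (1 / (2 * p)) xs t) powr p) powr (1 / p)
      * (LBINT t. cmod (gauss_trig (1 / (2 * p)) ys t) powr p) powr (1 / p)"
proof -
  define A B where "A = {..<length xs}" and "B = {..<length ys}"
  define c \<theta> d \<phi> where "c j = fst (xs ! j)" and "\<theta> j = snd (xs ! j)" and "d k = fst (ys ! k)" and "\<phi> k = snd (ys ! k)" for j k
  define c' d' where "c' j = c j * of_real (exp (- (\<theta> j)\<^sup>2 / 2))" and "d' k = d k * of_real (exp (- (\<phi> k)\<^sup>2 / 2))" for j k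
  have "(LBINT u. gauss_trig (1 / (2 * p)) ys u * fourier (gauss_trig (1 / (2 * p)) xs) (w / p * u))
    = (LBINT u. (\<Sum>j\<in>A. \<Sum>k\<in>B. c j * d k * (gauss_mode (1 / (2 * p)) (\<phi> k) u * fourier (gauss_mode (1 / (2 * p)) (\<theta> j)) (w / p * u))))"
  proof (rule Bochner_Integration.integral_cong[OF refl])
    fix u
    have "gauss_trig (1 / (2 * p)) ys u * fourier (gauss_trig (1 / (2 * p)) xs) (w / p * u)
       = (\<Sum>j\<in>A. c j * fourier (gauss_mode (1 / (2 * p)) (\<theta> j)) (w / p * u)) * (\<Sum>k\<in>B. d k * gauss_mode (1 / (2 * p)) (\<phi> k) u)"
      using p by (subst fourier_gauss_trig) (auto simp: gauss_trig_eq A_def B_def c_def d_def \<theta>_def \<phi>_def mult.commute)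
    also have "\<dots> = (\<Sum>j\<in>A. \<Sum>k\<in>B. c j * d k * (gauss_mode (1 / (2 * p)) (\<phi> k) u * fourier (gauss_mode (1 / (2 * p)) (\<theta> j)) (w / p * u)))"
      unfolding sum_product by (intro sum.cong refl) (simp only: mult_ac)
    finally show "gauss_trig (1 / (2 * p)) ys u * fourier (gauss_trig (1 / (2 * p)) xs) (w / p * u) = \<dots>" .
  qed
  also have "\<dots> = (\<Sum>j\<in>A. \<Sum>k\<in>B. c j * d k * (of_real (2 * pi * sqrt p * (exp (- (\<theta> j)\<^sup>2 / 2) * exp (- (\<phi> k)\<^sup>2 / 2))) * cis (w * \<theta> j * \<phi> k)))"
    by (intro has_bochner_integral_integral_eq has_bochner_integral_sum has_bochner_integral_mult_right gauss_mode_form p w)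
  also have "\<dots> = of_real (2 * pi * sqrt p) * (\<Sum>j\<in>A. \<Sum>k\<in>B. c' j * d' k * cis (w * \<theta> j * \<phi> k))"
    unfolding sum_distrib_left by (intro sum.cong refl) (simp add: c'_def d'_def mult_ac)
  finally have form: "cmod (LBINT u. gauss_trig (1 / (2 * p)) ys u * fourier (gauss_trig (1 / (2 * p)) xs) (w / p * u))
     = 2 * pi * sqrt p * cmod (\<Sum>j\<in>A. \<Sum>k\<in>B. c' j * d' k * cis (w * \<theta> j * \<phi> k))"
    using p by (simp add: norm_mult)
  have cancel: "z * of_real (exp (- s / 2)) * of_real (exp (s / 2)) = z" for z :: complex and s :: real
    by (simp add: mult.assoc exp_add [symmetric] flip: of_real_mult)
  have norm: "(\<integral>t. cmod (trig_poly zs t) powr p \<partial>std_normal_distribution)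
      = (2 * pi) powr (- 1 / 2) * (LBINT t. cmod (gauss_trig (1 / (2 * p)) zs t) powr p)" for zs
  proof -
    have "std_normal_density t * cmod (trig_poly zs t) powr p = (2 * pi) powr (- 1 / 2) * cmod (gauss_trig (1 / (2 * p)) zs t) powr p" for t
      using p by (simp add: gauss_trig_def norm_mult powr_mult std_normal_density_def powr_def[of "exp _"] powr_minus_divide powr_half_sqrt real_sqrt_mult)
    then show ?thesis by (subst integral_real_density) auto
  qed
  have "cmod (\<Sum>j\<in>A. \<Sum>k\<in>B. c' j * d' k * cis (w * \<theta> j * \<phi> k))
    \<le> (\<integral>t. cmod (trig_poly xs t) powr p \<partial>std_normal_distribution) powr (1 / p)
     * (\<integral>t. cmod (trig_poly ys t) powr p \<partial>std_normal_distribution) powr (1 / p)"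
    using gaussian_form_bound[OF p q w, of A B c' d' \<theta> \<phi>]
    unfolding c'_def d'_def cancel by (simp add: A_def B_def c_def d_def \<theta>_def \<phi>_def trig_poly_def)
  also have "\<dots> = ((2 * pi) powr (- 1 / 2)) powr (1 / p) * ((2 * pi) powr (- 1 / 2)) powr (1 / p)
      * (LBINT t. cmod (gauss_trig (1 / (2 * p)) xs t) powr p) powr (1 / p)
      * (LBINT t. cmod (gauss_trig (1 / (2 * p)) ys t) powr p) powr (1 / p)"
    unfolding norm powr_mult by (simp only: mult_ac)
  also have "((2 * pi) powr (- 1 / 2)) powr (1 / p) * ((2 * pi) powr (- 1 / 2)) powr (1 / p) = (2 * pi) powr (- 1 / p)"
  proof -
    have "- 1 / 2 * (1 / p) + - 1 / 2 * (1 / p) = - 1 / p" by (simp add: field_simps)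
    then show ?thesis by (simp only: powr_powr powr_add [symmetric])
  qed
  finally show ?thesis unfolding form using p by (simp add: mult.assoc mult_left_mono)
qed

theorem plancherel_gauss_trig:
  assumes a: "a > 0"
  shows "has_bochner_integral lborel (\<lambda>u. (cmod (fourier (gauss_trig a xs) u))\<^sup>2)
    (2 * pi * (LBINT t. (cmod (gauss_trig a xs t))\<^sup>2))"
proof -
  define A c \<theta> where "A = {..<length xs}" and "c j = fst (xs ! j)" and "\<theta> j = snd (xs ! j)" for j
  define m where "m = (\<Sum>j\<in>A. \<Sum>k\<in>A. c j * cnj (c k) * of_real (sqrt (pi / (2 * a)) * exp (- (\<theta> j - \<theta> k)\<^sup>2 / (8 * a))))"
  have f: "gauss_trig a xs t * cnj (gauss_trig a xs t) = (\<Sum>j\<in>A. \<Sum>k\<in>A. c j * cnj (c k) * (gauss_mode a (\<theta> j) t * cnj (gauss_mode a (\<theta> k) t)))" for t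
    unfolding gauss_trig_eq by (simp add: sum_product A_def c_def \<theta>_def mult_ac)
  have g: "fourier (gauss_trig a xs) u * cnj (fourier (gauss_trig a xs) u)
      = (\<Sum>j\<in>A. \<Sum>k\<in>A. c j * cnj (c k) * (fourier (gauss_mode a (\<theta> j)) u * cnj (fourier (gauss_mode a (\<theta> k)) u)))" for u
    unfolding fourier_gauss_trig[OF a] by (simp add: sum_product A_def c_def \<theta>_def mult_ac)
  have fi: "has_bochner_integral lborel (\<lambda>t. gauss_trig a xs t * cnj (gauss_trig a xs t)) m"
    unfolding f m_def by (intro has_bochner_integral_sum has_bochner_integral_mult_right gauss_mode_inner a)
  have "has_bochner_integral lborel (\<lambda>u. fourier (gauss_trig a xs) u * cnj (fourier (gauss_trig a xs) u))
     (\<Sum>j\<in>A. \<Sum>k\<in>A. c j * cnj (c k) * (of_real (2 * pi) * of_real (sqrt (pi / (2 * a)) * exp (- (\<theta> j - \<theta> k)\<^sup>2 / (8 * a)))))"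
    unfolding g by (intro has_bochner_integral_sum has_bochner_integral_mult_right fourier_gauss_mode_inner a)
  also have "(\<Sum>j\<in>A. \<Sum>k\<in>A. c j * cnj (c k) * (of_real (2 * pi) * of_real (sqrt (pi / (2 * a)) * exp (- (\<theta> j - \<theta> k)\<^sup>2 / (8 * a)))))
     = of_real (2 * pi) * m"
    unfolding m_def sum_distrib_left by (intro sum.cong refl) (simp add: mult_ac)
  finally have gi: "has_bochner_integral lborel (\<lambda>u. fourier (gauss_trig a xs) u * cnj (fourier (gauss_trig a xs) u)) (of_real (2 * pi) * m)" .
  have sq: "z * cnj z = of_real ((cmod z)\<^sup>2)" for z by (simp only: complex_norm_square)
  have Re: "has_bochner_integral lborel (\<lambda>t. h t) (Re x)" if "has_bochner_integral lborel (\<lambda>t. of_real (h t) :: complex) x" for h x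
    using has_bochner_integral_Re[OF that] by simp
  have "has_bochner_integral lborel (\<lambda>t. (cmod (gauss_trig a xs t))\<^sup>2) (Re m)"
    by (rule Re) (use fi in \<open>simp only: sq\<close>)
  moreover have "has_bochner_integral lborel (\<lambda>u. (cmod (fourier (gauss_trig a xs) u))\<^sup>2) (Re (of_real (2 * pi) * m))"
    by (rule Re) (use gi in \<open>simp only: sq\<close>)
  ultimately show ?thesis by (simp add: has_bochner_integral_iff)
qed

subsection \<open>Square integrable functions\<close>

text \<open>Used with \<open>lborel\<close>; the Lebesgue measurable functions of \<open>L2\<close>
  are replaced by Borel representatives only at the end.\<close>

definition square_integrable :: "'a measure \<Rightarrow> ('a \<Rightarrow> complex) \<Rightarrow> bool" where
  "square_integrable M f \<longleftrightarrow> f \<in> borel_measurable M \<and> integrable M (\<lambda>x. (cmod (f x))\<^sup>2)"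

definition l2norm :: "'a measure \<Rightarrow> ('a \<Rightarrow> complex) \<Rightarrow> real" where
  "l2norm M f = sqrt (\<integral>x. (cmod (f x))\<^sup>2 \<partial>M)"

lemma square_integrable_measurable [measurable_dest]:
  "square_integrable M f \<Longrightarrow> f \<in> borel_measurable M"
  by (simp add: square_integrable_def)

lemma square_integrableD: "square_integrable M f \<Longrightarrow> integrable M (\<lambda>x. (cmod (f x))\<^sup>2)"
  by (simp add: square_integrable_def)

lemma square_integrable_bound:
  assumes "square_integrable M g" "f \<in> borel_measurable M" "\<And>x. cmod (f x) \<le> C * cmod (g x)"
  shows "square_integrable M f"
proof -
  have "integrable M (\<lambda>x. (cmod (f x))\<^sup>2)"
  proof (rule Bochner_Integration.integrable_bound)
    show "integrable M (\<lambda>x. C\<^sup>2 * (cmod (g x))\<^sup>2)" using square_integrableD[OF assms(1)] by simp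
    show "AE x in M. norm ((cmod (f x))\<^sup>2) \<le> norm (C\<^sup>2 * (cmod (g x))\<^sup>2)"
      using assms(3) by (auto simp flip: power_mult_distrib intro!: power_mono AE_I2)
  qed (use assms(2) in measurable)
  with assms(2) show ?thesis by (simp add: square_integrable_def)
qed

lemma cmod_add_sq_le: "(cmod (x + y))\<^sup>2 \<le> 2 * (cmod x)\<^sup>2 + 2 * (cmod y)\<^sup>2"
proof -
  have "(cmod (x + y))\<^sup>2 \<le> (cmod x + cmod y)\<^sup>2" by (intro power_mono norm_triangle_ineq) auto
  also have "\<dots> \<le> 2 * (cmod x)\<^sup>2 + 2 * (cmod y)\<^sup>2"
    using zero_le_power2[of "cmod x - cmod y"] by (simp add: power2_eq_square algebra_simps)
  finally show ?thesis .
qed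

lemma square_integrable_add:
  assumes "square_integrable M f" "square_integrable M g"
  shows "square_integrable M (\<lambda>x. f x + g x)"
proof -
  note [measurable] = square_integrable_measurable[OF assms(1)] square_integrable_measurable[OF assms(2)]
  have "integrable M (\<lambda>x. (cmod (f x + g x))\<^sup>2)"
  proof (rule Bochner_Integration.integrable_bound)
    show "integrable M (\<lambda>x. 2 * (cmod (f x))\<^sup>2 + 2 * (cmod (g x))\<^sup>2)"
      using assms by (auto simp: square_integrable_def)
    show "AE x in M. norm ((cmod (f x + g x))\<^sup>2) \<le> norm (2 * (cmod (f x))\<^sup>2 + 2 * (cmod (g x))\<^sup>2)"
      using cmod_add_sq_le by auto
  qed measurable
  then show ?thesis by (simp add: square_integrable_def)
qed

lemma square_integrable_scale: "square_integrable M f \<Longrightarrow> square_integrable M (\<lambda>x. c * f x)"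
  by (auto simp: square_integrable_def norm_mult power_mult_distrib)

lemma square_integrable_diff:
  "\<lbrakk>square_integrable M f; square_integrable M g\<rbrakk> \<Longrightarrow> square_integrable M (\<lambda>x. f x - g x)"
  using square_integrable_add[of M f "\<lambda>x. - 1 * g x"] square_integrable_scale[of M g "- 1"] by simp

lemma square_integrable_cnj: "square_integrable M f \<Longrightarrow> square_integrable M (\<lambda>x. cnj (f x))"
  by (auto simp: square_integrable_def complex_eq_iff borel_measurable_complex_iff)

lemma l2norm_nonneg [simp]: "0 \<le> l2norm M f"
  by (simp add: l2norm_def integral_nonneg_AE)

lemma l2norm_sq: "(l2norm M f)\<^sup>2 = (\<integral>x. (cmod (f x))\<^sup>2 \<partial>M)"
  by (simp add: l2norm_def integral_nonneg_AE)

lemma l2norm_cnj [simp]: "l2norm M (\<lambda>x. cnj (f x)) = l2norm M f"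
  by (simp add: l2norm_def)

lemma l2norm_minus_commute: "l2norm M (\<lambda>x. f x - g x) = l2norm M (\<lambda>x. g x - f x)"
  by (simp add: l2norm_def norm_minus_commute)

lemma l2norm_scale: "l2norm M (\<lambda>x. c * f x) = cmod c * l2norm M f"
  by (simp add: l2norm_def norm_mult power_mult_distrib real_sqrt_mult)

lemma integrable_norm_mult:
  assumes "square_integrable M f" "square_integrable M g"
  shows "integrable M (\<lambda>x. cmod (f x) * cmod (g x))"
proof (rule Bochner_Integration.integrable_bound)
  note [measurable] = square_integrable_measurable[OF assms(1)] square_integrable_measurable[OF assms(2)]
  show "integrable M (\<lambda>x. (cmod (f x))\<^sup>2 + (cmod (g x))\<^sup>2)"
    using assms by (auto simp: square_integrable_def)
  have "s * t \<le> s\<^sup>2 + t\<^sup>2" if "s \<ge> 0" "t \<ge> 0" for s t :: real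
    using zero_le_power2[of "s - t"] mult_nonneg_nonneg[OF that] unfolding power2_diff by linarith
  then show "AE x in M. norm (cmod (f x) * cmod (g x)) \<le> norm ((cmod (f x))\<^sup>2 + (cmod (g x))\<^sup>2)"
    by (auto simp: abs_mult)
  show "(\<lambda>x. cmod (f x) * cmod (g x)) \<in> borel_measurable M" by measurable
qed

lemma integrable_square_mult:
  assumes "square_integrable M f" "square_integrable M g"
  shows "integrable M (\<lambda>x. f x * g x)"
proof -
  note [measurable] = square_integrable_measurable[OF assms(1)] square_integrable_measurable[OF assms(2)]
  have "integrable M (\<lambda>x. norm (f x * g x))" using integrable_norm_mult[OF assms] by (simp add: norm_mult)
  then show ?thesis by (subst (asm) integrable_norm_iff) auto
qed

text \<open>Pointwise AM-GM with the weights \<open>B / A\<close> and \<open>A / B\<close>, which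
  make the two integrals equal; vanishing norms are treated apart.\<close>

lemma integral_norm_mult_le:
  assumes f: "square_integrable M f" and g: "square_integrable M g"
  shows "(\<integral>x. cmod (f x) * cmod (g x) \<partial>M) \<le> l2norm M f * l2norm M g"
proof -
  note [measurable] = square_integrable_measurable[OF f] square_integrable_measurable[OF g]
  have zero: "(\<integral>x. cmod (f x) * cmod (g x) \<partial>M) = 0" if "l2norm M h = 0" "h = f \<or> h = g" for h
  proof -
    have "integrable M (\<lambda>x. (cmod (h x))\<^sup>2)" using that f g by (auto simp: square_integrable_def)
    moreover have "(\<integral>x. (cmod (h x))\<^sup>2 \<partial>M) = 0" using that(1) l2norm_sq[of M h] by simp
    ultimately have "AE x in M. (cmod (h x))\<^sup>2 = 0" by (subst (asm) integral_nonneg_eq_0_iff_AE) auto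
    then have "AE x in M. cmod (f x) * cmod (g x) = 0" using that(2) by auto
    then have "(\<integral>x. cmod (f x) * cmod (g x) \<partial>M) = (\<integral>x. 0 \<partial>M)" by (intro integral_cong_AE) auto
    then show ?thesis by simp
  qed
  consider "l2norm M f = 0" | "l2norm M g = 0" | "l2norm M f > 0" "l2norm M g > 0"
    using l2norm_nonneg[of M f] l2norm_nonneg[of M g] unfolding le_less by metis
  then show ?thesis
  proof cases
    case 3
    define A B where "A = l2norm M f" and "B = l2norm M g"
    have pos: "A > 0" "B > 0" using 3 by (auto simp: A_def B_def)
    have pt: "s * t \<le> (B / A * s\<^sup>2 + A / B * t\<^sup>2) / 2" for s t
    proof -
      have "0 \<le> (B * s - A * t)\<^sup>2" by simp
      then have "2 * (A * B * (s * t)) \<le> B\<^sup>2 * s\<^sup>2 + A\<^sup>2 * t\<^sup>2"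
        by (simp add: power2_eq_square algebra_simps)
      then have "A * B * (2 * (s * t)) \<le> A * B * (B / A * s\<^sup>2 + A / B * t\<^sup>2)"
        using pos by (simp add: power2_eq_square algebra_simps)
      then show ?thesis using pos by simp
    qed
    have "(\<integral>x. cmod (f x) * cmod (g x) \<partial>M) \<le> (\<integral>x. (B / A * (cmod (f x))\<^sup>2 + A / B * (cmod (g x))\<^sup>2) / 2 \<partial>M)"
      using integrable_norm_mult[OF f g] square_integrableD[OF f] square_integrableD[OF g] pt
      by (intro integral_mono) auto
    also have "\<dots> = (B / A * A\<^sup>2 + A / B * B\<^sup>2) / 2"
      using square_integrableD[OF f] square_integrableD[OF g] by (simp add: A_def B_def l2norm_sq)
    also have "\<dots> = A * B" using pos by (simp add: power2_eq_square)
    finally show ?thesis by (simp add: A_def B_def)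
  qed (use zero in auto)
qed

lemma norm_integral_mult_le:
  assumes f: "square_integrable M f" and g: "square_integrable M g"
  shows "cmod (\<integral>x. f x * g x \<partial>M) \<le> l2norm M f * l2norm M g"
  using integral_norm_bound[of M "\<lambda>x. f x * g x"] integral_norm_mult_le[OF f g] by (simp add: norm_mult)

lemma l2norm_triangle:
  assumes f: "square_integrable M f" and g: "square_integrable M g"
  shows "l2norm M (\<lambda>x. f x + g x) \<le> l2norm M f + l2norm M g"
proof (rule power2_le_imp_le)
  have "(l2norm M (\<lambda>x. f x + g x))\<^sup>2 \<le> (\<integral>x. (cmod (f x))\<^sup>2 + 2 * (cmod (f x) * cmod (g x)) + (cmod (g x))\<^sup>2 \<partial>M)"
    unfolding l2norm_sq
  proof (intro integral_mono)
    show "integrable M (\<lambda>x. (cmod (f x))\<^sup>2 + 2 * (cmod (f x) * cmod (g x)) + (cmod (g x))\<^sup>2)"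
      using f g integrable_norm_mult[OF f g] by (auto simp: square_integrable_def)
    have "(cmod (f x + g x))\<^sup>2 \<le> (cmod (f x) + cmod (g x))\<^sup>2" for x by (intro power_mono norm_triangle_ineq) auto
    then show "(cmod (f x + g x))\<^sup>2 \<le> (cmod (f x))\<^sup>2 + 2 * (cmod (f x) * cmod (g x)) + (cmod (g x))\<^sup>2" for x
      by (simp add: power2_sum algebra_simps)
  qed (rule square_integrableD[OF square_integrable_add[OF f g]])
  also have "\<dots> = (l2norm M f)\<^sup>2 + 2 * (\<integral>x. cmod (f x) * cmod (g x) \<partial>M) + (l2norm M g)\<^sup>2"
    using f g integrable_norm_mult[OF f g] by (simp add: square_integrable_def l2norm_sq)
  also have "\<dots> \<le> (l2norm M f + l2norm M g)\<^sup>2"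
    using integral_norm_mult_le[OF f g] by (simp add: power2_sum algebra_simps)
  finally show "(l2norm M (\<lambda>x. f x + g x))\<^sup>2 \<le> (l2norm M f + l2norm M g)\<^sup>2" .
qed simp

lemma l2norm_triangle_diff:
  assumes f: "square_integrable M f" and g: "square_integrable M g" and h: "square_integrable M h"
  shows "l2norm M (\<lambda>x. f x - h x) \<le> l2norm M (\<lambda>x. f x - g x) + l2norm M (\<lambda>x. g x - h x)"
  using l2norm_triangle[OF square_integrable_diff[OF f g] square_integrable_diff[OF g h]] by simp

lemma l2norm_diff_abs_le:
  assumes f: "square_integrable M f" and g: "square_integrable M g"
  shows "\<bar>l2norm M f - l2norm M g\<bar> \<le> l2norm M (\<lambda>x. f x - g x)"
  using l2norm_triangle[OF square_integrable_diff[OF f g] g] l2norm_triangle[OF square_integrable_diff[OF g f] f]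
    l2norm_minus_commute[of M f g] by simp

lemma l2norm_tendsto:
  assumes "\<And>n. square_integrable M (f n)" "square_integrable M g"
    and "((\<lambda>n. l2norm M (\<lambda>x. f n x - g x)) \<longlongrightarrow> 0) F"
  shows "((\<lambda>n. l2norm M (f n)) \<longlongrightarrow> l2norm M g) F"
proof -
  have "((\<lambda>n. l2norm M (f n) - l2norm M g) \<longlongrightarrow> 0) F"
    using assms(3) l2norm_diff_abs_le[OF assms(1,2)] by (intro Lim_null_comparison[OF _ assms(3)]) auto
  then show ?thesis by (simp add: LIM_zero_iff)
qed

lemma integral_mult_tendsto:
  assumes f: "\<And>n. square_integrable M (f n)" "square_integrable M f'"
    and g: "\<And>n. square_integrable M (g n)" "square_integrable M g'"
    and "((\<lambda>n. l2norm M (\<lambda>x. f n x - f' x)) \<longlongrightarrow> 0) F" "((\<lambda>n. l2norm M (\<lambda>x. g n x - g' x)) \<longlongrightarrow> 0) F"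
  shows "((\<lambda>n. \<integral>x. f n x * g n x \<partial>M) \<longlongrightarrow> (\<integral>x. f' x * g' x \<partial>M)) F"
proof -
  have "((\<lambda>n. (\<integral>x. f n x * g n x \<partial>M) - (\<integral>x. f' x * g' x \<partial>M)) \<longlongrightarrow> 0) F"
  proof (rule Lim_null_comparison)
    show "((\<lambda>n. l2norm M (\<lambda>x. f n x - f' x) * l2norm M (g n) + l2norm M f' * l2norm M (\<lambda>x. g n x - g' x)) \<longlongrightarrow> 0) F"
      using tendsto_add[OF tendsto_mult[OF assms(5) l2norm_tendsto[OF g assms(6)]] tendsto_mult[OF tendsto_const[of "l2norm M f'"] assms(6)]]
      by simp
    have "cmod ((\<integral>x. f n x * g n x \<partial>M) - (\<integral>x. f' x * g' x \<partial>M))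
       \<le> l2norm M (\<lambda>x. f n x - f' x) * l2norm M (g n) + l2norm M f' * l2norm M (\<lambda>x. g n x - g' x)" for n
    proof -
      have "(\<integral>x. f n x * g n x \<partial>M) - (\<integral>x. f' x * g' x \<partial>M)
        = (\<integral>x. (f n x - f' x) * g n x \<partial>M) + (\<integral>x. f' x * (g n x - g' x) \<partial>M)"
        using f g by (simp add: algebra_simps integrable_square_mult)
      also have "cmod \<dots> \<le> l2norm M (\<lambda>x. f n x - f' x) * l2norm M (g n) + l2norm M f' * l2norm M (\<lambda>x. g n x - g' x)"
        using f g by (intro order_trans[OF norm_triangle_ineq] add_mono norm_integral_mult_le square_integrable_diff)
      finally show ?thesis .
    qed
    then show "\<forall>\<^sub>F n in F. norm ((\<integral>x. f n x * g n x \<partial>M) - (\<integral>x. f' x * g' x \<partial>M))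
       \<le> l2norm M (\<lambda>x. f n x - f' x) * l2norm M (g n) + l2norm M f' * l2norm M (\<lambda>x. g n x - g' x)" by simp
  qed
  then show ?thesis by (simp add: LIM_zero_iff)
qed

lemma l2norm_tendsto_0_iff:
  "((\<lambda>n. l2norm M (f n)) \<longlongrightarrow> 0) F \<longleftrightarrow> ((\<lambda>n. \<integral>x. (cmod (f n x))\<^sup>2 \<partial>M) \<longlongrightarrow> 0) F"
  using tendsto_real_sqrt[of "\<lambda>n. \<integral>x. (cmod (f n x))\<^sup>2 \<partial>M" 0 F] tendsto_power[of "\<lambda>n. l2norm M (f n)" 0 F 2]
  by (auto simp: l2norm_sq l2norm_def [symmetric])

subsection \<open>Density of Gaussian trigonometric polynomials\<close>

lemma trig_poly_sum_list: "trig_poly xs t = (\<Sum>z\<leftarrow>xs. fst z * cis (snd z * t))"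
  by (simp add: trig_poly_def sum_list_sum_nth atLeast0LessThan)

lemma trig_poly_append: "trig_poly (xs @ ys) t = trig_poly xs t + trig_poly ys t"
  by (simp add: trig_poly_sum_list)

lemma trig_poly_scale: "trig_poly (map (\<lambda>z. (c * fst z, snd z)) xs) t = c * trig_poly xs t"
  by (induction xs) (simp_all add: trig_poly_sum_list algebra_simps)

lemma gauss_trig_diff:
  "gauss_trig a (xs @ map (\<lambda>z. (- 1 * fst z, snd z)) ys) t = gauss_trig a xs t - gauss_trig a ys t"
  unfolding gauss_trig_def trig_poly_append trig_poly_scale by (simp add: algebra_simps)

lemma trig_poly_mult: "\<exists>zs. \<forall>t. trig_poly zs t = trig_poly xs t * trig_poly ys t"
proof (induction xs)
  case Nil
  show ?case by (rule exI[of _ "[]"]) (simp add: trig_poly_sum_list)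
next
  case (Cons x xs)
  then obtain zs where zs: "\<And>t. trig_poly zs t = trig_poly xs t * trig_poly ys t" by blast
  have cis: "cis ((u + v) * t) = cis (u * t) * cis (v * t)" for u v t
    by (simp add: cis_mult distrib_right)
  have "trig_poly (map (\<lambda>z. (fst x * fst z, snd x + snd z)) ys) t = fst x * cis (snd x * t) * trig_poly ys t" for t
    by (induction ys) (simp_all add: trig_poly_sum_list cis distrib_left)
  then have "trig_poly (map (\<lambda>z. (fst x * fst z, snd x + snd z)) ys @ zs) t = trig_poly (x # xs) t * trig_poly ys t" for t
    by (simp add: trig_poly_append zs) (simp add: trig_poly_sum_list distrib_right)
  then show ?case by blast
qed

text \<open>On the circle a real-linear function is a combination of cosine and sine, hence of the
  frequencies \<open>k\<close> and \<open>- k\<close>; trigonometric polynomials are closed under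
  sums and products.\<close>

lemma real_polynomial_function_trig:
  assumes "real_polynomial_function g"
  shows "\<exists>xs. \<forall>t. trig_poly xs t = of_real (g (cis (k * t)))"
  using assms
proof (induction rule: real_polynomial_function.induct)
  case (linear g)
  have lin: "g (cis y) = cos y * g 1 + sin y * g \<i>" for y
  proof -
    have "cis y = cos y *\<^sub>R 1 + sin y *\<^sub>R \<i>" by (simp add: complex_eq_iff)
    then show ?thesis using linear by (simp only: linear_simps real_scaleR_def)
  qed
  have "trig_poly [((g 1 - \<i> * g \<i>) / 2, k), ((g 1 + \<i> * g \<i>) / 2, - k)] t = of_real (g (cis (k * t)))" for t
    unfolding lin by (simp add: trig_poly_sum_list complex_eq_iff field_simps)
  then show ?case by blast
next
  case (const c)
  have "trig_poly [(of_real c, 0)] t = of_real c" for t by (simp add: trig_poly_sum_list)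
  then show ?case by blast
next
  case (add f g)
  then obtain xs ys where *: "\<And>t. trig_poly xs t = of_real (f (cis (k * t)))" "\<And>t. trig_poly ys t = of_real (g (cis (k * t)))"
    by blast
  have "trig_poly (xs @ ys) t = of_real (f (cis (k * t)) + g (cis (k * t)))" for t
    by (simp add: trig_poly_append *)
  then show ?case by blast
next
  case (mult f g)
  then obtain xs ys where *: "\<And>t. trig_poly xs t = of_real (f (cis (k * t)))" "\<And>t. trig_poly ys t = of_real (g (cis (k * t)))"
    by blast
  obtain zs where "\<And>t. trig_poly zs t = trig_poly xs t * trig_poly ys t" using trig_poly_mult by blast
  then show ?case using * by auto
qed

text \<open>
  Stone--Weierstrass on the unit circle; the bound \<open>K + e\<close> holds on the whole line because the
  approximant is periodic.
\<close>
lemma trig_poly_approx: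
  fixes h :: "real \<Rightarrow> complex"
  assumes h: "continuous_on UNIV h" and supp: "\<And>x. \<bar>x\<bar> \<ge> R \<Longrightarrow> h x = 0" and R: "R > 0" and e: "e > 0"
    and K: "\<And>x. cmod (h x) \<le> K"
  shows "\<exists>xs. (\<forall>x. \<bar>x\<bar> \<le> R \<longrightarrow> cmod (h x - trig_poly xs x) \<le> e) \<and> (\<forall>x. cmod (trig_poly xs x) \<le> K + e)"
proof -
  \<comment> \<open>With this scaling \<open>{-R..R}\<close> covers the right half of the circle.
    The transplanted function vanishes for \<open>Re z < 0\<close>, so the branch cut of
    \<open>Arg\<close> does not harm its continuity.\<close>
  define k where "k = pi / (2 * R)"
  have k: "k > 0" using R by (simp add: k_def)
  define H where "H z = h (Arg z / k)" for z
  have far: "H z = 0" if "Re z < 0" for z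
  proof -
    have "z \<noteq> 0" using that by auto
    then have "\<bar>Arg z\<bar> \<ge> pi / 2" using Arg_Re_pos[of z] that by auto
    then have "\<bar>Arg z / k\<bar> \<ge> R" using R by (simp add: k_def abs_mult field_simps)
    then show ?thesis by (simp add: H_def supp)
  qed
  have "continuous_on ({z. Re z < 0} \<union> - \<real>\<^sub>\<le>\<^sub>0) H"
  proof (rule continuous_on_open_Un)
    show "open {z. Re z < 0}" by (rule open_halfspace_Re_lt)
    show "open (- \<real>\<^sub>\<le>\<^sub>0 :: complex set)" by (intro open_Compl closed_nonpos_Reals_complex)
    show "continuous_on {z. Re z < 0} H"
      by (rule continuous_on_eq[where f = "\<lambda>_. 0"]) (auto simp: far)
    show "continuous_on (- \<real>\<^sub>\<le>\<^sub>0) H" unfolding H_def using k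
      by (intro continuous_on_compose2[OF h] continuous_intros) auto
  qed
  moreover have "sphere 0 1 \<subseteq> {z. Re z < 0} \<union> - \<real>\<^sub>\<le>\<^sub>0"
  proof
    fix z :: complex assume z: "z \<in> sphere 0 1"
    have "z = 0" if "z \<in> \<real>\<^sub>\<le>\<^sub>0" "\<not> Re z < 0"
      using that by (simp add: complex_nonpos_Reals_iff complex_eq_iff)
    then show "z \<in> {z. Re z < 0} \<union> - \<real>\<^sub>\<le>\<^sub>0" using z by auto
  qed
  ultimately have "continuous_on (sphere 0 1) H" by (rule continuous_on_subset)
  then obtain g where g: "polynomial_function g" "\<And>z. z \<in> sphere 0 1 \<Longrightarrow> cmod (H z - g z) < e"
    using Stone_Weierstrass_polynomial_function[of "sphere 0 1" H e] e by auto
  have "real_polynomial_function (\<lambda>z. Re (g z))" "real_polynomial_function (\<lambda>z. Im (g z))"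
    using g(1) bounded_linear_Re bounded_linear_Im by (auto simp: polynomial_function_def o_def)
  then obtain xs ys where xs: "\<And>t. trig_poly xs t = of_real (Re (g (cis (k * t))))" "\<And>t. trig_poly ys t = of_real (Im (g (cis (k * t))))"
    using real_polynomial_function_trig by metis
  define zs where "zs = xs @ map (\<lambda>z. (\<i> * fst z, snd z)) ys"
  have zs: "trig_poly zs t = g (cis (k * t))" for t
    unfolding zs_def trig_poly_append trig_poly_scale xs by (simp add: complex_eq_iff)
  have "cmod (h x - trig_poly zs x) \<le> e" if "\<bar>x\<bar> \<le> R" for x
  proof -
    have "\<bar>k * x\<bar> \<le> k * R" using that k by (simp add: abs_mult)
    also have "k * R = pi / 2" using R by (simp add: k_def)
    finally have "- pi < k * x" "k * x \<le> pi" using pi_gt_zero by linarith+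
    then have "k * x \<in> {- pi<..pi}" by simp
    then have "H (cis (k * x)) = h x" using k by (simp add: H_def Arg_cis)
    then show ?thesis using g(2)[of "cis (k * x)"] by (simp add: zs)
  qed
  moreover have "cmod (trig_poly zs x) \<le> K + e" for x
  proof -
    have "cmod (g (cis (k * x))) \<le> cmod (H (cis (k * x))) + cmod (H (cis (k * x)) - g (cis (k * x)))"
      by (metis norm_minus_commute norm_triangle_sub)
    then show ?thesis using g(2)[of "cis (k * x)"] K[of "Arg (cis (k * x)) / k"] by (simp add: zs H_def)
  qed
  ultimately show ?thesis by blast
qed

section \<open>Simultaneous approximation in L1 and L2\<close>

definition L1L2 :: "(real \<Rightarrow> complex) \<Rightarrow> bool" where
  "L1L2 f \<longleftrightarrow> square_integrable lborel f \<and> integrable lborel f"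

text \<open>L1 convergence gives pointwise convergence of Fourier transforms, L2 convergence feeds
  Plancherel, and the two together control L^p for \<open>p\<close> in between. The second term is
  the square of the L2 distance, hence the factor 2 in \<open>dist12_triangle\<close>.\<close>

definition dist12 :: "(real \<Rightarrow> complex) \<Rightarrow> (real \<Rightarrow> complex) \<Rightarrow> real" where
  "dist12 f g = (LBINT x. cmod (f x - g x)) + (LBINT x. (cmod (f x - g x))\<^sup>2)"

lemma L1L2_measurable [measurable_dest]: "L1L2 f \<Longrightarrow> f \<in> borel_measurable lborel"
  by (simp add: L1L2_def square_integrable_def)

lemma L1L2_diff: "L1L2 f \<Longrightarrow> L1L2 g \<Longrightarrow> L1L2 (\<lambda>x. f x - g x)"
  by (simp add: L1L2_def square_integrable_diff)

lemma L1L2_bound: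
  assumes g: "L1L2 g" and f: "f \<in> borel_measurable lborel" and le: "\<And>x. cmod (f x) \<le> cmod (g x)"
  shows "L1L2 f"
  unfolding L1L2_def
proof
  show "square_integrable lborel f"
    by (rule square_integrable_bound[where C = 1 and g = g]) (use g f le in \<open>simp_all add: L1L2_def\<close>)
  show "integrable lborel f"
    by (rule Bochner_Integration.integrable_bound[of lborel g]) (use g f le in \<open>simp_all add: L1L2_def\<close>)
qed

lemma L1L2_gauss_trig: "a > 0 \<Longrightarrow> L1L2 (gauss_trig a xs)"
proof -
  assume a: "a > 0"
  have "integrable lborel (\<lambda>t. norm (gauss_trig a xs t))"
    using integrable_gauss_trig_powr[OF a, of 1 xs] by simp
  then have "integrable lborel (gauss_trig a xs)" by (subst (asm) integrable_norm_iff) auto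
  moreover have "integrable lborel (\<lambda>t. (cmod (gauss_trig a xs t))\<^sup>2)"
    using integrable_gauss_trig_powr[OF a, of 2 xs] by (simp add: powr_numeral)
  ultimately show ?thesis by (simp add: L1L2_def square_integrable_def)
qed

lemma L1L2_bounded_support:
  assumes [measurable]: "f \<in> borel_measurable lborel" and "\<And>x. cmod (f x) \<le> M" "\<And>x. \<bar>x\<bar> > T \<Longrightarrow> f x = 0"
  shows "L1L2 f"
proof -
  have bd: "cmod (f x) \<le> M * indicator {-T..T} x" for x
    using assms(2)[of x] assms(3)[of x] by (auto simp: indicator_def abs_if split: if_splits)
  have ind: "integrable lborel (\<lambda>x. c * indicator {-T..T} x :: real)" for c
    by (rule integrable_mult_right) (simp add: integrable_indicator_iff emeasure_lborel_Icc_eq)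
  have "integrable lborel f"
    by (rule Bochner_Integration.integrable_bound[OF ind[of M]]) (use bd in \<open>auto intro: order_trans[OF _ abs_ge_self]\<close>)
  moreover have "integrable lborel (\<lambda>x. (cmod (f x))\<^sup>2)"
  proof (rule Bochner_Integration.integrable_bound[OF ind[of "M\<^sup>2"]])
    have "(cmod (f x))\<^sup>2 \<le> (M * indicator {-T..T} x)\<^sup>2" for x using bd by (intro power_mono) auto
    also have "(M * indicator {-T..T} x)\<^sup>2 = M\<^sup>2 * indicator {-T..T} x" for x
      by (simp add: indicator_def)
    finally show "AE x in lborel. norm ((cmod (f x))\<^sup>2) \<le> norm (M\<^sup>2 * indicator {-T..T} x)" by (auto simp: abs_mult)
  qed measurable
  ultimately show ?thesis by (simp add: L1L2_def square_integrable_def)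
qed

lemma dist12_dominated:
  assumes g: "L1L2 g" and f: "L1L2 f" and fn: "\<And>n. f' n \<in> borel_measurable lborel"
    and le: "\<And>n x. cmod (f x - f' n x) \<le> cmod (g x)"
    and lim: "AE x in lborel. (\<lambda>n. f' n x) \<longlonglongrightarrow> f x"
  shows "(\<lambda>n. dist12 f (f' n)) \<longlonglongrightarrow> 0"
proof -
  note [measurable] = L1L2_measurable[OF g] L1L2_measurable[OF f] fn
  have lim': "AE x in lborel. (\<lambda>n. cmod (f x - f' n x)) \<longlonglongrightarrow> 0"
    using lim
  proof eventually_elim
    case (elim x)
    have "cmod (f x - f' n x) = cmod (f' n x - f x)" for n by (rule norm_minus_commute)
    then show ?case using tendsto_norm_zero[OF LIM_zero[OF elim]] by simp
  qed
  have "(\<lambda>n. \<integral>x. cmod (f x - f' n x) \<partial>lborel) \<longlonglongrightarrow> (\<integral>x. 0 \<partial>(lborel :: real measure))"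
  proof (rule integral_dominated_convergence[where w = "\<lambda>x. cmod (g x)"])
    show "integrable lborel (\<lambda>x. cmod (g x))" using g by (simp add: L1L2_def)
  qed (use lim' le in auto)
  moreover have "(\<lambda>n. \<integral>x. (cmod (f x - f' n x))\<^sup>2 \<partial>lborel) \<longlonglongrightarrow> (\<integral>x. 0 \<partial>(lborel :: real measure))"
  proof (rule integral_dominated_convergence[where w = "\<lambda>x. (cmod (g x))\<^sup>2"])
    show "integrable lborel (\<lambda>x. (cmod (g x))\<^sup>2)" using g by (simp add: L1L2_def square_integrable_def)
    show "AE x in lborel. (\<lambda>n. (cmod (f x - f' n x))\<^sup>2) \<longlonglongrightarrow> 0"
      using lim' by eventually_elim (auto intro!: tendsto_eq_intros)
    show "AE x in lborel. norm ((cmod (f x - f' n x))\<^sup>2) \<le> (cmod (g x))\<^sup>2" for n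
      using le by (auto intro!: power_mono)
  qed auto
  ultimately show ?thesis unfolding dist12_def using tendsto_add by fastforce
qed

lemma dist12_nonneg: "0 \<le> dist12 f g"
  unfolding dist12_def by (rule add_nonneg_nonneg) (simp_all add: integral_nonneg_AE)

lemma dist12_triangle:
  assumes f: "L1L2 f" and g: "L1L2 g" and h: "L1L2 h"
  shows "dist12 f h \<le> 2 * dist12 f g + 2 * dist12 g h"
proof -
  have i1: "integrable lborel (\<lambda>x. cmod (u x - v x))" and i2: "integrable lborel (\<lambda>x. (cmod (u x - v x))\<^sup>2)"
    if "L1L2 u" "L1L2 v" for u v
    using L1L2_diff[OF that] by (auto simp: L1L2_def square_integrable_def)
  have "(LBINT x. cmod (f x - h x)) \<le> (LBINT x. 2 * cmod (f x - g x) + 2 * cmod (g x - h x))"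
  proof (intro integral_mono)
    show "cmod (f x - h x) \<le> 2 * cmod (f x - g x) + 2 * cmod (g x - h x)" for x
    proof -
      have "cmod (f x - h x) \<le> cmod (f x - g x) + cmod (g x - h x)"
        using norm_triangle_ineq[of "f x - g x" "g x - h x"] by simp
      moreover have "0 \<le> cmod (f x - g x)" "0 \<le> cmod (g x - h x)" by simp_all
      ultimately show ?thesis by linarith
    qed
  qed (use i1 f g h in auto)
  moreover have "(LBINT x. (cmod (f x - h x))\<^sup>2) \<le> (LBINT x. 2 * (cmod (f x - g x))\<^sup>2 + 2 * (cmod (g x - h x))\<^sup>2)"
  proof (intro integral_mono)
    show "(cmod (f x - h x))\<^sup>2 \<le> 2 * (cmod (f x - g x))\<^sup>2 + 2 * (cmod (g x - h x))\<^sup>2" for x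
      using cmod_add_sq_le[of "f x - g x" "g x - h x"] by simp
  qed (use i2 f g h in auto)
  ultimately show ?thesis unfolding dist12_def using i1 i2 f g h by simp
qed

definition gauss_approx :: "real \<Rightarrow> (real \<Rightarrow> complex) \<Rightarrow> bool" where
  "gauss_approx a f \<longleftrightarrow> (\<forall>e>0. \<exists>xs. dist12 f (gauss_trig a xs) < e)"

lemma gauss_approx_limit:
  assumes a: "a > 0" and f: "L1L2 f" and fn: "\<And>n. L1L2 (f' n)" "\<And>n. gauss_approx a (f' n)"
    and lim: "(\<lambda>n. dist12 f (f' n)) \<longlonglongrightarrow> 0"
  shows "gauss_approx a f"
  unfolding gauss_approx_def
proof (intro allI impI)
  fix e :: real assume e: "e > 0"
  then have "\<forall>\<^sub>F n in sequentially. dist12 f (f' n) < e / 4"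
    using lim by (intro order_tendstoD(2)) auto
  then obtain n where n: "dist12 f (f' n) < e / 4" by (meson eventually_happens sequentially_bot)
  obtain xs where xs: "dist12 (f' n) (gauss_trig a xs) < e / 4"
    using fn(2)[of n] e unfolding gauss_approx_def by (meson divide_pos_pos zero_less_numeral)
  have "dist12 f (gauss_trig a xs) \<le> 2 * dist12 f (f' n) + 2 * dist12 (f' n) (gauss_trig a xs)"
    by (intro dist12_triangle f fn L1L2_gauss_trig a)
  then show "\<exists>xs. dist12 f (gauss_trig a xs) < e" using n xs by (intro exI[of _ xs]) linarith
qed

text \<open>The function \<open>exp (a * x\<^sup>2) * f x\<close> is approximated by uniformly
  bounded trigonometric polynomials on windows of radius \<open>R + n\<close>. They do not decay
  outside, but every point eventually lies in the windows, and after multiplication by the Gaussian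
  factor a fixed Gaussian dominates the error.\<close>

lemma gauss_approx_continuous:
  assumes a: "a > 0" and f: "continuous_on UNIV f" and supp: "\<And>x. \<bar>x\<bar> \<ge> R \<Longrightarrow> f x = 0" and R: "R > 0"
  shows "gauss_approx a f"
proof -
  define h where "h x = of_real (exp (a * x\<^sup>2)) * f x" for x
  have h: "continuous_on UNIV h" unfolding h_def by (intro continuous_intros f)
  have hf: "f x = of_real (exp (- (a * x\<^sup>2))) * h x" for x
    by (simp add: h_def exp_minus flip: of_real_mult)
  have "compact (h ` {-R..R})" by (intro compact_continuous_image continuous_on_subset[OF h]) auto
  then obtain K where K0: "K > 0" "\<And>z. z \<in> h ` {-R..R} \<Longrightarrow> cmod z \<le> K"
    using bounded_pos[of "h ` {-R..R}"] compact_imp_bounded by auto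
  have K: "cmod (h x) \<le> K" for x
    using K0 supp[of x] by (cases "\<bar>x\<bar> \<le> R") (auto simp: h_def abs_le_iff)
  have "\<exists>xs. (\<forall>x. \<bar>x\<bar> \<le> R + n \<longrightarrow> cmod (h x - trig_poly xs x) \<le> 1 / (1 + real n)) \<and> (\<forall>x. cmod (trig_poly xs x) \<le> K + 1 / (1 + real n))" for n
    using R supp by (intro trig_poly_approx h K) (auto simp: h_def)
  then obtain X where X: "\<And>n x. \<bar>x\<bar> \<le> R + real n \<Longrightarrow> cmod (h x - trig_poly (X n) x) \<le> 1 / (1 + real n)"
      "\<And>n x. cmod (trig_poly (X n) x) \<le> K + 1 / (1 + real n)" by metis
  have fL: "L1L2 f"
  proof (rule L1L2_bounded_support)
    show "f \<in> borel_measurable lborel" using f by (simp add: borel_measurable_continuous_onI)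
    have "exp (- (a * x\<^sup>2)) * cmod (h x) \<le> 1 * K" for x
      using a K[of x] by (intro mult_mono) auto
    then show "cmod (f x) \<le> K" for x by (simp add: hf[of x] norm_mult)
    show "f x = 0" if "\<bar>x\<bar> > R" for x using supp that by auto
  qed
  have diff: "f x - gauss_trig a (X n) x = of_real (exp (- (a * x\<^sup>2))) * (h x - trig_poly (X n) x)" for x n
    unfolding hf[of x] gauss_trig_def by (simp add: algebra_simps)
  have "(\<lambda>n. dist12 f (gauss_trig a (X n))) \<longlonglongrightarrow> 0"
  proof (rule dist12_dominated[OF _ fL])
    show "L1L2 (gauss_trig a [(of_real (2 * K + 1), 0)])" using a by (rule L1L2_gauss_trig)
    show "cmod (f x - gauss_trig a (X n) x) \<le> cmod (gauss_trig a [(of_real (2 * K + 1), 0)] x)" for n x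
    proof -
      have "cmod (h x - trig_poly (X n) x) \<le> cmod (h x) + cmod (trig_poly (X n) x)" by (rule norm_triangle_ineq4)
      also have "\<dots> \<le> 2 * K + 1" 
      proof -
        have "1 / (1 + real n) \<le> 1" by simp
        then show ?thesis using K[of x] X(2)[of n x] by linarith
      qed
      finally have "cmod (h x - trig_poly (X n) x) \<le> 2 * K + 1" .
      then have "cmod (f x - gauss_trig a (X n) x) \<le> exp (- (a * x\<^sup>2)) * (2 * K + 1)"
        unfolding diff norm_mult by simp
      also have "\<dots> = cmod (gauss_trig a [(of_real (2 * K + 1), 0)] x)"
      proof -
        have "cmod (gauss_trig a [(of_real C, 0)] x) = exp (- (a * x\<^sup>2)) * \<bar>C\<bar>" for C
          by (simp add: gauss_trig_def trig_poly_sum_list norm_mult)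
        moreover have "\<bar>2 * K + 1\<bar> = 2 * K + 1" using K0(1) by simp
        ultimately show ?thesis by (simp only:)
      qed
      finally show ?thesis .
    qed
    show "AE x in lborel. (\<lambda>n. gauss_trig a (X n) x) \<longlonglongrightarrow> f x"
    proof (rule AE_I2)
      fix x
      have "(\<lambda>n. f x - gauss_trig a (X n) x) \<longlonglongrightarrow> 0"
      proof (rule Lim_null_comparison)
        obtain N :: nat where N: "\<bar>x\<bar> \<le> N" using real_arch_simple by blast
        show "\<forall>\<^sub>F n in sequentially. norm (f x - gauss_trig a (X n) x) \<le> 1 / (1 + real n)"
          using eventually_ge_at_top[of N]
        proof eventually_elim
          case (elim n)
          have "exp (- (a * x\<^sup>2)) * cmod (h x - trig_poly (X n) x) \<le> 1 * (1 / (1 + real n))"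
          proof (rule mult_mono)
            have "\<bar>x\<bar> \<le> R + real n" using elim N R by linarith
            then show "cmod (h x - trig_poly (X n) x) \<le> 1 / (1 + real n)" by (rule X(1))
          qed (use a in auto)
          then show ?case unfolding diff norm_mult by simp
        qed
        show "(\<lambda>n. 1 / (1 + real n)) \<longlonglongrightarrow> 0" by real_asymp
      qed
      then have "(\<lambda>n. f x - (f x - gauss_trig a (X n) x)) \<longlonglongrightarrow> f x - 0" by (intro tendsto_intros)
      then show "(\<lambda>n. gauss_trig a (X n) x) \<longlonglongrightarrow> f x" by simp
    qed
  qed auto
  then show ?thesis unfolding gauss_approx_def
  proof (intro allI impI)
    fix e :: real assume "e > 0"
    then have "\<forall>\<^sub>F n in sequentially. dist12 f (gauss_trig a (X n)) < e"
      using \<open>_ \<longlonglongrightarrow> 0\<close> by (intro order_tendstoD(2)) auto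
    then show "\<exists>xs. dist12 f (gauss_trig a xs) < e" by (meson eventually_happens sequentially_bot)
  qed
qed

lemma gauss_approx_bounded:
  assumes a: "a > 0" and f: "f \<in> borel_measurable lborel" and M: "\<And>x. cmod (f x) \<le> M" and T: "\<And>x. \<bar>x\<bar> > T \<Longrightarrow> f x = 0" "T > 0"
  shows "gauss_approx a f"
proof -
  have M0: "M \<ge> 0" using M[of 0] norm_ge_zero order_trans by blast
  have "f \<in> borel_measurable lebesgue" using f by (simp add: measurable_completion)
  then have "f measurable_on UNIV" by (intro lebesgue_measurable_imp_measurable_on) auto
  then obtain N G where NG: "negligible N" "\<And>n. continuous_on UNIV (G n)" "\<And>x. x \<notin> N \<Longrightarrow> (\<lambda>n. G n x) \<longlonglongrightarrow> f x"
    by (auto simp: measurable_on_def)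
  \<comment> \<open>The continuous approximants \<open>G n\<close> need be neither bounded nor
    compactly supported. The cutoff \<open>cut\<close> is 1 on \<open>{-T..T}\<close> and 0 beyond
    \<open>T + 1\<close>, and \<open>cl\<close> projects radially onto the disc of radius
    \<open>M\<close>; both leave \<open>f\<close> unchanged.\<close>
  define cut where "cut x = max 0 (min 1 (T + 1 - \<bar>x\<bar>))" for x
  define cl where "cl z = of_real (M / max M (cmod z)) * z" for z
  \<comment> \<open>For \<open>M = 0\<close> the denominator in \<open>cl\<close> vanishes at
    \<open>z = 0\<close>, so this case is split off to obtain continuity.\<close>
  define cl' where "cl' z = (if M = 0 then 0 else cl z)" for z
  define g where "g n x = of_real (cut x) * cl' (G n x)" for n x
  have clc: "continuous_on UNIV cl'"
    unfolding cl'_def cl_def using M0 by (cases "M = 0") (auto intro!: continuous_intros)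
  have gc: "continuous_on UNIV (g n)" for n
    unfolding g_def cut_def by (intro continuous_intros continuous_on_compose2[OF clc] NG) auto
  have clM: "cmod (cl' z) \<le> M" for z
    using M0 by (auto simp: cl'_def cl_def norm_mult norm_divide field_simps max_def)
  have clf: "cl' (f x) = f x" for x
    using M[of x] M0 by (auto simp: cl'_def cl_def max_def)
  have gM: "cmod (g n x) \<le> M" for n x
  proof -
    have "\<bar>cut x\<bar> * cmod (cl' (G n x)) \<le> 1 * M" using clM by (intro mult_mono) (auto simp: cut_def)
    then show ?thesis by (simp add: g_def norm_mult)
  qed
  have gT: "g n x = 0" if "\<bar>x\<bar> \<ge> T + 1" for n x using that by (simp add: g_def cut_def)
  have gm: "g n \<in> borel_measurable lborel" for n using gc[of n] by (simp add: borel_measurable_continuous_onI)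
  have fL: "L1L2 f" using f M T by (intro L1L2_bounded_support[where T = T and M = M]) auto
  define dom where "dom x = (of_real (2 * M) * indicator {-(T+1)..T+1} x :: complex)" for x
  show ?thesis
  proof (rule gauss_approx_limit[OF a fL])
    show "gauss_approx a (g n)" for n by (rule gauss_approx_continuous[OF a gc, where R = "T + 1"]) (use gT T in auto)
    show "L1L2 (g n)" for n using gm gM gT by (intro L1L2_bounded_support[where T = "T + 1" and M = M]) auto
    show "(\<lambda>n. dist12 f (g n)) \<longlonglongrightarrow> 0"
    proof (rule dist12_dominated[OF _ fL gm])
      show "L1L2 dom" unfolding dom_def using M0
        by (intro L1L2_bounded_support[where T = "T + 1" and M = "2 * M"]) (auto simp: indicator_def norm_mult)
      show "cmod (f x - g n x) \<le> cmod (dom x)" for n x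
      proof (cases "\<bar>x\<bar> \<le> T + 1")
        case True
        have "cmod (f x - g n x) \<le> M + M" using norm_triangle_ineq4[of "f x" "g n x"] M[of x] gM[of n x] by linarith
        then show ?thesis using True M0 by (auto simp: dom_def norm_mult abs_le_iff)
      next
        case False
        then show ?thesis using T gT by simp
      qed
      have "AE x in lebesgue. (\<lambda>n. g n x) \<longlonglongrightarrow> f x"
      proof (rule AE_I')
        show "N \<in> null_sets lebesgue" using NG(1) by (simp add: negligible_iff_null_sets)
        have "(\<lambda>n. g n x) \<longlonglongrightarrow> f x" if "x \<notin> N" for x
        proof -
          have "(\<lambda>n. g n x) \<longlonglongrightarrow> of_real (cut x) * cl' (f x)" unfolding g_def
            using NG(3)[OF that] clc by (intro tendsto_intros isCont_tendsto_compose[of _ cl']) (auto simp: continuous_on_eq_continuous_at)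
          also have "of_real (cut x) * cl' (f x) = f x"
            unfolding clf using T by (cases "\<bar>x\<bar> > T") (auto simp: cut_def)
          finally show ?thesis .
        qed
        then show "{x \<in> space lebesgue. \<not> (\<lambda>n. g n x) \<longlonglongrightarrow> f x} \<subseteq> N" by auto
      qed
      then show "AE x in lborel. (\<lambda>n. g n x) \<longlonglongrightarrow> f x" by (simp add: AE_completion_iff)
    qed
  qed
qed

theorem gauss_approx_L1L2:
  assumes a: "a > 0" and f: "L1L2 f"
  shows "gauss_approx a f"
proof -
  note [measurable] = L1L2_measurable[OF f]
  \<comment> \<open>The support bound is \<open>1 + n\<close> because
    \<open>gauss_approx_bounded\<close> asks for a positive \<open>T\<close>, also at
    \<open>n = 0\<close>.\<close>
  define g where "g n x = (if cmod (f x) \<le> real n \<and> \<bar>x\<bar> \<le> 1 + real n then f x else 0)" for n x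
  have gm: "g n \<in> borel_measurable lborel" for n unfolding g_def by measurable
  show ?thesis
  proof (rule gauss_approx_limit[OF a f])
    show "L1L2 (g n)" for n by (rule L1L2_bound[OF f gm]) (simp add: g_def)
    show "gauss_approx a (g n)" for n
      by (rule gauss_approx_bounded[OF a gm, where M = n and T = "1 + n"]) (auto simp: g_def)
    show "(\<lambda>n. dist12 f (g n)) \<longlonglongrightarrow> 0"
    proof (rule dist12_dominated[OF f f gm])
      show "AE x in lborel. (\<lambda>n. g n x) \<longlonglongrightarrow> f x"
      proof (rule AE_I2, rule tendsto_eventually)
        fix x
        obtain N :: nat where N: "max (cmod (f x)) \<bar>x\<bar> \<le> N" using real_arch_simple by blast
        show "\<forall>\<^sub>F n in sequentially. g n x = f x"
          using eventually_ge_at_top[of N] by eventually_elim (use N in \<open>auto simp: g_def\<close>)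
      qed
    qed (simp add: g_def)
  qed
qed

lemma gauss_approx_sequence:
  assumes a: "a > 0" and f: "L1L2 f"
  obtains X where "(\<lambda>n. dist12 f (gauss_trig a (X n))) \<longlonglongrightarrow> 0"
proof -
  have "\<exists>xs. dist12 f (gauss_trig a xs) < 1 / (1 + real n)" for n
    using gauss_approx_L1L2[OF a f] unfolding gauss_approx_def by simp
  then obtain X where X: "\<And>n. dist12 f (gauss_trig a (X n)) < 1 / (1 + real n)" by metis
  have "(\<lambda>n. dist12 f (gauss_trig a (X n))) \<longlonglongrightarrow> 0"
  proof (rule Lim_null_comparison)
    show "\<forall>\<^sub>F n in sequentially. norm (dist12 f (gauss_trig a (X n))) \<le> 1 / (1 + real n)"
      using X by (auto simp: dist12_nonneg less_imp_le)
    show "(\<lambda>n. 1 / (1 + real n)) \<longlonglongrightarrow> 0" by real_asymp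
  qed
  then show thesis by (rule that)
qed

subsection \<open>Plancherel and the sharp Hausdorff--Young inequality\<close>

lemma borel_measurable_fourier [measurable]:
  assumes [measurable]: "f \<in> borel_measurable lborel"
  shows "fourier f \<in> borel_measurable borel"
  unfolding fourier_def[abs_def] by measurable

lemma fourier_add:
  assumes "integrable lborel f" "integrable lborel g"
  shows "fourier (\<lambda>t. f t + g t) u = fourier f u + fourier g u"
  unfolding fourier_def using assms by (simp add: distrib_right integrable_mult_cis)

lemma fourier_scale: "fourier (\<lambda>t. c * f t) u = c * fourier f u"
  by (simp add: fourier_def mult.assoc)

lemma fourier_diff:
  assumes "integrable lborel f" "integrable lborel g"
  shows "fourier (\<lambda>t. f t - g t) u = fourier f u - fourier g u"
  unfolding fourier_def using assms by (simp add: left_diff_distrib integrable_mult_cis)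

lemma norm_fourier_le: "cmod (fourier f u) \<le> (LBINT t. cmod (f t))"
  unfolding fourier_def using integral_norm_bound[of lborel "\<lambda>t. f t * cis (- (t * u))"] by (simp add: norm_mult)

text \<open>Fatou's lemma for the squares. It serves to send the second index of a Cauchy estimate
  to infinity when convergence is known only pointwise, in \<open>fourier_gauss_limit\<close> and in
  \<open>riesz_fischer\<close>.\<close>

lemma l2norm_fatou:
  assumes h: "\<And>n. square_integrable M (h n)" and h': "h' \<in> borel_measurable M"
    and lim: "AE x in M. (\<lambda>n. h n x) \<longlonglongrightarrow> h' x"
    and le: "\<And>n. l2norm M (h n) \<le> c n" and c: "c \<longlonglongrightarrow> c'"
  shows "square_integrable M h'" "l2norm M h' \<le> c'"
proof -
  note [measurable] = h' square_integrable_measurable[OF h]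
  have c0: "0 \<le> c n" for n using le[of n] l2norm_nonneg[of M "h n"] by linarith
  have c'0: "0 \<le> c'" using c c0 by (intro LIMSEQ_le_const[OF c]) auto
  have "(\<integral>\<^sup>+x. ennreal ((cmod (h' x))\<^sup>2) \<partial>M) = (\<integral>\<^sup>+x. liminf (\<lambda>n. ennreal ((cmod (h n x))\<^sup>2)) \<partial>M)"
  proof (rule nn_integral_cong_AE, use lim in eventually_elim)
    case (elim x)
    then have "(\<lambda>n. ennreal ((cmod (h n x))\<^sup>2)) \<longlonglongrightarrow> ennreal ((cmod (h' x))\<^sup>2)" by (intro tendsto_intros)
    from lim_imp_Liminf[OF trivial_limit_sequentially this] show ?case by simp
  qed
  also have "\<dots> \<le> liminf (\<lambda>n. \<integral>\<^sup>+x. ennreal ((cmod (h n x))\<^sup>2) \<partial>M)" by (rule nn_integral_liminf) measurable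
  also have "\<dots> \<le> liminf (\<lambda>n. ennreal ((c n)\<^sup>2))"
  proof (rule Liminf_mono, rule always_eventually, rule allI)
    fix n
    have "(\<integral>\<^sup>+x. ennreal ((cmod (h n x))\<^sup>2) \<partial>M) = ennreal ((l2norm M (h n))\<^sup>2)"
      unfolding l2norm_sq by (rule nn_integral_eq_integral) (use square_integrableD[OF h] in auto)
    also have "\<dots> \<le> ennreal ((c n)\<^sup>2)" using le[of n] by (intro ennreal_leI power_mono) auto
    finally show "(\<integral>\<^sup>+x. ennreal ((cmod (h n x))\<^sup>2) \<partial>M) \<le> ennreal ((c n)\<^sup>2)" .
  qed
  also have "\<dots> = ennreal (c'\<^sup>2)"
    by (rule lim_imp_Liminf) (auto intro!: tendsto_intros c)
  finally have bd: "(\<integral>\<^sup>+x. ennreal ((cmod (h' x))\<^sup>2) \<partial>M) \<le> ennreal (c'\<^sup>2)" .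
  then have "integrable M (\<lambda>x. (cmod (h' x))\<^sup>2)"
    by (intro integrableI_nonneg) (auto simp: order.strict_trans1[OF bd])
  then show sq: "square_integrable M h'" using h' by (simp add: square_integrable_def)
  have "ennreal ((l2norm M h')\<^sup>2) = (\<integral>\<^sup>+x. ennreal ((cmod (h' x))\<^sup>2) \<partial>M)"
    unfolding l2norm_sq by (rule nn_integral_eq_integral[symmetric]) (use square_integrableD[OF sq] in auto)
  then have "ennreal ((l2norm M h')\<^sup>2) \<le> ennreal (c'\<^sup>2)" using bd by simp
  then have "(l2norm M h')\<^sup>2 \<le> c'\<^sup>2" by (simp add: ennreal_le_iff)
  then show "l2norm M h' \<le> c'" using c'0 by (rule power2_le_imp_le)
qed

lemma plancherel_gauss_trig_l2norm:
  assumes a: "a > 0"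
  shows "square_integrable lborel (fourier (gauss_trig a xs))"
    "l2norm lborel (fourier (gauss_trig a xs)) = sqrt (2 * pi) * l2norm lborel (gauss_trig a xs)"
proof -
  have "fourier (gauss_trig a xs) \<in> borel_measurable lborel" by measurable
  then show "square_integrable lborel (fourier (gauss_trig a xs))"
    using plancherel_gauss_trig[OF a, of xs] by (simp add: square_integrable_def has_bochner_integral_iff)
  show "l2norm lborel (fourier (gauss_trig a xs)) = sqrt (2 * pi) * l2norm lborel (gauss_trig a xs)"
    using plancherel_gauss_trig[OF a, of xs] unfolding l2norm_def real_sqrt_mult [symmetric]
    by (simp add: has_bochner_integral_iff)
qed

lemma dist12_tendsto_l2norm:
  assumes "(\<lambda>n. dist12 f (g n)) \<longlonglongrightarrow> 0"
  shows "(\<lambda>n. l2norm lborel (\<lambda>x. g n x - f x)) \<longlonglongrightarrow> 0"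
  unfolding l2norm_tendsto_0_iff
proof (rule Lim_null_comparison[OF _ assms], rule always_eventually, rule allI)
  fix n
  have "0 \<le> (LBINT x. cmod (f x - g n x))" "0 \<le> (LBINT x. (cmod (f x - g n x))\<^sup>2)"
    by (simp_all add: integral_nonneg_AE)
  then show "norm (LBINT x. (cmod (g n x - f x))\<^sup>2) \<le> dist12 f (g n)"
    by (simp add: dist12_def norm_minus_commute[of "g n _"])
qed

lemma dist12_tendsto_l1norm:
  assumes "(\<lambda>n. dist12 f (g n)) \<longlonglongrightarrow> 0"
  shows "(\<lambda>n. \<integral>x. cmod (g n x - f x) \<partial>lborel) \<longlonglongrightarrow> 0"
proof (rule Lim_null_comparison[OF _ assms], rule always_eventually, rule allI)
  fix n
  have "0 \<le> (LBINT x. cmod (f x - g n x))" "0 \<le> (LBINT x. (cmod (f x - g n x))\<^sup>2)"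
    by (simp_all add: integral_nonneg_AE)
  then show "norm (LBINT x. cmod (g n x - f x)) \<le> dist12 f (g n)"
    by (simp add: dist12_def norm_minus_commute[of "g n _"])
qed

text \<open>L1 convergence identifies the pointwise limit as \<open>fourier f\<close>. A difference
  of two approximants is again a \<open>gauss_trig\<close>, so the exact Plancherel formula makes
  their transforms Cauchy in L2, and Fatou transfers the estimate to the limit.\<close>

lemma fourier_gauss_limit:
  assumes a: "a > 0" and f: "L1L2 f" and X: "(\<lambda>n. dist12 f (gauss_trig a (X n))) \<longlonglongrightarrow> 0"
  shows "square_integrable lborel (fourier f)"
    "(\<lambda>n. l2norm lborel (\<lambda>u. fourier (gauss_trig a (X n)) u - fourier f u)) \<longlonglongrightarrow> 0"
proof -
  define g where "g n = gauss_trig a (X n)" for n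
  have gL: "L1L2 (g n)" for n unfolding g_def by (rule L1L2_gauss_trig[OF a])
  define e where "e n = l2norm lborel (\<lambda>x. g n x - f x)" for n
  have e: "e \<longlonglongrightarrow> 0" unfolding e_def g_def by (rule dist12_tendsto_l2norm[OF X])
  have l1: "(\<lambda>n. \<integral>x. cmod (g n x - f x) \<partial>lborel) \<longlonglongrightarrow> 0" unfolding g_def by (rule dist12_tendsto_l1norm[OF X])
  note [measurable] = L1L2_measurable[OF f]
  have ptw: "(\<lambda>m. fourier (g m) u) \<longlonglongrightarrow> fourier f u" for u
  proof -
    have "(\<lambda>m. fourier (g m) u - fourier f u) \<longlonglongrightarrow> 0"
    proof (rule Lim_null_comparison[OF _ l1], rule always_eventually, rule allI)
      fix m
      have "fourier (g m) u - fourier f u = fourier (\<lambda>t. g m t - f t) u"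
        using gL[of m] f by (subst fourier_diff) (auto simp: L1L2_def)
      then show "norm (fourier (g m) u - fourier f u) \<le> (LBINT x. cmod (g m x - f x))"
        using norm_fourier_le[of "\<lambda>t. g m t - f t" u] by simp
    qed
    then show ?thesis by (simp add: LIM_zero_iff)
  qed
  have diffsq: "square_integrable lborel (\<lambda>u. fourier (g n) u - fourier (g m) u)"
    "l2norm lborel (\<lambda>u. fourier (g n) u - fourier (g m) u) \<le> sqrt (2 * pi) * (e n + e m)" for n m
  proof -
    show "square_integrable lborel (\<lambda>u. fourier (g n) u - fourier (g m) u)"
      unfolding g_def by (intro square_integrable_diff plancherel_gauss_trig_l2norm a)
    obtain xs where xs: "\<And>t. gauss_trig a xs t = g n t - g m t"
      unfolding g_def using gauss_trig_diff by blast
    have "fourier (g n) u - fourier (g m) u = fourier (gauss_trig a xs) u" for u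
    proof -
      have "fourier (\<lambda>t. g n t - g m t) u = fourier (g n) u - fourier (g m) u"
        using gL by (intro fourier_diff) (auto simp: L1L2_def)
      then show ?thesis unfolding xs [symmetric] by simp
    qed
    then have "l2norm lborel (\<lambda>u. fourier (g n) u - fourier (g m) u) = sqrt (2 * pi) * l2norm lborel (\<lambda>t. g n t - g m t)"
    proof -
      have "gauss_trig a xs = (\<lambda>t. g n t - g m t)" using xs by auto
      then show ?thesis using plancherel_gauss_trig_l2norm(2)[OF a, of xs]
        by (simp only: \<open>\<And>u. fourier (g n) u - fourier (g m) u = fourier (gauss_trig a xs) u\<close>)
    qed
    also have "l2norm lborel (\<lambda>t. g n t - g m t) \<le> e n + e m"
      using l2norm_triangle_diff[of lborel "g n" f "g m"] gL f l2norm_minus_commute[of lborel f "g m"]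
      by (simp add: L1L2_def e_def)
    finally show "l2norm lborel (\<lambda>u. fourier (g n) u - fourier (g m) u) \<le> sqrt (2 * pi) * (e n + e m)"
      by (simp add: mult_left_mono)
  qed
  have lim: "square_integrable lborel (\<lambda>u. fourier (g n) u - fourier f u)"
     "l2norm lborel (\<lambda>u. fourier (g n) u - fourier f u) \<le> sqrt (2 * pi) * (e n + 0)" for n
  proof -
    have gm: "(\<lambda>u. fourier (g n) u - fourier f u) \<in> borel_measurable lborel"
      unfolding g_def by measurable
    have ae: "AE u in lborel. (\<lambda>m. fourier (g n) u - fourier (g m) u) \<longlonglongrightarrow> fourier (g n) u - fourier f u"
      by (intro AE_I2 tendsto_intros ptw)
    have cl: "(\<lambda>m. sqrt (2 * pi) * (e n + e m)) \<longlonglongrightarrow> sqrt (2 * pi) * (e n + 0)"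
      by (intro tendsto_intros e)
    show "square_integrable lborel (\<lambda>u. fourier (g n) u - fourier f u)"
      by (rule l2norm_fatou(1)[OF diffsq(1) gm ae diffsq(2) cl])
    show "l2norm lborel (\<lambda>u. fourier (g n) u - fourier f u) \<le> sqrt (2 * pi) * (e n + 0)"
      by (rule l2norm_fatou(2)[OF diffsq(1) gm ae diffsq(2) cl])
  qed
  have "square_integrable lborel (\<lambda>u. fourier (g 0) u - (fourier (g 0) u - fourier f u))"
    by (intro square_integrable_diff lim) (simp add: g_def plancherel_gauss_trig_l2norm a)
  then show "square_integrable lborel (fourier f)" by simp
  have "(\<lambda>n. l2norm lborel (\<lambda>u. fourier (g n) u - fourier f u)) \<longlonglongrightarrow> 0"
  proof (rule Lim_null_comparison)
    show "(\<lambda>n. sqrt (2 * pi) * (e n + 0)) \<longlonglongrightarrow> 0" using tendsto_mult[OF tendsto_const e] by simp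
  qed (use lim in simp)
  then show "(\<lambda>n. l2norm lborel (\<lambda>u. fourier (gauss_trig a (X n)) u - fourier f u)) \<longlonglongrightarrow> 0"
    by (simp add: g_def)
qed

theorem plancherel:
  assumes f: "L1L2 f"
  shows "square_integrable lborel (fourier f)" "l2norm lborel (fourier f) = sqrt (2 * pi) * l2norm lborel f"
proof -
  obtain X where X: "(\<lambda>n. dist12 f (gauss_trig 1 (X n))) \<longlonglongrightarrow> 0"
    using gauss_approx_sequence[of 1 f] f by auto
  have lim: "square_integrable lborel (fourier f)"
    "(\<lambda>n. l2norm lborel (\<lambda>u. fourier (gauss_trig 1 (X n)) u - fourier f u)) \<longlonglongrightarrow> 0"
    using fourier_gauss_limit[OF _ f X] by auto
  show "square_integrable lborel (fourier f)" by fact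
  have "(\<lambda>n. l2norm lborel (fourier (gauss_trig 1 (X n)))) \<longlonglongrightarrow> l2norm lborel (fourier f)"
    by (intro l2norm_tendsto lim plancherel_gauss_trig_l2norm) auto
  moreover have "(\<lambda>n. l2norm lborel (fourier (gauss_trig 1 (X n)))) \<longlonglongrightarrow> sqrt (2 * pi) * l2norm lborel f"
  proof -
    have "(\<lambda>n. l2norm lborel (gauss_trig 1 (X n))) \<longlonglongrightarrow> l2norm lborel f"
      using f L1L2_gauss_trig[of 1] by (intro l2norm_tendsto dist12_tendsto_l2norm X) (auto simp: L1L2_def)
    then show ?thesis by (subst plancherel_gauss_trig_l2norm) (auto intro!: tendsto_intros)
  qed
  ultimately show "l2norm lborel (fourier f) = sqrt (2 * pi) * l2norm lborel f" by (rule LIMSEQ_unique)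
qed

section \<open>Inner products recovered from norms\<close>

lemma l2norm_add_sq:
  assumes f: "square_integrable M f" and h: "square_integrable M h"
  shows "(l2norm M (\<lambda>x. f x + c * h x))\<^sup>2
    = (l2norm M f)\<^sup>2 + (cmod c)\<^sup>2 * (l2norm M h)\<^sup>2 + 2 * Re (cnj c * (\<integral>x. f x * cnj (h x) \<partial>M))"
proof -
  have i: "integrable M (\<lambda>x. f x * cnj (h x))" by (intro integrable_square_mult square_integrable_cnj f h)
  have "(cmod (f x + c * h x))\<^sup>2 = (cmod (f x))\<^sup>2 + (cmod c)\<^sup>2 * (cmod (h x))\<^sup>2 + 2 * Re (cnj c * (f x * cnj (h x)))" for x
    unfolding cmod_power2 by (simp add: power2_eq_square algebra_simps)
  then have "(l2norm M (\<lambda>x. f x + c * h x))\<^sup>2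
    = (\<integral>x. (cmod (f x))\<^sup>2 + (cmod c)\<^sup>2 * (cmod (h x))\<^sup>2 + 2 * Re (cnj c * (f x * cnj (h x))) \<partial>M)"
    by (simp add: l2norm_sq)
  also have "\<dots> = (l2norm M f)\<^sup>2 + (cmod c)\<^sup>2 * (l2norm M h)\<^sup>2 + 2 * (\<integral>x. Re (cnj c * (f x * cnj (h x))) \<partial>M)"
  proof -
    have i': "integrable M (\<lambda>x. Re (cnj c * (f x * cnj (h x))))"
      by (intro integrable_Re integrable_mult_right i)
    show ?thesis
      using square_integrableD[OF f] square_integrableD[OF h] i'
      by (simp only: l2norm_sq Bochner_Integration.integral_add Bochner_Integration.integrable_add
        integrable_mult_right integral_mult_right_zero)
  qed
  also have "(\<integral>x. Re (cnj c * (f x * cnj (h x))) \<partial>M) = Re (cnj c * (\<integral>x. f x * cnj (h x) \<partial>M))"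
    using integral_Re[OF integrable_mult_right[OF i], of "cnj c"] by (simp only: integral_mult_right_zero)
  finally show ?thesis .
qed

text \<open>Polarisation: \<open>c = 1\<close> compares the real parts of the inner products,
  \<open>c = \<i>\<close> the imaginary parts.\<close>

lemma inner_eq_of_l2norm_eq:
  assumes f: "square_integrable M f" "square_integrable M h" and g: "square_integrable N f'" "square_integrable N h'"
    and eq: "\<And>c. (l2norm N (\<lambda>x. f' x + c * h' x))\<^sup>2 = k * (l2norm M (\<lambda>x. f x + c * h x))\<^sup>2"
    and "(l2norm N h')\<^sup>2 = k * (l2norm M h)\<^sup>2"
  shows "(\<integral>x. f' x * cnj (h' x) \<partial>N) = of_real k * (\<integral>x. f x * cnj (h x) \<partial>M)"
proof -
  have "(l2norm N f')\<^sup>2 = k * (l2norm M f)\<^sup>2" using eq[of 0] by simp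
  then have "Re (cnj c * (\<integral>x. f' x * cnj (h' x) \<partial>N)) = k * Re (cnj c * (\<integral>x. f x * cnj (h x) \<partial>M))" for c
    using eq[of c] assms(6) unfolding l2norm_add_sq[OF f] l2norm_add_sq[OF g] by (simp add: algebra_simps)
  from this[of 1] this[of \<i>] show ?thesis by (simp add: complex_eq_iff)
qed

lemma square_integrable_rescale:
  assumes f: "square_integrable lborel f" and k: "k > 0"
  shows "square_integrable lborel (\<lambda>u. f (k * u))" "l2norm lborel (\<lambda>u. f (k * u)) = l2norm lborel f / sqrt k"
proof -
  have [measurable]: "f \<in> borel_measurable borel" using square_integrable_measurable[OF f] by simp
  show "square_integrable lborel (\<lambda>u. f (k * u))"
    using lborel_integrable_real_affine[OF square_integrableD[OF f], of k 0] k by (simp add: square_integrable_def)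
  have "(LBINT x. (cmod (f x))\<^sup>2) = k * (LBINT u. (cmod (f (k * u)))\<^sup>2)"
    using lborel_integral_real_affine[of k "\<lambda>x. (cmod (f x))\<^sup>2" 0] k by simp
  then show "l2norm lborel (\<lambda>u. f (k * u)) = l2norm lborel f / sqrt k"
    using k by (simp add: l2norm_def real_sqrt_mult)
qed

section \<open>Exponents between 1 and 2, and the sharp inequality by density\<close>

lemma powr_le_add_sq:
  fixes x p :: real
  assumes "1 \<le> p" "p \<le> 2" "0 \<le> x"
  shows "x powr p \<le> x + x\<^sup>2"
proof (cases "x \<le> 1")
  case True
  then have "x powr p \<le> x" using assms powr_le_one_le[of x p] by (cases "x = 0") auto
  then show ?thesis by (simp add: add_increasing2)
next
  case False
  then have "x powr p \<le> x powr 2" using assms by (intro powr_mono) auto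
  then show ?thesis using assms by (simp add: powr_numeral)
qed

lemma L1L2_integrable_powr:
  assumes f: "L1L2 f" and p: "1 \<le> p" "p \<le> 2"
  shows "integrable lborel (\<lambda>x. cmod (f x) powr p)"
proof (rule Bochner_Integration.integrable_bound)
  note [measurable] = L1L2_measurable[OF f]
  show "integrable lborel (\<lambda>x. cmod (f x) + (cmod (f x))\<^sup>2)" using f by (auto simp: L1L2_def square_integrable_def)
  show "AE x in lborel. norm (cmod (f x) powr p) \<le> norm (cmod (f x) + (cmod (f x))\<^sup>2)"
    using p powr_le_add_sq by auto
  show "(\<lambda>x. cmod (f x) powr p) \<in> borel_measurable lborel" by measurable
qed

text \<open>As \<open>p - 1 \<le> 1\<close>, the mean value bound for the p-th power has a slope of
  at most linear growth, so the difference is at most \<open>2 * r * (1 + s + t)\<close> with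
  \<open>r\<close> the distance. The constant part is controlled by L1, the linear part by L2
  through Cauchy-Schwarz.\<close>

lemma integral_powr_tendsto:
  assumes f: "L1L2 f" and g: "\<And>n. L1L2 (g n)" and p: "1 \<le> p" "p \<le> 2"
    and lim: "(\<lambda>n. dist12 f (g n)) \<longlonglongrightarrow> 0"
  shows "(\<lambda>n. \<integral>x. cmod (g n x) powr p \<partial>lborel) \<longlonglongrightarrow> (LBINT x. cmod (f x) powr p)"
proof -
  have pt: "\<bar>s powr p - t powr p\<bar> \<le> 2 * r + 2 * (s * r + t * r)"
    if "0 \<le> s" "0 \<le> t" "\<bar>s - t\<bar> \<le> r" for s t r :: real
  proof -
    define K where "K = s + t"
    have K0: "K \<ge> 0" using that by (simp add: K_def)
    have "\<bar>s powr p - t powr p\<bar> \<le> p * K powr (p - 1) * \<bar>s - t\<bar>"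
      using that p by (intro abs_powr_diff_le) (auto simp: K_def)
    also have "p * K powr (p - 1) * \<bar>s - t\<bar> \<le> 2 * (1 + K) * r"
    proof (rule mult_mono)
     show "p * K powr (p - 1) \<le> 2 * (1 + K)"
    proof (rule mult_mono)
      show "K powr (p - 1) \<le> 1 + K"
      proof (cases "K \<le> 1")
        case True
        then have "K powr (p - 1) \<le> 1" using K0 p by (intro powr_le1) auto
        then show ?thesis using K0 by simp
      next
        case False
        then have "K powr (p - 1) \<le> K powr 1" using p by (intro powr_mono) auto
        then show ?thesis using K0 by simp
      qed
    qed (use p in auto)
    qed (use that K0 in auto)
    finally show ?thesis by (simp add: K_def algebra_simps)
  qed
  define e1 e2 where "e1 n = (LBINT x. cmod (g n x - f x))" and "e2 n = l2norm lborel (\<lambda>x. g n x - f x)" for n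
  have e1: "e1 \<longlonglongrightarrow> 0" unfolding e1_def by (rule dist12_tendsto_l1norm[OF lim])
  have e2: "e2 \<longlonglongrightarrow> 0" unfolding e2_def by (rule dist12_tendsto_l2norm[OF lim])
  have sq: "square_integrable lborel f" "square_integrable lborel (g n)" "square_integrable lborel (\<lambda>x. g n x - f x)" for n
    using f g[of n] L1L2_diff[OF g f, of n] by (auto simp: L1L2_def)
  have lg: "(\<lambda>n. l2norm lborel (g n)) \<longlonglongrightarrow> l2norm lborel f"
    by (intro l2norm_tendsto sq dist12_tendsto_l2norm lim)
  have "(\<lambda>n. (LBINT x. cmod (g n x) powr p) - (LBINT x. cmod (f x) powr p)) \<longlonglongrightarrow> 0"
  proof (rule Lim_null_comparison)
    have "(\<lambda>n. 2 * e1 n + 2 * (l2norm lborel (g n) * e2 n + l2norm lborel f * e2 n))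
      \<longlonglongrightarrow> 2 * 0 + 2 * (l2norm lborel f * 0 + l2norm lborel f * 0)"
      by (intro tendsto_intros e1 e2 lg)
    then show "(\<lambda>n. 2 * e1 n + 2 * (l2norm lborel (g n) * e2 n + l2norm lborel f * e2 n)) \<longlonglongrightarrow> 0" by simp
    have "norm ((LBINT x. cmod (g n x) powr p) - (LBINT x. cmod (f x) powr p))
        \<le> 2 * e1 n + 2 * (l2norm lborel (g n) * e2 n + l2norm lborel f * e2 n)" for n
    proof -
      have i1: "integrable lborel (\<lambda>x. cmod (g n x - f x))" using L1L2_diff[OF g f, of n] by (simp add: L1L2_def)
      have ip: "integrable lborel (\<lambda>x. cmod (g n x) powr p)" "integrable lborel (\<lambda>x. cmod (f x) powr p)"
        using L1L2_integrable_powr[OF _ p] f g by auto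
      have "norm ((LBINT x. cmod (g n x) powr p) - (LBINT x. cmod (f x) powr p))
         = norm (LBINT x. cmod (g n x) powr p - cmod (f x) powr p)" using ip by simp
      also have "\<dots> \<le> (LBINT x. norm (cmod (g n x) powr p - cmod (f x) powr p))" by (rule integral_norm_bound)
      also have "\<dots> \<le> (LBINT x. 2 * cmod (g n x - f x) + 2 * (cmod (g n x) * cmod (g n x - f x) + cmod (f x) * cmod (g n x - f x)))"
      proof (rule integral_mono)
        show "integrable lborel (\<lambda>x. norm (cmod (g n x) powr p - cmod (f x) powr p))" using ip by simp
        show "integrable lborel (\<lambda>x. 2 * cmod (g n x - f x) + 2 * (cmod (g n x) * cmod (g n x - f x) + cmod (f x) * cmod (g n x - f x)))"
          using i1 integrable_norm_mult[OF sq(2,3)] integrable_norm_mult[OF sq(1,3)] by simp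
        show "norm (cmod (g n x) powr p - cmod (f x) powr p)
          \<le> 2 * cmod (g n x - f x) + 2 * (cmod (g n x) * cmod (g n x - f x) + cmod (f x) * cmod (g n x - f x))" for x
          unfolding real_norm_def by (rule pt) (auto simp: norm_triangle_ineq3)
      qed
      also have "\<dots> = 2 * e1 n + 2 * ((LBINT x. cmod (g n x) * cmod (g n x - f x)) + (LBINT x. cmod (f x) * cmod (g n x - f x)))"
        using i1 integrable_norm_mult[OF sq(2,3), of n n] integrable_norm_mult[OF sq(1,3), of n] by (simp add: e1_def)
      also have "\<dots> \<le> 2 * e1 n + 2 * (l2norm lborel (g n) * e2 n + l2norm lborel f * e2 n)"
        using integral_norm_mult_le[OF sq(2,3), of n n] integral_norm_mult_le[OF sq(1,3), of n] by (simp add: e2_def)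
      finally show ?thesis .
    qed
    then show "\<forall>\<^sub>F n in sequentially. norm ((LBINT x. cmod (g n x) powr p) - (LBINT x. cmod (f x) powr p))
        \<le> 2 * e1 n + 2 * (l2norm lborel (g n) * e2 n + l2norm lborel f * e2 n)" by simp
  qed
  then show ?thesis by (simp add: LIM_zero_iff)
qed

text \<open>Both functions are approximated with the width \<open>1 / (2 * p)\<close> at which the
  inequality has been obtained. The left side is continuous in L2 by Plancherel and rescaling, the
  right side by \<open>integral_powr_tendsto\<close>.\<close>

theorem hausdorff_young:
  fixes p q w :: real
  assumes p: "1 < p" "p < 2" and q: "1 / p + 1 / q = 1" "q > 1" and w: "w\<^sup>2 = p - 1" "w > 0"
    and f: "L1L2 f" and g: "L1L2 g"
  shows "cmod (LBINT u. g u * fourier f (w / p * u))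
    \<le> 2 * pi * sqrt p * (2 * pi) powr (- 1 / p)
      * lpnorm p f * lpnorm p g"
proof -
  define a where "a = 1 / (2 * p)"
  have a: "a > 0" using p by (simp add: a_def)
  have k: "w / p > 0" using w p by simp
  obtain X where X: "(\<lambda>n. dist12 f (gauss_trig a (X n))) \<longlonglongrightarrow> 0" using gauss_approx_sequence[OF a f] .
  obtain Y where Y: "(\<lambda>n. dist12 g (gauss_trig a (Y n))) \<longlonglongrightarrow> 0" using gauss_approx_sequence[OF a g] .
  note lim = fourier_gauss_limit[OF a f X]
  have sqG: "square_integrable lborel (gauss_trig a xs)" for xs
    using L1L2_gauss_trig[OF a] by (simp add: L1L2_def)
  have flim: "(\<lambda>n. l2norm lborel (\<lambda>u. fourier (gauss_trig a (X n)) (w / p * u) - fourier f (w / p * u))) \<longlonglongrightarrow> 0"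
  proof -
    have "l2norm lborel (\<lambda>u. fourier (gauss_trig a (X n)) (w / p * u) - fourier f (w / p * u))
       = l2norm lborel (\<lambda>u. fourier (gauss_trig a (X n)) u - fourier f u) / sqrt (w / p)" for n
      using square_integrable_rescale(2)[OF square_integrable_diff[OF plancherel_gauss_trig_l2norm(1)[OF a] lim(1)] k] by simp
    then show ?thesis using tendsto_divide_zero[OF lim(2)] by (simp only:)
  qed
  have B: "(\<lambda>n. \<integral>u. gauss_trig a (Y n) u * fourier (gauss_trig a (X n)) (w / p * u) \<partial>lborel)
      \<longlonglongrightarrow> (LBINT u. g u * fourier f (w / p * u))"
    using g by (intro integral_mult_tendsto sqG dist12_tendsto_l2norm Y flim square_integrable_rescale plancherel_gauss_trig_l2norm lim a k)
      (auto simp: L1L2_def)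
  show ?thesis
  proof (rule LIMSEQ_le[OF tendsto_norm[OF B]])
    have pos: "\<forall>\<^sub>F n in F. 0 \<le> (LBINT t. cmod (h n t) powr p)" for h :: "nat \<Rightarrow> real \<Rightarrow> complex" and F
      by (simp add: integral_nonneg_AE)
    show "(\<lambda>n. 2 * pi * sqrt p * (2 * pi) powr (- 1 / p)
      * lpnorm p (gauss_trig a (X n)) * lpnorm p (gauss_trig a (Y n)))
      \<longlonglongrightarrow> 2 * pi * sqrt p * (2 * pi) powr (- 1 / p)
      * lpnorm p f * lpnorm p g"
      using p by (intro tendsto_mult tendsto_powr' tendsto_const integral_powr_tendsto f g X Y L1L2_gauss_trig a) (auto intro: pos)
    show "\<exists>N. \<forall>n\<ge>N. norm (LBINT u. gauss_trig a (Y n) u * fourier (gauss_trig a (X n)) (w / p * u))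
      \<le> 2 * pi * sqrt p * (2 * pi) powr (- 1 / p)
      * lpnorm p (gauss_trig a (X n)) * lpnorm p (gauss_trig a (Y n))"
      using hausdorff_young_gauss_trig[OF p q w(1)] unfolding a_def by blast
  qed
qed

subsection \<open>The chirped Fourier transform on square integrable functions\<close>

text \<open>Increments along a fast subsequence are summable almost everywhere, which gives the
  limit \<open>g\<close>; Fatou then estimates \<open>h n - g\<close> for the whole sequence. The
  form \<open>e n + e m\<close> of the Cauchy condition is the one that distances to a common
  function produce.\<close>

theorem riesz_fischer:
  assumes h: "\<And>n. square_integrable M (h n)"
    and cauchy: "\<And>n m. l2norm M (\<lambda>x. h n x - h m x) \<le> e n + e m" and e: "e \<longlonglongrightarrow> 0"
  shows "\<exists>g. square_integrable M g \<and> (\<lambda>n. l2norm M (\<lambda>x. h n x - g x)) \<longlonglongrightarrow> 0"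
proof -
  have e0: "e n \<ge> 0" for n using cauchy[of n n] l2norm_nonneg[of M "\<lambda>x. h n x - h n x"] by linarith
  have "\<exists>n. e n < (1 / 4) ^ k / 2" for k :: nat
  proof -
    have "\<forall>\<^sub>F n in sequentially. e n < (1 / 4) ^ k / 2" using e by (intro order_tendstoD(2)) auto
    then show ?thesis by (meson eventually_happens sequentially_bot)
  qed
  then obtain r where r: "\<And>k. e (r k) < (1 / 4) ^ k / 2" by metis
  have er: "(\<lambda>k. e (r k)) \<longlonglongrightarrow> 0"
  proof (rule Lim_null_comparison)
    show "\<forall>\<^sub>F k in sequentially. norm (e (r k)) \<le> (1 / 4) ^ k / 2" using r e0 by (auto simp: less_imp_le)
    show "(\<lambda>k. (1 / 4) ^ k / 2 :: real) \<longlonglongrightarrow> 0" by real_asymp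
  qed
  define d where "d k x = h (r (Suc k)) x - h (r k) x" for k x
  have dsq: "square_integrable M (d k)" for k unfolding d_def by (intro square_integrable_diff h)
  note [measurable] = square_integrable_measurable[OF h] square_integrable_measurable[OF dsq]
  have dle: "l2norm M (d k) \<le> (1 / 4) ^ k" for k
  proof -
    have "l2norm M (d k) \<le> e (r (Suc k)) + e (r k)" unfolding d_def by (rule cauchy)
    also have "\<dots> \<le> (1 / 4) ^ Suc k / 2 + (1 / 4) ^ k / 2" using r[of k] r[of "Suc k"] by linarith
    also have "\<dots> \<le> (1 / 4) ^ k" by simp
    finally show ?thesis .
  qed
  text \<open>The weights \<open>4 ^ k\<close> turn square summability of the increments into absolute summability.\<close>
  have "(\<integral>\<^sup>+x. (\<Sum>k. ennreal (4 ^ k * (cmod (d k x))\<^sup>2)) \<partial>M) = (\<Sum>k. \<integral>\<^sup>+x. ennreal (4 ^ k * (cmod (d k x))\<^sup>2) \<partial>M)"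
    by (rule nn_integral_suminf) measurable
  also have "\<dots> \<le> (\<Sum>k. ennreal ((1 / 4) ^ k))"
  proof (rule suminf_le)
    fix k
    have "(\<integral>\<^sup>+x. ennreal (4 ^ k * (cmod (d k x))\<^sup>2) \<partial>M) = ennreal (4 ^ k * (l2norm M (d k))\<^sup>2)"
      unfolding l2norm_sq using square_integrableD[OF dsq]
      by (subst nn_integral_eq_integral) auto
    also have "\<dots> \<le> ennreal (4 ^ k * ((1 / 4) ^ k)\<^sup>2)"
      using dle by (intro ennreal_leI mult_left_mono power_mono) auto
    also have "4 ^ k * ((1 / 4) ^ k)\<^sup>2 = (1 / 4 :: real) ^ k"
      by (simp add: power2_eq_square power_divide)
    finally show "(\<integral>\<^sup>+x. ennreal (4 ^ k * (cmod (d k x))\<^sup>2) \<partial>M) \<le> ennreal ((1 / 4) ^ k)" .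
  qed auto
  also have "\<dots> = ennreal (\<Sum>k. (1 / 4) ^ k)" by (rule suminf_ennreal2) (auto intro: summable_geometric)
  finally have "(\<integral>\<^sup>+x. (\<Sum>k. ennreal (4 ^ k * (cmod (d k x))\<^sup>2)) \<partial>M) \<noteq> \<infinity>"
    by (metis ennreal_less_top infinity_ennreal_def not_less top.not_eq_extremum)
  then have "AE x in M. (\<Sum>k. ennreal (4 ^ k * (cmod (d k x))\<^sup>2)) \<noteq> \<infinity>"
    by (intro nn_integral_noteq_infinite) auto
  then have conv: "AE x in M. convergent (\<lambda>k. h (r k) x)"
  proof eventually_elim
    case (elim x)
    have "summable (\<lambda>k. 4 ^ k * (cmod (d k x))\<^sup>2)"
      by (rule summable_suminf_not_top) (use elim in auto)
    then have "(\<lambda>k. 4 ^ k * (cmod (d k x))\<^sup>2) \<longlonglongrightarrow> 0" by (rule summable_LIMSEQ_zero)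
    then have "\<forall>\<^sub>F k in sequentially. 4 ^ k * (cmod (d k x))\<^sup>2 < 1" by (rule order_tendstoD) simp
    then have "\<forall>\<^sub>F k in sequentially. norm (d k x) \<le> (1 / 2) ^ k"
    proof eventually_elim
      case (elim k)
      have "(2 ^ k * cmod (d k x))\<^sup>2 = 4 ^ k * (cmod (d k x))\<^sup>2"
      proof -
        have "(2 ^ k)\<^sup>2 = (4 :: real) ^ k" by (simp add: power2_eq_square flip: power_mult_distrib)
        then show ?thesis by (simp add: power_mult_distrib)
      qed
      then have "(2 ^ k * cmod (d k x))\<^sup>2 \<le> 1\<^sup>2" using elim by simp
      then have "2 ^ k * cmod (d k x) \<le> 1" by (rule power2_le_imp_le) simp
      then show ?case by (simp add: power_divide field_simps)
    qed
    then have "summable (\<lambda>k. d k x)"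
      by (rule summable_comparison_test_ev) (auto intro: summable_geometric)
    then have "convergent (\<lambda>n. \<Sum>k<n. d k x)" by (simp add: summable_iff_convergent)
    moreover have "(\<Sum>k<n. d k x) = h (r n) x - h (r 0) x" for n
      unfolding d_def by (rule sum_lessThan_telescope)
    ultimately show ?case by (simp add: convergent_diff_const_right_iff)
  qed
  define g where "g x = lim (\<lambda>k. h (r k) x)" for x
  have gm: "g \<in> borel_measurable M" unfolding g_def by (rule borel_measurable_lim_metric) measurable
  have lim: "AE x in M. (\<lambda>k. h n x - h (r k) x) \<longlonglongrightarrow> h n x - g x" for n
    using conv by eventually_elim (auto simp: g_def convergent_LIMSEQ_iff intro!: tendsto_intros)
  have sq: "square_integrable M (\<lambda>x. h n x - h (r k) x)" for n k by (intro square_integrable_diff h)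
  have dm: "(\<lambda>x. h n x - g x) \<in> borel_measurable M" for n using gm by measurable
  have cl: "(\<lambda>k. e n + e (r k)) \<longlonglongrightarrow> e n + 0" for n by (intro tendsto_intros er)
  have lim': "square_integrable M (\<lambda>x. h n x - g x)" "l2norm M (\<lambda>x. h n x - g x) \<le> e n + 0" for n
    by (rule l2norm_fatou(1)[OF sq dm lim cauchy cl], rule l2norm_fatou(2)[OF sq dm lim cauchy cl])
  have "square_integrable M (\<lambda>x. h 0 x - (h 0 x - g x))" by (intro square_integrable_diff h lim')
  then have "square_integrable M g" by simp
  moreover have "(\<lambda>n. l2norm M (\<lambda>x. h n x - g x)) \<longlonglongrightarrow> 0"
    by (rule Lim_null_comparison[OF _ e]) (use lim' in auto)
  ultimately show ?thesis by blast
qed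

section \<open>Truncation to bounded intervals\<close>

definition trunc :: "real \<Rightarrow> (real \<Rightarrow> complex) \<Rightarrow> real \<Rightarrow> complex" where
  "trunc T f t = indicator {-T..T} t * f t"

lemma cmod_trunc_le: "cmod (trunc T f t) \<le> cmod (f t)"
  by (simp add: trunc_def indicator_def)

lemma borel_measurable_trunc [measurable]: "f \<in> borel_measurable borel \<Longrightarrow> trunc T f \<in> borel_measurable borel"
  unfolding trunc_def[abs_def] by measurable

lemma L1L2_trunc:
  assumes f: "square_integrable lborel f"
  shows "L1L2 (trunc T f)"
proof -
  have [measurable]: "f \<in> borel_measurable borel" using square_integrable_measurable[OF f] by simp
  have "square_integrable lborel (trunc T f)"
    by (rule square_integrable_bound[OF f, where C = 1]) (use cmod_trunc_le in auto)
  moreover have "integrable lborel (trunc T f)"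
  proof (rule Bochner_Integration.integrable_bound)
    show "integrable lborel (\<lambda>t. indicator {-T..T} t + (cmod (f t))\<^sup>2)"
      using square_integrableD[OF f] by (auto simp: integrable_indicator_iff emeasure_lborel_Icc_eq)
    have "cmod (trunc T f t) \<le> indicator {-T..T} t + (cmod (f t))\<^sup>2" for t
    proof -
      have "s \<le> 1 + s\<^sup>2" for s :: real
        using zero_le_power2[of "s - 1 / 2"] by (simp add: power2_eq_square algebra_simps)
      then show ?thesis by (simp add: trunc_def indicator_def)
    qed
    then show "AE t in lborel. norm (trunc T f t) \<le> norm (indicator {-T..T} t + (cmod (f t))\<^sup>2)"
      by (auto intro!: AE_I2 order_trans[OF _ abs_ge_self])
  qed measurable
  ultimately show ?thesis by (simp add: L1L2_def)
qed

lemma trunc_tendsto: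
  assumes f: "square_integrable lborel f"
  shows "((\<lambda>T. l2norm lborel (\<lambda>t. trunc T f t - f t)) \<longlongrightarrow> 0) at_top"
  unfolding l2norm_tendsto_0_iff
proof -
  have [measurable]: "f \<in> borel_measurable borel" using square_integrable_measurable[OF f] by simp
  have "((\<lambda>T. \<integral>t. (cmod (trunc T f t - f t))\<^sup>2 \<partial>lborel) \<longlongrightarrow> (\<integral>t. 0 \<partial>(lborel :: real measure))) at_top"
  proof (rule integral_dominated_convergence_at_top)
    show "integrable lborel (\<lambda>t. (cmod (f t))\<^sup>2)" by (rule square_integrableD[OF f])
    show "\<forall>\<^sub>F T in at_top. AE t in lborel. norm ((cmod (trunc T f t - f t))\<^sup>2) \<le> (cmod (f t))\<^sup>2"
      by (auto simp: trunc_def indicator_def)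
    show "AE t in lborel. ((\<lambda>T. (cmod (trunc T f t - f t))\<^sup>2) \<longlongrightarrow> 0) at_top"
    proof (rule AE_I2, rule tendsto_eventually)
      fix t
      show "\<forall>\<^sub>F T in at_top. (cmod (trunc T f t - f t))\<^sup>2 = 0"
        using eventually_ge_at_top[of "\<bar>t\<bar>"] by eventually_elim (auto simp: trunc_def indicator_def)
    qed
  qed measurable
  then show "((\<lambda>T. \<integral>t. (cmod (trunc T f t - f t))\<^sup>2 \<partial>lborel) \<longlongrightarrow> 0) at_top" by simp
qed

text \<open>
  Up to a unimodular factor on the input, the truncated transform is the operator \<open>chirp\<close> below:
  a Fourier transform, dilated by \<open>b\<close> and multiplied by a chirp.
\<close>
locale chirped_fourier =
  fixes b :: real and \<kappa> :: complex and \<psi> :: "real \<Rightarrow> real"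
  assumes b: "b > 0" and \<kappa>: "cmod \<kappa> = 1 / sqrt (2 * pi * b)" and \<psi> [measurable]: "\<psi> \<in> borel_measurable borel"
begin

definition chirp :: "(real \<Rightarrow> complex) \<Rightarrow> real \<Rightarrow> complex" where
  "chirp f u = \<kappa> * cis (\<psi> u) * fourier f (u / b)"

definition is_transform :: "(real \<Rightarrow> complex) \<Rightarrow> (real \<Rightarrow> complex) \<Rightarrow> bool" where
  "is_transform f g \<longleftrightarrow> square_integrable lborel f \<and> square_integrable lborel g \<and>
     ((\<lambda>T. l2norm lborel (\<lambda>u. chirp (trunc T f) u - g u)) \<longlongrightarrow> 0) at_top"

lemma borel_measurable_chirp [measurable]:
  assumes f: "f \<in> borel_measurable lborel"
  shows "chirp f \<in> borel_measurable borel"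
proof -
  have [measurable]: "(\<lambda>u. fourier f (u / b)) \<in> borel_measurable borel"
    by (rule measurable_compose[OF _ borel_measurable_fourier[OF f]]) simp
  show ?thesis unfolding chirp_def[abs_def] by measurable
qed

lemma chirp_diff: "L1L2 f \<Longrightarrow> L1L2 g \<Longrightarrow> chirp (\<lambda>t. f t - g t) u = chirp f u - chirp g u"
  by (simp add: chirp_def L1L2_def fourier_diff algebra_simps)

text \<open>The modulus of \<open>\<kappa>\<close> is the reciprocal of the factor
  \<open>sqrt (2 * pi)\<close> from \<open>plancherel\<close> times the factor \<open>sqrt b\<close>
  from the dilation.\<close>

lemma chirp_isometry:
  assumes f: "L1L2 f"
  shows "square_integrable lborel (chirp f)" "l2norm lborel (chirp f) = l2norm lborel f"
proof -
  have c: "chirp f u = \<kappa> * (cis (\<psi> u) * fourier f (1 / b * u))" for u by (simp add: chirp_def)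
  note sq = square_integrable_rescale[OF plancherel(1)[OF f], of "1 / b"]
  have "square_integrable lborel (\<lambda>u. cis (\<psi> u) * fourier f (1 / b * u))"
    using sq b L1L2_measurable[OF f] by (intro square_integrable_bound[OF sq(1), where C = 1]) (auto simp: norm_mult)
  then show "square_integrable lborel (chirp f)" unfolding c[abs_def] by (rule square_integrable_scale)
  have "l2norm lborel (chirp f) = cmod \<kappa> * l2norm lborel (\<lambda>u. cis (\<psi> u) * fourier f (1 / b * u))"
    unfolding c[abs_def] by (rule l2norm_scale)
  also have "l2norm lborel (\<lambda>u. cis (\<psi> u) * fourier f (1 / b * u)) = l2norm lborel (\<lambda>u. fourier f (1 / b * u))"
    by (simp add: l2norm_def norm_mult)
  also have "\<dots> = sqrt (2 * pi) * l2norm lborel f / sqrt (1 / b)" using sq(2) b plancherel(2)[OF f] by simp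
  also have "cmod \<kappa> * \<dots> = l2norm lborel f" using b by (simp add: \<kappa> real_sqrt_mult real_sqrt_divide)
  finally show "l2norm lborel (chirp f) = l2norm lborel f" .
qed

lemma is_transform_exists:
  assumes f: "square_integrable lborel f"
  shows "\<exists>g. is_transform f g"
proof -
  define e where "e T = l2norm lborel (\<lambda>t. trunc T f t - f t)" for T
  have e: "(e \<longlongrightarrow> 0) at_top" unfolding e_def by (rule trunc_tendsto[OF f])
  have sqt: "square_integrable lborel (trunc T f)" for T using L1L2_trunc[OF f] by (simp add: L1L2_def)
  have cauchy: "l2norm lborel (\<lambda>u. chirp (trunc S f) u - chirp (trunc T f) u) \<le> e S + e T" for S T
  proof -
    have "l2norm lborel (\<lambda>u. chirp (trunc S f) u - chirp (trunc T f) u) = l2norm lborel (chirp (\<lambda>t. trunc S f t - trunc T f t))"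
      by (intro arg_cong[where f = "l2norm lborel"] ext chirp_diff[symmetric] L1L2_trunc f)
    also have "\<dots> = l2norm lborel (\<lambda>t. trunc S f t - trunc T f t)" by (intro chirp_isometry L1L2_diff L1L2_trunc f)
    also have "\<dots> \<le> e S + e T"
      using l2norm_triangle_diff[OF sqt f sqt, of S T] l2norm_minus_commute[of lborel f "trunc T f"] by (simp add: e_def)
    finally show ?thesis .
  qed
  have ereal: "(\<lambda>n. e (real n)) \<longlonglongrightarrow> 0" by (rule filterlim_compose[OF e filterlim_real_sequentially])
  have sqo: "square_integrable lborel (chirp (trunc T f))" for T by (intro chirp_isometry L1L2_trunc f)
  obtain g where g: "square_integrable lborel g" "(\<lambda>n. l2norm lborel (\<lambda>u. chirp (trunc (real n) f) u - g u)) \<longlonglongrightarrow> 0"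
    using riesz_fischer[where M = lborel and h = "\<lambda>n. chirp (trunc (real n) f)" and e = "\<lambda>n. e (real n)"] sqo cauchy ereal by blast
  \<comment> \<open>Riesz-Fischer gives a limit along the integers only; comparing a real
    \<open>T\<close> with large integers extends the convergence to \<open>at_top\<close>.\<close>
  have le: "l2norm lborel (\<lambda>u. chirp (trunc T f) u - g u) \<le> e T" for T
  proof (rule LIMSEQ_le_const)
    show "(\<lambda>n. e T + e (real n) + l2norm lborel (\<lambda>u. chirp (trunc (real n) f) u - g u)) \<longlonglongrightarrow> e T"
      using tendsto_add[OF tendsto_add[OF tendsto_const[of "e T"] ereal] g(2)] by simp
    have "l2norm lborel (\<lambda>u. chirp (trunc T f) u - g u) \<le> e T + e (real n) + l2norm lborel (\<lambda>u. chirp (trunc (real n) f) u - g u)" for n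
      using l2norm_triangle_diff[OF sqo sqo g(1), of T "real n"] cauchy[of T "real n"] by linarith
    then show "\<exists>N. \<forall>n\<ge>N. l2norm lborel (\<lambda>u. chirp (trunc T f) u - g u)
        \<le> e T + e (real n) + l2norm lborel (\<lambda>u. chirp (trunc (real n) f) u - g u)" by blast
  qed
  have "((\<lambda>T. l2norm lborel (\<lambda>u. chirp (trunc T f) u - g u)) \<longlongrightarrow> 0) at_top"
    by (rule Lim_null_comparison[OF _ e]) (use le in auto)
  then show ?thesis using f g(1) by (auto simp: is_transform_def)
qed

lemma is_transform_l2norm:
  assumes "is_transform f g"
  shows "l2norm lborel g = l2norm lborel f"
proof -
  have f: "square_integrable lborel f" and g: "square_integrable lborel g"
    and lim: "((\<lambda>T. l2norm lborel (\<lambda>u. chirp (trunc T f) u - g u)) \<longlongrightarrow> 0) at_top"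
    using assms by (auto simp: is_transform_def)
  have sqt: "square_integrable lborel (trunc T f)" for T using L1L2_trunc[OF f] by (simp add: L1L2_def)
  have "((\<lambda>T. l2norm lborel (chirp (trunc T f))) \<longlongrightarrow> l2norm lborel g) at_top"
    by (intro l2norm_tendsto chirp_isometry L1L2_trunc f g lim)
  moreover have "((\<lambda>T. l2norm lborel (trunc T f)) \<longlongrightarrow> l2norm lborel f) at_top"
    by (intro l2norm_tendsto sqt f trunc_tendsto)
  moreover have "l2norm lborel (chirp (trunc T f)) = l2norm lborel (trunc T f)" for T by (intro chirp_isometry L1L2_trunc f)
  ultimately show ?thesis using tendsto_unique[OF trivial_limit_at_top_linorder] by (simp only:)
qed

lemma is_transform_add_scale:
  assumes f: "is_transform f g" and f': "is_transform f' g'"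
  shows "is_transform (\<lambda>t. f t + c * f' t) (\<lambda>u. g u + c * g' u)"
proof -
  have sq: "square_integrable lborel f" "square_integrable lborel g" "square_integrable lborel f'" "square_integrable lborel g'"
    using f f' by (auto simp: is_transform_def)
  have tr: "trunc T (\<lambda>t. f t + c * f' t) = (\<lambda>t. trunc T f t + c * trunc T f' t)" for T
    by (simp add: trunc_def fun_eq_iff algebra_simps)
  have chirp: "chirp (trunc T (\<lambda>t. f t + c * f' t)) u = chirp (trunc T f) u + c * chirp (trunc T f') u" for T u
  proof -
    have "fourier (\<lambda>t. trunc T f t + c * trunc T f' t) v = fourier (trunc T f) v + c * fourier (trunc T f') v" for v
      using L1L2_trunc[OF sq(1)] L1L2_trunc[OF sq(3)] by (subst fourier_add) (auto simp: L1L2_def fourier_scale)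
    then show ?thesis unfolding chirp_def tr by (simp add: algebra_simps)
  qed
  have "((\<lambda>T. l2norm lborel (\<lambda>u. chirp (trunc T (\<lambda>t. f t + c * f' t)) u - (g u + c * g' u))) \<longlongrightarrow> 0) at_top"
  proof (rule Lim_null_comparison)
    show "((\<lambda>T. l2norm lborel (\<lambda>u. chirp (trunc T f) u - g u) + cmod c * l2norm lborel (\<lambda>u. chirp (trunc T f') u - g' u)) \<longlongrightarrow> 0) at_top"
      using f f' by (auto simp: is_transform_def intro!: tendsto_eq_intros)
    have "l2norm lborel (\<lambda>u. chirp (trunc T (\<lambda>t. f t + c * f' t)) u - (g u + c * g' u))
        \<le> l2norm lborel (\<lambda>u. chirp (trunc T f) u - g u) + cmod c * l2norm lborel (\<lambda>u. chirp (trunc T f') u - g' u)" for T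
    proof -
      have "(\<lambda>u. chirp (trunc T (\<lambda>t. f t + c * f' t)) u - (g u + c * g' u))
          = (\<lambda>u. (chirp (trunc T f) u - g u) + c * (chirp (trunc T f') u - g' u))"
        by (simp add: chirp fun_eq_iff algebra_simps)
      then show ?thesis
        using l2norm_triangle[OF square_integrable_diff square_integrable_scale[OF square_integrable_diff, of lborel "chirp (trunc T f')" g' c], of "chirp (trunc T f)" g]
          chirp_isometry(1)[OF L1L2_trunc[OF sq(1)]] chirp_isometry(1)[OF L1L2_trunc[OF sq(3)]] sq
        by (simp add: l2norm_scale)
    qed
    then show "\<forall>\<^sub>F T in at_top. norm (l2norm lborel (\<lambda>u. chirp (trunc T (\<lambda>t. f t + c * f' t)) u - (g u + c * g' u)))
        \<le> l2norm lborel (\<lambda>u. chirp (trunc T f) u - g u) + cmod c * l2norm lborel (\<lambda>u. chirp (trunc T f') u - g' u)" by simp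
  qed
  then show ?thesis using sq by (auto simp: is_transform_def intro!: square_integrable_add square_integrable_scale)
qed

text \<open>Norms are preserved on all combinations \<open>f + c * f'\<close>, so polarisation
  applies.\<close>

lemma is_transform_inner:
  assumes f: "is_transform f g" and f': "is_transform f' g'"
  shows "(LBINT u. g u * cnj (g' u)) = (LBINT t. f t * cnj (f' t))"
proof -
  have "(LBINT u. g u * cnj (g' u)) = of_real 1 * (LBINT t. f t * cnj (f' t))"
    using f f' is_transform_l2norm[OF is_transform_add_scale[OF f f']] is_transform_l2norm[OF f']
    by (intro inner_eq_of_l2norm_eq) (auto simp: is_transform_def)
  then show ?thesis by simp
qed

text \<open>The factors are the modulus of \<open>\<kappa>\<close>, the constant of
  \<open>hausdorff_young\<close>, and the power \<open>1 - 1 / p\<close> of the dilation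
  \<open>s = b * sqrt (p - 1) / p\<close> that matches \<open>u / b\<close> with
  \<open>w / p * v\<close>. At \<open>p = 2\<close> the value is 1.\<close>

definition hy_const :: "real \<Rightarrow> real" where
  "hy_const p = 1 / sqrt (2 * pi * b) * (2 * pi * sqrt p * (2 * pi) powr (- 1 / p)) * (b * sqrt (p - 1) / p) powr (1 - 1 / p)"

text \<open>The substitution \<open>u = s * v\<close> turns \<open>fourier f (u / b)\<close> into
  \<open>fourier f (w / p * v)\<close>. Its Jacobian contributes \<open>s\<close>, and the L^p norm
  of the dilated \<open>g\<close> contributes \<open>s powr (- 1 / p)\<close>; the unimodular chirp
  is absorbed into \<open>G\<close> without changing that norm.\<close>

lemma chirp_hausdorff_young:
  assumes p: "1 < p" "p < 2" and f: "L1L2 f" and g: "L1L2 g"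
  shows "cmod (LBINT u. chirp f u * cnj (g u))
    \<le> hy_const p * lpnorm p f * lpnorm p g"
proof -
  define q w where "q = p / (p - 1)" and "w = sqrt (p - 1)"
  have q: "1 / p + 1 / q = 1" "q > 1" using p by (simp_all add: q_def field_simps)
  have w: "w\<^sup>2 = p - 1" "w > 0" using p by (simp_all add: w_def)
  define s where "s = b * w / p"
  have s: "s > 0" using b w p by (simp add: s_def)
  define G where "G u = cis (\<psi> (s * u)) * cnj (g (s * u))" for u
  note [measurable] = L1L2_measurable[OF f] L1L2_measurable[OF g]
  have GL: "L1L2 G"
  proof -
    have gs: "L1L2 (\<lambda>u. g (s * u))"
      using square_integrable_rescale(1)[of g s] lborel_integrable_real_affine[of g s 0] g s by (simp add: L1L2_def)
    show ?thesis
    proof (rule L1L2_bound[OF gs])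
      have [measurable]: "(\<lambda>u. cnj (g (s * u))) \<in> borel_measurable lborel"
        using square_integrable_cnj[of lborel "\<lambda>u. g (s * u)"] gs by (auto simp: L1L2_def square_integrable_def)
      show "G \<in> borel_measurable lborel" unfolding G_def by measurable
    qed (simp add: G_def norm_mult)
  qed
  have "(LBINT u. chirp f u * cnj (g u)) = \<bar>s\<bar> *\<^sub>R (LBINT v. chirp f (0 + s * v) * cnj (g (0 + s * v)))"
    using s by (intro lborel_integral_real_affine) simp
  also have "(LBINT v. chirp f (0 + s * v) * cnj (g (0 + s * v))) = \<kappa> * (LBINT v. G v * fourier f (w / p * v))"
  proof -
    have "chirp f (0 + s * v) * cnj (g (0 + s * v)) = \<kappa> * (G v * fourier f (w / p * v))" for v
      using b by (simp add: chirp_def G_def s_def mult_ac)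
    then show ?thesis by simp
  qed
  finally have "cmod (LBINT u. chirp f u * cnj (g u)) = s * cmod \<kappa> * cmod (LBINT v. G v * fourier f (w / p * v))"
    using s by (simp add: norm_mult)
  also have "\<dots> \<le> s * cmod \<kappa> * (2 * pi * sqrt p * (2 * pi) powr (- 1 / p)
      * lpnorm p f * lpnorm p G)"
    using s by (intro mult_left_mono hausdorff_young[OF p q w f GL]) auto
  also have "(LBINT t. cmod (G t) powr p) = (LBINT t. cmod (g t) powr p) / s"
    using lborel_integral_real_affine[of s "\<lambda>t. cmod (g t) powr p" 0] s by (simp add: G_def norm_mult)
  also have "((LBINT t. cmod (g t) powr p) / s) powr (1 / p) = lpnorm p g / s powr (1 / p)"
    by (rule powr_divide)
  also have "s * cmod \<kappa> * (2 * pi * sqrt p * (2 * pi) powr (- 1 / p) * lpnorm p f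
        * (lpnorm p g / s powr (1 / p)))
      = cmod \<kappa> * (2 * pi * sqrt p * (2 * pi) powr (- 1 / p)) * (s / s powr (1 / p))
        * lpnorm p f * lpnorm p g"
    by simp
  also have "s / s powr (1 / p) = s powr (1 - 1 / p)" using s by (simp add: powr_diff)
  finally show ?thesis by (simp add: hy_const_def \<kappa> s_def w_def)
qed

text \<open>Truncation brings both functions into L1 and L2 without increasing their L^p norms, and
  the pairing is continuous in L2, so the bound survives the limit.\<close>

theorem transform_hausdorff_young:
  assumes p: "1 < p" "p < 2" and f: "is_transform f \<Phi>" and g: "square_integrable lborel g"
    and fp: "integrable lborel (\<lambda>t. cmod (f t) powr p)" "(LBINT t. cmod (f t) powr p) \<le> 1"
    and gp: "integrable lborel (\<lambda>t. cmod (g t) powr p)" "(LBINT t. cmod (g t) powr p) \<le> 1"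
  shows "cmod (LBINT u. \<Phi> u * cnj (g u)) \<le> hy_const p"
proof -
  have f': "square_integrable lborel f" "square_integrable lborel \<Phi>"
     "((\<lambda>T. l2norm lborel (\<lambda>u. chirp (trunc T f) u - \<Phi> u)) \<longlongrightarrow> 0) at_top"
    using f by (auto simp: is_transform_def)
  have D0: "hy_const p \<ge> 0" using p b by (simp add: hy_const_def)
  have sqg: "square_integrable lborel (\<lambda>u. cnj (trunc T g u))" for T
    using L1L2_trunc[OF g] by (auto simp: L1L2_def intro!: square_integrable_cnj)
  have cl: "((\<lambda>T. l2norm lborel (\<lambda>u. cnj (trunc T g u) - cnj (g u))) \<longlongrightarrow> 0) at_top"
    using trunc_tendsto[OF g] by (simp add: l2norm_def flip: complex_cnj_diff)
  have lim: "((\<lambda>T. \<integral>u. chirp (trunc T f) u * cnj (trunc T g u) \<partial>lborel) \<longlongrightarrow> (LBINT u. \<Phi> u * cnj (g u))) at_top"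
    by (intro integral_mult_tendsto chirp_isometry L1L2_trunc f' sqg square_integrable_cnj g cl)
  have bound: "cmod (LBINT u. chirp (trunc T f) u * cnj (trunc T g u)) \<le> hy_const p" for T
  proof -
    have le1: "lpnorm p (trunc T h) \<le> 1"
      if h: "square_integrable lborel h" "integrable lborel (\<lambda>t. cmod (h t) powr p)" "(LBINT t. cmod (h t) powr p) \<le> 1" for h
    proof -
      have "(LBINT t. cmod (trunc T h t) powr p) \<le> (LBINT t. cmod (h t) powr p)"
      proof (rule integral_mono)
        show "integrable lborel (\<lambda>t. cmod (trunc T h t) powr p)"
          using p by (intro L1L2_integrable_powr L1L2_trunc h) auto
        show "cmod (trunc T h t) powr p \<le> cmod (h t) powr p" for t
          using p cmod_trunc_le by (intro powr_mono2) auto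
      qed (rule h)
      then have "(LBINT t. cmod (trunc T h t) powr p) \<le> 1" using h(3) by linarith
      then show ?thesis using p by (intro powr_le1) (auto simp: integral_nonneg_AE)
    qed
    have "cmod (LBINT u. chirp (trunc T f) u * cnj (trunc T g u))
       \<le> hy_const p * lpnorm p (trunc T f) * lpnorm p (trunc T g)"
      by (intro chirp_hausdorff_young p L1L2_trunc f' g)
    also have "\<dots> \<le> hy_const p * 1 * 1"
      using D0 le1[OF f'(1) fp] le1[OF g gp] by (intro mult_mono) auto
    finally show ?thesis by simp
  qed
  show ?thesis
    by (rule tendsto_upperbound[OF tendsto_norm[OF lim]]) (use bound in auto)
qed

end

subsection \<open>Differentiation at the exponent 2\<close>

text \<open>Between 0 and \<open>y\<close> the slope of \<open>exp\<close> is at most 1 for negative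
  \<open>y\<close> and at most \<open>exp y\<close> for positive \<open>y\<close>. The estimate thus
  tolerates that \<open>ln (m x)\<close> may be unbounded below.\<close>

lemma exp_diff_one_le:
  fixes y C :: real
  assumes "exp y \<le> C" "C \<ge> 1"
  shows "\<bar>exp y - 1\<bar> \<le> \<bar>y\<bar> * C"
proof (cases "y \<ge> 0")
  case True
  have "exp y - 1 = exp y * (1 - exp (- y))" by (simp add: exp_minus field_simps)
  also have "\<dots> \<le> exp y * y" using exp_ge_add_one_self[of "- y"] by (intro mult_left_mono) auto
  also have "\<dots> \<le> C * y" using assms True by (intro mult_right_mono) auto
  finally show ?thesis using True by (simp add: mult.commute)
next
  case False
  then have "1 - exp y \<le> - y * 1" using exp_ge_add_one_self[of y] by linarith
  also have "\<dots> \<le> - y * C" using False assms by (intro mult_left_mono) auto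
  finally show ?thesis using False by simp
qed

text \<open>The shift by 2 gives \<open>0 < s < 1\<close> already at \<open>n = 0\<close>, so that
  \<open>p = 2 / (1 + s)\<close> stays strictly between 1 and 2.\<close>

definition step :: "nat \<Rightarrow> real" where "step n = 1 / (real n + 2)"

lemma step: "0 < step n" "step n < 1"
  by (auto simp: step_def)

lemma step_tendsto: "step \<longlonglongrightarrow> 0"
  unfolding step_def[abs_def] by real_asymp

lemma step_quotient_tendsto:
  assumes "(f has_real_derivative D) (at 0)"
  shows "(\<lambda>n. (f (step n) - f 0) / step n) \<longlonglongrightarrow> D"
proof -
  have "((\<lambda>h. (f h - f 0) / h) \<longlongrightarrow> D) (at 0)" using assms by (simp add: DERIV_def)
  moreover have "filterlim step (at 0) sequentially"
    using step_tendsto step by (auto simp: filterlim_at intro!: always_eventually less_imp_neq[THEN not_sym])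
  ultimately show ?thesis by (rule filterlim_compose)
qed

text \<open>
  Multiplying \<open>F\<close> by \<open>m powr (s / 2)\<close> moves it to the unit ball of \<open>L\<^sup>p\<close>, \<open>p = 2 / (1 + s)\<close>.
\<close>
locale weight =
  fixes F :: "real \<Rightarrow> complex" and m :: "real \<Rightarrow> real" and M :: real
  assumes F: "square_integrable lborel F" and F1: "l2norm lborel F = 1"
    and m [measurable]: "m \<in> borel_measurable lborel" and m0: "\<And>x. 0 \<le> m x" and mM: "\<And>x. m x \<le> M" and M: "M \<ge> 1"
    and mi: "integrable lborel m" and m1: "(LBINT x. m x) \<le> 1"
    and pos: "\<And>x. F x \<noteq> 0 \<Longrightarrow> 0 < m x"
    and ent: "integrable lborel (\<lambda>x. (cmod (F x))\<^sup>2 * ln (m x))"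
begin

lemma F_measurable [measurable]: "F \<in> borel_measurable lborel"
  using F by (rule square_integrable_measurable)

lemma F_sq: "(LBINT x. (cmod (F x))\<^sup>2) = 1"
  using l2norm_sq[of lborel F] by (simp add: F1)

definition tilt :: "real \<Rightarrow> real \<Rightarrow> complex" where
  "tilt s x = F x * of_real (m x powr (s / 2))"

lemma powr_le_M: "0 < s \<Longrightarrow> s < 1 \<Longrightarrow> m x powr (s / 2) \<le> M"
proof -
  assume s: "0 < s" "s < 1"
  have "m x powr (s / 2) \<le> M powr (s / 2)" using m0 mM s by (intro powr_mono2) auto
  also have "\<dots> \<le> M powr 1" using M s by (intro powr_mono) auto
  finally show ?thesis using M by simp
qed

lemma square_integrable_tilt:
  assumes s: "0 < s" "s < 1"
  shows "square_integrable lborel (tilt s)"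
proof (rule square_integrable_bound[OF F, where C = M])
  show "tilt s \<in> borel_measurable lborel" unfolding tilt_def[abs_def] by measurable
  show "cmod (tilt s x) \<le> M * cmod (F x)" for x
    using mult_right_mono[OF powr_le_M[OF s, of x], of "cmod (F x)"] by (simp add: tilt_def norm_mult mult.commute)
qed

text \<open>The exponent is tuned to \<open>s / 2 * p = 1 - p / 2\<close>. Young's inequality then
  bounds the integrand by the convex combination of \<open>|F|\<^sup>2\<close> and \<open>m\<close>
  with weights \<open>p / 2\<close> and \<open>1 - p / 2\<close>, and both have integral at most
  1.\<close>

lemma tilt_powr:
  assumes s: "0 < s" "s < 1" and p: "p = 2 / (1 + s)"
  shows "integrable lborel (\<lambda>x. cmod (tilt s x) powr p)" "(LBINT x. cmod (tilt s x) powr p) \<le> 1"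
proof -
  have p': "1 < p" "p < 2" using s by (simp_all add: p field_simps)
  have sp: "s / 2 * p = 1 - p / 2" using s by (simp add: p field_simps)
  have le: "cmod (tilt s x) powr p \<le> p / 2 * (cmod (F x))\<^sup>2 + (1 - p / 2) * m x" for x
  proof (cases "F x = 0")
    case True
    then show ?thesis using p' m0[of x] by (simp add: tilt_def)
  next
    case False
    have "cmod (tilt s x) powr p = ((cmod (F x))\<^sup>2) powr (p / 2) * m x powr (1 - p / 2)"
    proof -
      have sq: "(cmod (F x))\<^sup>2 = cmod (F x) powr 2" using False by (simp add: powr_numeral)
      have "2 * (p / 2) = p" by simp
      then have "((cmod (F x))\<^sup>2) powr (p / 2) = cmod (F x) powr p" unfolding sq powr_powr by (simp only:)
      then show ?thesis unfolding tilt_def norm_mult norm_of_real powr_mult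
        by (simp only: abs_of_nonneg[OF powr_ge_zero] powr_powr sp)
    qed
    also have "\<dots> \<le> p / 2 * (cmod (F x))\<^sup>2 + (1 - p / 2) * m x"
      using False p' pos by (intro Youngs_inequality_0) auto
    finally show ?thesis .
  qed
  have i: "integrable lborel (\<lambda>x. p / 2 * (cmod (F x))\<^sup>2 + (1 - p / 2) * m x)"
    using mi square_integrableD[OF F] by auto
  show int: "integrable lborel (\<lambda>x. cmod (tilt s x) powr p)"
  proof (rule Bochner_Integration.integrable_bound[OF i])
    show "(\<lambda>x. cmod (tilt s x) powr p) \<in> borel_measurable lborel" unfolding tilt_def by measurable
    show "AE x in lborel. norm (cmod (tilt s x) powr p) \<le> norm (p / 2 * (cmod (F x))\<^sup>2 + (1 - p / 2) * m x)"
      using le by (auto intro!: AE_I2 order_trans[OF _ abs_ge_self])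
  qed
  have "(LBINT x. cmod (tilt s x) powr p) \<le> (LBINT x. p / 2 * (cmod (F x))\<^sup>2 + (1 - p / 2) * m x)"
    by (rule integral_mono[OF int i le])
  also have "\<dots> = p / 2 * 1 + (1 - p / 2) * (LBINT x. m x)"
    using mi square_integrableD[OF F] by (simp add: F_sq)
  also have "\<dots> \<le> p / 2 * 1 + (1 - p / 2) * 1" using m1 p' by (intro add_left_mono mult_left_mono) auto
  finally show "(LBINT x. cmod (tilt s x) powr p) \<le> 1" by simp
qed

definition overlap :: "real \<Rightarrow> real" where
  "overlap s = (LBINT x. (cmod (F x))\<^sup>2 * m x powr (s / 2))"

lemma integrable_overlap:
  assumes s: "0 < s" "s < 1"
  shows "integrable lborel (\<lambda>x. (cmod (F x))\<^sup>2 * m x powr (s / 2))"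
proof (rule Bochner_Integration.integrable_bound)
  show "integrable lborel (\<lambda>x. M * (cmod (F x))\<^sup>2)" using square_integrableD[OF F] by simp
  show "AE x in lborel. norm ((cmod (F x))\<^sup>2 * m x powr (s / 2)) \<le> norm (M * (cmod (F x))\<^sup>2)"
  proof (rule AE_I2)
    fix x
    show "norm ((cmod (F x))\<^sup>2 * m x powr (s / 2)) \<le> norm (M * (cmod (F x))\<^sup>2)"
      using mult_right_mono[OF powr_le_M[OF s, of x], of "(cmod (F x))\<^sup>2"] M by (simp add: abs_mult mult.commute)
  qed
qed measurable

lemma tilt_overlap: "(LBINT x. tilt s x * cnj (F x)) = of_real (overlap s)"
  "(LBINT x. F x * cnj (tilt s x)) = of_real (overlap s)"
proof -
  have "F x * cnj (F x) * of_real r = of_real ((cmod (F x))\<^sup>2 * r)" for x r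
    unfolding of_real_mult complex_norm_square by simp
  then have "tilt s x * cnj (F x) = of_real ((cmod (F x))\<^sup>2 * m x powr (s / 2))"
    "F x * cnj (tilt s x) = of_real ((cmod (F x))\<^sup>2 * m x powr (s / 2))" for x
    unfolding tilt_def by (simp_all add: mult_ac)
  then show "(LBINT x. tilt s x * cnj (F x)) = of_real (overlap s)"
    "(LBINT x. F x * cnj (tilt s x)) = of_real (overlap s)"
    by (simp_all only: overlap_def integral_complex_of_real)
qed

lemma quotient_bound:
  assumes s: "0 < s" "s < 1" and x: "0 < m x"
  shows "\<bar>m x powr (s / 2) - 1\<bar> / s \<le> M * \<bar>ln (m x)\<bar> / 2"
proof -
  have "\<bar>exp (s / 2 * ln (m x)) - 1\<bar> \<le> \<bar>s / 2 * ln (m x)\<bar> * M"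
    using powr_le_M[OF s, of x] x M by (intro exp_diff_one_le) (auto simp: powr_def)
  then show ?thesis using s x by (simp add: powr_def abs_mult field_simps)
qed

lemma quotient_tendsto:
  assumes x: "0 < m x"
  shows "(\<lambda>n. (m x powr (step n / 2) - 1) / step n) \<longlonglongrightarrow> ln (m x) / 2"
proof -
  have "((\<lambda>s. exp (s / 2 * ln (m x))) has_real_derivative ln (m x) / 2) (at 0)"
    by (auto intro!: derivative_eq_intros)
  from step_quotient_tendsto[OF this] show ?thesis using x by (simp add: powr_def)
qed

text \<open>The derivative of \<open>m powr (s / 2)\<close> at 0 is \<open>ln m / 2\<close>. It may
  be taken under the integral because \<open>quotient_bound\<close>, which rests on
  \<open>m \<le> M\<close>, dominates the quotients by a multiple of
  \<open>|F|\<^sup>2 * |ln m|\<close>.\<close>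

lemma overlap_tendsto: "(\<lambda>n. (overlap (step n) - 1) / step n) \<longlonglongrightarrow> (LBINT x. (cmod (F x))\<^sup>2 * ln (m x)) / 2"
proof -
  have "(\<lambda>n. \<integral>x. (cmod (F x))\<^sup>2 * ((m x powr (step n / 2) - 1) / step n) \<partial>lborel)
      \<longlonglongrightarrow> (LBINT x. (cmod (F x))\<^sup>2 * (ln (m x) / 2))"
  proof (rule integral_dominated_convergence[where w = "\<lambda>x. M / 2 * \<bar>(cmod (F x))\<^sup>2 * ln (m x)\<bar>"])
    show "integrable lborel (\<lambda>x. M / 2 * \<bar>(cmod (F x))\<^sup>2 * ln (m x)\<bar>)"
      using integrable_abs[OF ent] by (rule integrable_mult_right)
    show "AE x in lborel. (\<lambda>n. (cmod (F x))\<^sup>2 * ((m x powr (step n / 2) - 1) / step n)) \<longlonglongrightarrow> (cmod (F x))\<^sup>2 * (ln (m x) / 2)"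
    proof (rule AE_I2)
      fix x
      show "(\<lambda>n. (cmod (F x))\<^sup>2 * ((m x powr (step n / 2) - 1) / step n)) \<longlonglongrightarrow> (cmod (F x))\<^sup>2 * (ln (m x) / 2)"
      proof (cases "F x = 0")
        case False
        show ?thesis by (rule tendsto_mult_left[OF quotient_tendsto[OF pos[OF False]]])
      qed simp
    qed
    show "AE x in lborel. norm ((cmod (F x))\<^sup>2 * ((m x powr (step n / 2) - 1) / step n)) \<le> M / 2 * \<bar>(cmod (F x))\<^sup>2 * ln (m x)\<bar>" for n
    proof (rule AE_I2)
      fix x
      show "norm ((cmod (F x))\<^sup>2 * ((m x powr (step n / 2) - 1) / step n)) \<le> M / 2 * \<bar>(cmod (F x))\<^sup>2 * ln (m x)\<bar>"
      proof (cases "F x = 0")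
        case False
        have "(cmod (F x))\<^sup>2 * (\<bar>m x powr (step n / 2) - 1\<bar> / step n) \<le> (cmod (F x))\<^sup>2 * (M * \<bar>ln (m x)\<bar> / 2)"
          by (intro mult_left_mono quotient_bound step pos False) auto
        then show ?thesis using step[of n] by (simp add: abs_mult mult_ac)
      qed simp
    qed
  qed measurable
  moreover have eq: "(LBINT x. (cmod (F x))\<^sup>2 * ((m x powr (step n / 2) - 1) / step n)) = (overlap (step n) - 1) / step n" for n
  proof -
    have "(LBINT x. (cmod (F x))\<^sup>2 * ((m x powr (step n / 2) - 1) / step n))
       = (LBINT x. ((cmod (F x))\<^sup>2 * m x powr (step n / 2) - (cmod (F x))\<^sup>2) / step n)"
      by (rule Bochner_Integration.integral_cong[OF refl]) (simp add: algebra_simps diff_divide_distrib)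
    also have "\<dots> = (overlap (step n) - 1) / step n"
      using integrable_overlap[OF step] square_integrableD[OF F] by (simp add: overlap_def F_sq)
    finally show ?thesis .
  qed
  ultimately show ?thesis unfolding eq by simp
qed

text \<open>Integrability is at hand for the first power of \<open>ln m\<close> only, so one factor
  of the square is bounded by \<open>M\<close> and the other by \<open>quotient_bound\<close>. The
  resulting o(s) suffices, since the distances for \<open>F\<close> and for \<open>G\<close> enter
  as a product of square roots.\<close>

lemma tilt_diff_tendsto: "(\<lambda>n. (l2norm lborel (\<lambda>x. F x - tilt (step n) x))\<^sup>2 / step n) \<longlonglongrightarrow> 0"
proof -
  have "(\<lambda>n. \<integral>x. (cmod (F x))\<^sup>2 * ((m x powr (step n / 2) - 1)\<^sup>2 / step n) \<partial>lborel) \<longlonglongrightarrow> (\<integral>x. 0 \<partial>(lborel :: real measure))"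
  proof (rule integral_dominated_convergence[where w = "\<lambda>x. M * M / 2 * \<bar>(cmod (F x))\<^sup>2 * ln (m x)\<bar>"])
    show "integrable lborel (\<lambda>x. M * M / 2 * \<bar>(cmod (F x))\<^sup>2 * ln (m x)\<bar>)"
      using integrable_abs[OF ent] by (rule integrable_mult_right)
    show "AE x in lborel. (\<lambda>n. (cmod (F x))\<^sup>2 * ((m x powr (step n / 2) - 1)\<^sup>2 / step n)) \<longlonglongrightarrow> 0"
    proof (rule AE_I2)
      fix x
      show "(\<lambda>n. (cmod (F x))\<^sup>2 * ((m x powr (step n / 2) - 1)\<^sup>2 / step n)) \<longlonglongrightarrow> 0"
      proof (cases "F x = 0")
        case False
        note q = quotient_tendsto[OF pos[OF False]]
        have "(\<lambda>n. (cmod (F x))\<^sup>2 * ((m x powr (step n / 2) - 1) / step n * ((m x powr (step n / 2) - 1) / step n) * step n))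
            \<longlonglongrightarrow> (cmod (F x))\<^sup>2 * (ln (m x) / 2 * (ln (m x) / 2) * 0)"
          by (intro tendsto_mult tendsto_const q step_tendsto)
        moreover have "(m x powr (step n / 2) - 1) / step n * ((m x powr (step n / 2) - 1) / step n) * step n
           = (m x powr (step n / 2) - 1)\<^sup>2 / step n" for n
          using step[of n] by (simp add: power2_eq_square)
        ultimately show ?thesis by (simp only: mult_zero_right)
      qed simp
    qed
    show "AE x in lborel. norm ((cmod (F x))\<^sup>2 * ((m x powr (step n / 2) - 1)\<^sup>2 / step n)) \<le> M * M / 2 * \<bar>(cmod (F x))\<^sup>2 * ln (m x)\<bar>" for n
    proof (rule AE_I2)
      fix x
      show "norm ((cmod (F x))\<^sup>2 * ((m x powr (step n / 2) - 1)\<^sup>2 / step n)) \<le> M * M / 2 * \<bar>(cmod (F x))\<^sup>2 * ln (m x)\<bar>"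
      proof (cases "F x = 0")
        case False
        define r where "r = m x powr (step n / 2)"
        have r: "0 \<le> r" "r \<le> M" using powr_le_M[OF step] by (auto simp: r_def)
        have "\<bar>r - 1\<bar> * (\<bar>r - 1\<bar> / step n) \<le> M * (M * \<bar>ln (m x)\<bar> / 2)"
        proof (rule mult_mono)
          show "\<bar>r - 1\<bar> \<le> M" using r M by linarith
          show "\<bar>r - 1\<bar> / step n \<le> M * \<bar>ln (m x)\<bar> / 2" unfolding r_def by (rule quotient_bound[OF step pos[OF False]])
        qed (use M step[of n] in auto)
        then have "(cmod (F x))\<^sup>2 * (\<bar>r - 1\<bar> * (\<bar>r - 1\<bar> / step n)) \<le> (cmod (F x))\<^sup>2 * (M * (M * \<bar>ln (m x)\<bar> / 2))"
          by (intro mult_left_mono) auto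
        then show ?thesis using step[of n]
          by (simp add: r_def abs_mult power2_eq_square mult_ac)
      qed simp
    qed
  qed measurable
  moreover have eq: "(LBINT x. (cmod (F x))\<^sup>2 * ((m x powr (step n / 2) - 1)\<^sup>2 / step n))
      = (l2norm lborel (\<lambda>x. F x - tilt (step n) x))\<^sup>2 / step n" for n
  proof -
    have "(cmod (F x - tilt (step n) x))\<^sup>2 = (cmod (F x))\<^sup>2 * (m x powr (step n / 2) - 1)\<^sup>2" for x
    proof -
      have "F x - tilt (step n) x = - (F x * of_real (m x powr (step n / 2) - 1))"
        by (simp add: tilt_def algebra_simps)
      then show ?thesis by (simp only: norm_minus_cancel norm_mult norm_of_real power_mult_distrib power2_abs)
    qed
    then show ?thesis unfolding l2norm_sq by simp
  qed
  ultimately show ?thesis unfolding eq by simp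
qed

end

context chirped_fourier
begin

text \<open>\<open>L s\<close> is the logarithm of the constant in a form that is smooth at
  \<open>s = 0\<close>. It vanishes there, in accordance with the isometry at \<open>p = 2\<close>,
  and its slope is the entropy bound times \<open>- 1 / 2\<close>.\<close>

lemma hy_const_tendsto: "(\<lambda>n. (hy_const (2 / (1 + step n)) - 1) / step n) \<longlonglongrightarrow> - ln (pi * exp 1 * b) / 2"
proof -
  define L where "L s = ln (2 * pi) - ln (2 * pi * b) / 2 + (ln 2 - ln (1 + s)) / 2 - (1 + s) / 2 * ln (2 * pi)
    + (1 - s) / 2 * (ln b + (ln (1 - s) - ln (1 + s)) / 2 - (ln 2 - ln (1 + s)))" for s
  have eq: "hy_const (2 / (1 + s)) = exp (L s)" if s: "0 < s" "s < 1" for s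
  proof -
    define p where "p = 2 / (1 + s)"
    have p: "1 < p" using s by (simp add: p_def field_simps)
    have pos: "hy_const p > 0" using p b by (simp add: hy_const_def)
    have "ln (hy_const p) = - ln (2 * pi * b) / 2 + (ln (2 * pi) + ln p / 2 - 1 / p * ln (2 * pi))
       + (1 - 1 / p) * (ln b + ln (p - 1) / 2 - ln p)"
      unfolding hy_const_def using p b by (simp add: ln_mult ln_div ln_powr ln_sqrt) (simp add: field_simps)
    also have "p - 1 = (1 - s) / (1 + s)" using s by (simp add: p_def field_simps)
    also have "ln ((1 - s) / (1 + s)) = ln (1 - s) - ln (1 + s)" using s by (simp add: ln_div)
    also have "ln p = ln 2 - ln (1 + s)" using s by (simp add: p_def ln_div)
    also have "1 / p = (1 + s) / 2" by (simp add: p_def)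
    also have "1 - (1 + s) / 2 = (1 - s) / 2" by (simp add: field_simps)
    finally have "ln (hy_const p) = L s" by (simp add: L_def)
    then show ?thesis using pos by (metis exp_ln p_def)
  qed
  have L0: "L 0 = 0" using b by (simp add: L_def ln_mult field_simps)
  have "ln (pi * exp 1 * b) = ln pi + 1 + ln b" using b by (simp add: ln_mult)
  then have "(L has_real_derivative - ln (pi * exp 1 * b) / 2) (at 0)"
    unfolding L_def by (auto intro!: derivative_eq_intros simp: ln_mult field_simps)
  then have "((\<lambda>s. exp (L s)) has_real_derivative - ln (pi * exp 1 * b) / 2) (at 0)"
    using DERIV_chain2[OF DERIV_exp, of L "- ln (pi * exp 1 * b) / 2" 0 UNIV] L0 by simp
  from step_quotient_tendsto[OF this] show ?thesis using eq[OF step] by (simp add: L0)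
qed

text \<open>The inequality for the tilted functions becomes an equality at \<open>s = 0\<close>, so
  it passes to the difference quotients: the overlaps yield the logarithmic integrals and
  \<open>hy_const_tendsto\<close> the constant, all with the same factor 1/2.\<close>

theorem gibbs_uncertainty:
  assumes T: "is_transform F G" and WF: "weight F mF MF" and WG: "weight G mG MG"
  shows "ln (pi * exp 1 * b) \<le> - (LBINT x. (cmod (F x))\<^sup>2 * ln (mF x)) - (LBINT x. (cmod (G x))\<^sup>2 * ln (mG x))"
proof -
  interpret WF: weight F mF MF by (rule WF)
  interpret WG: weight G mG MG by (rule WG)
  define a where "a n = (l2norm lborel (\<lambda>x. F x - WF.tilt (step n) x))\<^sup>2 / step n" for n
  define c where "c n = (l2norm lborel (\<lambda>x. G x - WG.tilt (step n) x))\<^sup>2 / step n" for n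
  have ineq: "(WF.overlap (step n) - 1) / step n + (WG.overlap (step n) - 1) / step n - sqrt (a n) * sqrt (c n)
      \<le> (hy_const (2 / (1 + step n)) - 1) / step n" for n
  proof -
    define s where "s = step n"
    have s: "0 < s" "s < 1" using step by (auto simp: s_def)
    define p where "p = 2 / (1 + s)"
    have p: "1 < p" "p < 2" using s by (simp_all add: p_def field_simps)
    define \<phi> \<gamma> where "\<phi> = WF.tilt s" and "\<gamma> = WG.tilt s"
    have sq: "square_integrable lborel \<phi>" "square_integrable lborel \<gamma>" "square_integrable lborel F" "square_integrable lborel G"
      using WF.square_integrable_tilt[OF s] WG.square_integrable_tilt[OF s] WF.F WG.F by (auto simp: \<phi>_def \<gamma>_def)
    obtain \<Phi> where \<Phi>: "is_transform \<phi> \<Phi>" using is_transform_exists[OF sq(1)] by blast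
    then have sq\<Phi>: "square_integrable lborel \<Phi>" by (simp add: is_transform_def)
    have bound: "cmod (LBINT u. \<Phi> u * cnj (\<gamma> u)) \<le> hy_const p"
      using WF.tilt_powr[OF s p_def] WG.tilt_powr[OF s p_def]
      by (intro transform_hausdorff_young[OF p \<Phi> sq(2)]) (auto simp: \<phi>_def \<gamma>_def)
    have i: "integrable lborel (\<lambda>u. v u * cnj (w u))" if "square_integrable lborel v" "square_integrable lborel w" for v w
      using that by (intro integrable_square_mult square_integrable_cnj)
    \<comment> \<open>Expansion around \<open>G\<close>: the first-order terms are the two overlaps,
      the first by unitarity, and the remainder is a product of two differences whose norms are
      o(sqrt s).\<close>
    have "(LBINT u. \<Phi> u * cnj (\<gamma> u))
      = (LBINT u. \<Phi> u * cnj (G u)) - ((LBINT u. G u * cnj (G u)) - (LBINT u. G u * cnj (\<gamma> u)))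
        + (LBINT u. (G u - \<Phi> u) * cnj (G u - \<gamma> u))"
    proof -
      have "(LBINT u. (G u - \<Phi> u) * cnj (G u - \<gamma> u))
        = (LBINT u. G u * cnj (G u) - G u * cnj (\<gamma> u) - (\<Phi> u * cnj (G u) - \<Phi> u * cnj (\<gamma> u)))"
        by (simp add: algebra_simps)
      also have "\<dots> = (LBINT u. G u * cnj (G u)) - (LBINT u. G u * cnj (\<gamma> u))
          - ((LBINT u. \<Phi> u * cnj (G u)) - (LBINT u. \<Phi> u * cnj (\<gamma> u)))"
        by (simp only: Bochner_Integration.integral_diff Bochner_Integration.integrable_diff i sq sq\<Phi>)
      finally show ?thesis by simp
    qed
    also have "(LBINT u. \<Phi> u * cnj (G u)) = of_real (WF.overlap s)"
      using is_transform_inner[OF \<Phi> T] WF.tilt_overlap(1)[of s] by (simp add: \<phi>_def)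
    also have "(LBINT u. G u * cnj (\<gamma> u)) = of_real (WG.overlap s)"
      using WG.tilt_overlap(2)[of s] by (simp add: \<gamma>_def)
    also have "(LBINT u. G u * cnj (G u)) = 1"
    proof -
      have "(LBINT u. G u * cnj (G u)) = (LBINT u. of_real ((cmod (G u))\<^sup>2))" by (simp only: complex_norm_square)
      then show ?thesis by (simp only: integral_complex_of_real WG.F_sq of_real_1)
    qed
    finally have eq: "(LBINT u. \<Phi> u * cnj (\<gamma> u))
      = of_real (WF.overlap s + WG.overlap s - 1) + (LBINT u. (G u - \<Phi> u) * cnj (G u - \<gamma> u))" by simp
    have err: "cmod (LBINT u. (G u - \<Phi> u) * cnj (G u - \<gamma> u)) \<le> l2norm lborel (\<lambda>x. F x - \<phi> x) * l2norm lborel (\<lambda>x. G x - \<gamma> x)"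
    proof -
      have "l2norm lborel (\<lambda>u. G u - \<Phi> u) = l2norm lborel (\<lambda>x. F x - \<phi> x)"
        using is_transform_l2norm[OF is_transform_add_scale[OF T \<Phi>, of "- 1"]] by simp
      then show ?thesis
        using norm_integral_mult_le[OF square_integrable_diff[OF sq(4) sq\<Phi>] square_integrable_cnj[OF square_integrable_diff[OF sq(4) sq(2)]]]
        by (simp only: l2norm_cnj)
    qed
    have "WF.overlap s + WG.overlap s - 1 - l2norm lborel (\<lambda>x. F x - \<phi> x) * l2norm lborel (\<lambda>x. G x - \<gamma> x)
        \<le> Re (LBINT u. \<Phi> u * cnj (\<gamma> u))"
      using err abs_Re_le_cmod[of "\<integral>u. (G u - \<Phi> u) * cnj (G u - \<gamma> u) \<partial>lborel"] unfolding eq by simp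
    also have "\<dots> \<le> hy_const p" using bound complex_Re_le_cmod order_trans by blast
    finally have main: "WF.overlap s + WG.overlap s - 1 - l2norm lborel (\<lambda>x. F x - \<phi> x) * l2norm lborel (\<lambda>x. G x - \<gamma> x) \<le> hy_const p" .
    have "sqrt (a n) * sqrt (c n) = l2norm lborel (\<lambda>x. F x - \<phi> x) * l2norm lborel (\<lambda>x. G x - \<gamma> x) / s"
      using s by (simp add: a_def c_def \<phi>_def \<gamma>_def s_def real_sqrt_divide)
    moreover have "(WF.overlap s - 1) / s + (WG.overlap s - 1) / s - X / s = ((WF.overlap s + WG.overlap s - 1 - X) - 1) / s" for X
      by (simp add: add_divide_distrib diff_divide_distrib)
    ultimately show ?thesis using main s unfolding s_def [symmetric] p_def [symmetric]
      by (simp add: divide_right_mono)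
  qed
  have "(\<lambda>n. (WF.overlap (step n) - 1) / step n + (WG.overlap (step n) - 1) / step n - sqrt (a n) * sqrt (c n))
      \<longlonglongrightarrow> (LBINT x. (cmod (F x))\<^sup>2 * ln (mF x)) / 2 + (LBINT x. (cmod (G x))\<^sup>2 * ln (mG x)) / 2 - sqrt 0 * sqrt 0"
    unfolding a_def c_def
    by (intro tendsto_diff tendsto_add tendsto_mult tendsto_real_sqrt WF.overlap_tendsto WG.overlap_tendsto
        WF.tilt_diff_tendsto WG.tilt_diff_tendsto)
  from LIMSEQ_le[OF this hy_const_tendsto] ineq
  have "(LBINT x. (cmod (F x))\<^sup>2 * ln (mF x)) / 2 + (LBINT x. (cmod (G x))\<^sup>2 * ln (mG x)) / 2 - sqrt 0 * sqrt 0
      \<le> - ln (pi * exp 1 * b) / 2" by blast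
  then show ?thesis by simp
qed

end

subsection \<open>Entropies\<close>

context chirped_fourier
begin

text \<open>The height is at least 1, so clipping changes \<open>|F|\<^sup>2\<close> only where its
  logarithm is positive, and the negative part of \<open>|F|\<^sup>2 * ln (|F|\<^sup>2)\<close> is
  the same for every \<open>n\<close>. Clipping loses mass, which is why weights may be
  subprobability densities.\<close>

definition clipped :: "(real \<Rightarrow> complex) \<Rightarrow> nat \<Rightarrow> real \<Rightarrow> real" where
  "clipped F n x = min ((cmod (F x))\<^sup>2) (real n + 1)"

lemma clipped_weight:
  assumes F: "square_integrable lborel F" "l2norm lborel F = 1"
    and P: "integrable lborel (\<lambda>x. max 0 (- ((cmod (F x))\<^sup>2 * ln ((cmod (F x))\<^sup>2))))"
  shows "weight F (clipped F n) (real n + 1)"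
    "integrable lborel (\<lambda>x. max 0 ((cmod (F x))\<^sup>2 * ln (clipped F n x)))"
    "(LBINT x. (cmod (F x))\<^sup>2 * ln (clipped F n x))
      = (LBINT x. max 0 ((cmod (F x))\<^sup>2 * ln (clipped F n x)))
        - (LBINT x. max 0 (- ((cmod (F x))\<^sup>2 * ln ((cmod (F x))\<^sup>2))))"
proof -
  note [measurable] = square_integrable_measurable[OF F(1)]
  define \<rho> where "\<rho> x = (cmod (F x))\<^sup>2" for x
  have r0: "\<rho> x \<ge> 0" for x by (simp add: \<rho>_def)
  have [measurable]: "\<rho> \<in> borel_measurable lborel" unfolding \<rho>_def by measurable
  have ri: "integrable lborel \<rho>" using square_integrableD[OF F(1)] by (simp add: \<rho>_def[abs_def])
  have r1: "(LBINT x. \<rho> x) = 1" using l2norm_sq[of lborel F] F(2) by (simp add: \<rho>_def)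
  have cl: "clipped F n x = min (\<rho> x) (real n + 1)" for x by (simp add: clipped_def \<rho>_def)
  have cm [measurable]: "clipped F n \<in> borel_measurable lborel" unfolding clipped_def[abs_def] by measurable
  have ci: "integrable lborel (clipped F n)"
    by (rule Bochner_Integration.integrable_bound[OF ri cm]) (auto simp: cl r0 intro!: AE_I2)
  have split: "\<rho> x * ln (clipped F n x) = max 0 (\<rho> x * ln (clipped F n x)) - max 0 (- (\<rho> x * ln (\<rho> x)))" for x
  proof (cases "\<rho> x \<le> 1")
    case True
    then have eq: "clipped F n x = \<rho> x" by (simp add: cl min_def)
    have "ln (\<rho> x) \<le> 0" using True r0[of x] by (cases "\<rho> x = 0") auto
    then have "\<rho> x * ln (\<rho> x) \<le> 0" using r0[of x] by (rule mult_nonneg_nonpos[rotated])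
    then show ?thesis unfolding eq by simp
  next
    case False
    then have "0 \<le> ln (\<rho> x)" "0 \<le> ln (clipped F n x)" by (auto simp: cl)
    then show ?thesis using r0[of x] by (simp add: mult_nonneg_nonneg)
  qed
  have bound: "max 0 (\<rho> x * ln (clipped F n x)) \<le> \<rho> x * ln (real n + 1)" for x
  proof (cases "\<rho> x = 0")
    case False
    then have "ln (clipped F n x) \<le> ln (real n + 1)" using r0[of x] by (subst ln_le_cancel_iff) (auto simp: cl)
    then have "\<rho> x * ln (clipped F n x) \<le> \<rho> x * ln (real n + 1)" by (intro mult_left_mono r0)
    then show ?thesis using r0[of x] by simp
  qed simp
  have int: "integrable lborel (\<lambda>x. max 0 (\<rho> x * ln (clipped F n x)))"
  proof (rule Bochner_Integration.integrable_bound)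
    show "integrable lborel (\<lambda>x. \<rho> x * ln (real n + 1))" using ri by simp
    show "AE x in lborel. norm (max 0 (\<rho> x * ln (clipped F n x))) \<le> norm (\<rho> x * ln (real n + 1))"
      using bound by (auto intro!: AE_I2 order_trans[OF _ abs_ge_self])
  qed measurable
  have P': "integrable lborel (\<lambda>x. max 0 (- (\<rho> x * ln (\<rho> x))))" using P by (simp add: \<rho>_def)
  show "integrable lborel (\<lambda>x. max 0 ((cmod (F x))\<^sup>2 * ln (clipped F n x)))" using int by (simp add: \<rho>_def)
  have "integrable lborel (\<lambda>x. \<rho> x * ln (clipped F n x))" by (subst split) (intro Bochner_Integration.integrable_diff int P')
  then have ent: "integrable lborel (\<lambda>x. (cmod (F x))\<^sup>2 * ln (clipped F n x))" by (simp add: \<rho>_def)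
  have "(LBINT x. \<rho> x * ln (clipped F n x))
      = (LBINT x. max 0 (\<rho> x * ln (clipped F n x))) - (LBINT x. max 0 (- (\<rho> x * ln (\<rho> x))))"
    by (subst split) (rule Bochner_Integration.integral_diff[OF int P'])
  then show "(LBINT x. (cmod (F x))\<^sup>2 * ln (clipped F n x))
      = (LBINT x. max 0 ((cmod (F x))\<^sup>2 * ln (clipped F n x)))
        - (LBINT x. max 0 (- ((cmod (F x))\<^sup>2 * ln ((cmod (F x))\<^sup>2))))" by (simp add: \<rho>_def)
  have "(LBINT x. clipped F n x) \<le> (LBINT x. \<rho> x)" by (rule integral_mono[OF ci ri]) (simp add: cl)
  then have c1: "(LBINT x. clipped F n x) \<le> 1" by (simp only: r1)
  show "weight F (clipped F n) (real n + 1)"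
    by unfold_locales (use F cm ci c1 ent in \<open>auto simp: clipped_def\<close>)
qed

text \<open>Monotone convergence in \<open>n\<close>. The uniform bound \<open>C\<close>, which
  \<open>gibbs_uncertainty\<close> supplies in the application, makes the limit integrable.\<close>

lemma clipped_limit:
  assumes F: "square_integrable lborel F"
    and bd: "\<And>n. (LBINT x. max 0 ((cmod (F x))\<^sup>2 * ln (clipped F n x))) \<le> C"
    and int: "\<And>n. integrable lborel (\<lambda>x. max 0 ((cmod (F x))\<^sup>2 * ln (clipped F n x)))"
  shows "integrable lborel (\<lambda>x. max 0 ((cmod (F x))\<^sup>2 * ln ((cmod (F x))\<^sup>2)))"
    "(\<lambda>n. \<integral>x. max 0 ((cmod (F x))\<^sup>2 * ln (clipped F n x)) \<partial>lborel)
      \<longlonglongrightarrow> (LBINT x. max 0 ((cmod (F x))\<^sup>2 * ln ((cmod (F x))\<^sup>2)))"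
proof -
  note [measurable] = square_integrable_measurable[OF F]
  define k where "k n x = max 0 ((cmod (F x))\<^sup>2 * ln (clipped F n x))" for n x
  define k' where "k' x = max 0 ((cmod (F x))\<^sup>2 * ln ((cmod (F x))\<^sup>2))" for x
  have [measurable]: "k n \<in> borel_measurable lborel" for n unfolding k_def clipped_def by measurable
  have [measurable]: "k' \<in> borel_measurable lborel" unfolding k'_def by measurable
  have mono: "k n x \<le> k m x" if "n \<le> m" for n m x
  proof (cases "F x = 0")
    case False
    then have "ln (clipped F n x) \<le> ln (clipped F m x)" using that by (subst ln_le_cancel_iff) (auto simp: clipped_def)
    then have "(cmod (F x))\<^sup>2 * ln (clipped F n x) \<le> (cmod (F x))\<^sup>2 * ln (clipped F m x)" by (intro mult_left_mono) auto
    then show ?thesis unfolding k_def by (intro max.mono) auto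
  qed (simp add: k_def)
  have lim: "(\<lambda>n. k n x) \<longlonglongrightarrow> k' x" for x
  proof (rule tendsto_eventually)
    obtain N :: nat where N: "(cmod (F x))\<^sup>2 \<le> N" using real_arch_simple by blast
    show "\<forall>\<^sub>F n in sequentially. k n x = k' x"
      using eventually_ge_at_top[of N]
    proof eventually_elim
      case (elim n)
      then have "clipped F n x = (cmod (F x))\<^sup>2" using N by (simp add: clipped_def min_def)
      then show ?case by (simp add: k_def k'_def)
    qed
  qed
  have inc: "incseq (\<lambda>n. k n x)" for x using mono by (auto simp: incseq_def)
  have ik: "integrable lborel (k n)" for n using int[of n] by (simp add: k_def[abs_def])
  have Ibd: "(LBINT x. k n x) \<le> C" for n using bd[of n] by (simp add: k_def)
  have "incseq (\<lambda>n. \<integral>x. k n x \<partial>lborel)" unfolding incseq_def using mono by (auto intro!: integral_mono ik)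
  then obtain L where L: "(\<lambda>n. \<integral>x. k n x \<partial>lborel) \<longlonglongrightarrow> L"
    using incseq_convergent[of "\<lambda>n. \<integral>x. k n x \<partial>lborel" C] Ibd by blast
  have "has_bochner_integral lborel k' L"
    by (rule has_bochner_integral_monotone_convergence[OF ik _ _ L]) (use inc lim in \<open>auto simp: mono_iff_le_Suc incseq_Suc_iff\<close>)
  then have "integrable lborel k'" "(LBINT x. k' x) = L" by (auto simp: has_bochner_integral_iff)
  then show "integrable lborel (\<lambda>x. max 0 ((cmod (F x))\<^sup>2 * ln ((cmod (F x))\<^sup>2)))"
    "(\<lambda>n. \<integral>x. max 0 ((cmod (F x))\<^sup>2 * ln (clipped F n x)) \<partial>lborel)
      \<longlonglongrightarrow> (LBINT x. max 0 ((cmod (F x))\<^sup>2 * ln ((cmod (F x))\<^sup>2)))"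
    using L by (simp_all add: k_def k'_def[abs_def])
qed

lemma entropy_eq_of_integrable:
  fixes \<rho> :: "real \<Rightarrow> real"
  assumes [measurable]: "\<rho> \<in> borel_measurable lborel"
    and P: "integrable lborel (\<lambda>x. max 0 (- (\<rho> x * ln (\<rho> x))))" and N: "integrable lborel (\<lambda>x. max 0 (\<rho> x * ln (\<rho> x)))"
  shows "shannon_entropy \<rho>
    = ereal ((LBINT x. max 0 (- (\<rho> x * ln (\<rho> x)))) - (LBINT x. max 0 (\<rho> x * ln (\<rho> x))))"
proof -
  have "(\<integral>\<^sup>+x. ennreal (max 0 (h x)) \<partial>lborel) = ennreal (LBINT x. max 0 (h x))"
    if "integrable lborel (\<lambda>x. max 0 (h x))" for h :: "real \<Rightarrow> real"
    using that by (intro nn_integral_eq_integral) auto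
  note this[OF P] this[OF N]
  then have "(\<integral>\<^sup>+x. ennreal (- (\<rho> x * ln (\<rho> x))) \<partial>lebesgue) = ennreal (LBINT x. max 0 (- (\<rho> x * ln (\<rho> x))))"
    "(\<integral>\<^sup>+x. ennreal (\<rho> x * ln (\<rho> x)) \<partial>lebesgue) = ennreal (LBINT x. max 0 (\<rho> x * ln (\<rho> x)))"
    by (simp_all add: nn_integral_completion)
  then show ?thesis unfolding shannon_entropy_def by (simp add: enn2ereal_ennreal integral_nonneg_AE)
qed

text \<open>The minuend is infinite, and \<open>\<infinity>\<close> minus anything is
  \<open>\<infinity>\<close> in the extended reals.\<close>

lemma entropy_infinite:
  fixes \<rho> :: "real \<Rightarrow> real"
  assumes [measurable]: "\<rho> \<in> borel_measurable lborel"
    and P: "\<not> integrable lborel (\<lambda>x. max 0 (- (\<rho> x * ln (\<rho> x))))"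
  shows "shannon_entropy \<rho> = \<infinity>"
proof -
  have "(\<integral>\<^sup>+x. ennreal (max 0 (- (\<rho> x * ln (\<rho> x)))) \<partial>lborel) = \<infinity>"
  proof (rule ccontr)
    assume "(\<integral>\<^sup>+x. ennreal (max 0 (- (\<rho> x * ln (\<rho> x)))) \<partial>lborel) \<noteq> \<infinity>"
    then have "integrable lborel (\<lambda>x. max 0 (- (\<rho> x * ln (\<rho> x))))"
      by (intro integrableI_nonneg) (auto simp: top.not_eq_extremum)
    with P show False by blast
  qed
  then have "(\<integral>\<^sup>+x. ennreal (- (\<rho> x * ln (\<rho> x))) \<partial>lebesgue) = \<infinity>"
    by (simp add: nn_integral_completion)
  then show ?thesis unfolding shannon_entropy_def by simp
qed

text \<open>If \<open>neg F\<close> or \<open>neg G\<close> fails to be integrable, one entropy is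
  infinite and so is the sum. Otherwise the clipped densities bound \<open>k F n + k G n\<close> by
  \<open>C\<close> uniformly in \<open>n\<close>. Both summands are nonnegative, so the inequality
  itself shows that both entropies are finite, and its limit is the claim.\<close>

theorem entropic_uncertainty:
  assumes T: "is_transform F G" and F1: "l2norm lborel F = 1"
  shows "ereal (ln (pi * exp 1 * b)) \<le> shannon_entropy (\<lambda>x. (cmod (F x))\<^sup>2) + shannon_entropy (\<lambda>x. (cmod (G x))\<^sup>2)"
proof -
  have F: "square_integrable lborel F" and G: "square_integrable lborel G" using T by (auto simp: is_transform_def)
  have G1: "l2norm lborel G = 1" using is_transform_l2norm[OF T] F1 by simp
  note [measurable] = square_integrable_measurable[OF F] square_integrable_measurable[OF G]
  define neg where "neg H x = max 0 (- ((cmod (H x))\<^sup>2 * ln ((cmod (H x))\<^sup>2)))" for H :: "real \<Rightarrow> complex" and x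
  define pos where "pos H x = max 0 ((cmod (H x))\<^sup>2 * ln ((cmod (H x))\<^sup>2))" for H :: "real \<Rightarrow> complex" and x
  define k where "k H n = (LBINT x. max 0 ((cmod (H x))\<^sup>2 * ln (clipped H n x)))" for H n
  show ?thesis
  proof (cases "integrable lborel (neg F) \<and> integrable lborel (neg G)")
    case False
    then have "shannon_entropy (\<lambda>x. (cmod (F x))\<^sup>2) = \<infinity> \<or> shannon_entropy (\<lambda>x. (cmod (G x))\<^sup>2) = \<infinity>"
      using entropy_infinite[of "\<lambda>x. (cmod (F x))\<^sup>2"] entropy_infinite[of "\<lambda>x. (cmod (G x))\<^sup>2"]
      unfolding neg_def[abs_def] by auto
    then show ?thesis by auto
  next
    case True
    then have P: "integrable lborel (neg F)" "integrable lborel (neg G)" by auto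
    note WF = clipped_weight[OF F F1 P(1)[unfolded neg_def[abs_def]]]
    note WG = clipped_weight[OF G G1 P(2)[unfolded neg_def[abs_def]]]
    have le: "k F n + k G n \<le> (LBINT x. neg F x) + (LBINT x. neg G x) - ln (pi * exp 1 * b)" for n
      using gibbs_uncertainty[OF T WF(1)[of n] WG(1)[of n]] unfolding WF(3)[of n] WG(3)[of n] k_def neg_def by linarith
    have k0: "0 \<le> k H n" for H n unfolding k_def by (simp add: integral_nonneg_AE)
    define C where "C = (LBINT x. neg F x) + (LBINT x. neg G x) - ln (pi * exp 1 * b)"
    have "k F n \<le> C" "k G n \<le> C" for n using le[of n] k0[of F n] k0[of G n] by (auto simp: C_def)
    then have lim: "integrable lborel (pos F)" "integrable lborel (pos G)"
      "(\<lambda>n. k F n) \<longlonglongrightarrow> (LBINT x. pos F x)" "(\<lambda>n. k G n) \<longlonglongrightarrow> (LBINT x. pos G x)"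
      using clipped_limit[OF F _ WF(2), of C] clipped_limit[OF G _ WG(2), of C]
      unfolding k_def pos_def[abs_def] by auto
    have "(LBINT x. pos F x) + (LBINT x. pos G x) \<le> C"
      by (rule LIMSEQ_le_const2[OF tendsto_add[OF lim(3,4)]]) (use le in \<open>auto simp: C_def\<close>)
    moreover have "shannon_entropy (\<lambda>x. (cmod (H x))\<^sup>2) = ereal ((LBINT x. neg H x) - (LBINT x. pos H x))"
      if "integrable lborel (neg H)" "integrable lborel (pos H)" "square_integrable lborel H" for H
      using that square_integrable_measurable[of lborel H] unfolding neg_def pos_def
      by (intro entropy_eq_of_integrable) auto
    ultimately show ?thesis using P lim(1,2) F G by (simp add: C_def)
  qed
qed

end

section \<open>From Lebesgue measurable functions to Borel representatives\<close>

lemma lebesgue_complex_borel_version: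
  fixes f :: "real \<Rightarrow> complex"
  assumes f: "f \<in> borel_measurable lebesgue"
  obtains f' where "f' \<in> borel_measurable lborel" "AE x in lebesgue. f x = f' x"
proof -
  have "(\<lambda>x. Re (f x)) \<in> borel_measurable lebesgue" "(\<lambda>x. Im (f x)) \<in> borel_measurable lebesgue"
    using f by measurable
  from this[THEN completion_ex_borel_measurable_real]
  obtain g h where g: "g \<in> borel_measurable lborel" "AE x in lborel. Re (f x) = g x"
    and h: "h \<in> borel_measurable lborel" "AE x in lborel. Im (f x) = h x"
    by blast
  have "(\<lambda>x. Complex (g x) (h x)) \<in> borel_measurable lborel"
    using g(1) h(1) by (simp add: borel_measurable_complex_iff)
  moreover have "AE x in lborel. f x = Complex (g x) (h x)"
    using g(2) h(2) by eventually_elim (simp add: complex_eq_iff)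
  ultimately show thesis using that by (simp add: AE_completion_iff)
qed

lemma L2_norm_eq_l2norm:
  assumes "f' \<in> borel_measurable lborel" "AE x in lebesgue. f x = f' x" "f \<in> borel_measurable lebesgue"
  shows "L2_norm f = l2norm lborel f'"
proof -
  have m: "(\<lambda>t. (cmod (f' t))\<^sup>2) \<in> borel_measurable lborel" using assms(1) by measurable
  have [measurable]: "f' \<in> borel_measurable lebesgue" using assms(1) by (rule measurable_completion)
  note [measurable] = assms(3)
  have "(\<integral>t. (cmod (f t))\<^sup>2 \<partial>lebesgue) = (\<integral>t. (cmod (f' t))\<^sup>2 \<partial>lebesgue)"
    using assms(2) by (intro integral_cong_AE) auto
  also have "\<dots> = (LBINT t. (cmod (f' t))\<^sup>2)" by (rule integral_completion[OF m])
  finally show ?thesis by (simp add: L2_norm_def l2norm_def)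
qed

lemma L2_iff_square_integrable:
  assumes "f' \<in> borel_measurable lborel" "AE x in lebesgue. f x = f' x" "f \<in> borel_measurable lebesgue"
  shows "f \<in> L2 \<longleftrightarrow> square_integrable lborel f'"
proof -
  have m: "(\<lambda>t. (cmod (f' t))\<^sup>2) \<in> borel_measurable lborel" using assms(1) by measurable
  have [measurable]: "f' \<in> borel_measurable lebesgue" using assms(1) by (rule measurable_completion)
  note [measurable] = assms(3)
  have "integrable lebesgue (\<lambda>t. (cmod (f t))\<^sup>2) \<longleftrightarrow> integrable lebesgue (\<lambda>t. (cmod (f' t))\<^sup>2)"
    using assms(2) by (intro integrable_cong_AE) auto
  also have "\<dots> \<longleftrightarrow> integrable lborel (\<lambda>t. (cmod (f' t))\<^sup>2)" by (rule integrable_completion[OF m])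
  finally show ?thesis using assms by (simp add: L2_def square_integrable_def)
qed

lemma shannon_entropy_cong_AE:
  assumes "AE x in lebesgue. \<rho> x = \<rho>' x"
  shows "shannon_entropy \<rho> = shannon_entropy \<rho>'"
proof -
  have "(\<integral>\<^sup>+t. ennreal (- (\<rho> t * ln (\<rho> t))) \<partial>lebesgue) = (\<integral>\<^sup>+t. ennreal (- (\<rho>' t * ln (\<rho>' t))) \<partial>lebesgue)"
    "(\<integral>\<^sup>+t. ennreal (\<rho> t * ln (\<rho> t)) \<partial>lebesgue) = (\<integral>\<^sup>+t. ennreal (\<rho>' t * ln (\<rho>' t)) \<partial>lebesgue)"
    using assms by (auto intro!: nn_integral_cong_AE)
  then show ?thesis by (simp add: shannon_entropy_def)
qed

theorem theorem3p11:
  fixes a b c d \<tau> \<eta> :: real and f :: "real \<Rightarrow> complex"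
  assumes "a * d - b * c = 1" and "b > 0"
    and "f \<in> L2" and "L2_norm f = 1"
  shows "shannon_entropy (\<lambda>t. (cmod (f t))\<^sup>2)
       + shannon_entropy (\<lambda>u. (cmod (olct a b c d \<tau> \<eta> f u))\<^sup>2)
       \<ge> ereal (ln (pi * exp 1 * b))"
proof -
  define \<kappa> where "\<kappa> = 1 / csqrt (\<i> * of_real (2 * pi * b))"
  define \<psi> where "\<psi> u = - 1 / b * u * (d * \<tau> - b * \<eta>) + d / (2 * b) * (u\<^sup>2 + \<tau>\<^sup>2)" for u
  interpret chirped_fourier b \<kappa> \<psi>
  proof
    show "b > 0" by fact
    show "cmod \<kappa> = 1 / sqrt (2 * pi * b)" using \<open>b > 0\<close> by (simp add: \<kappa>_def norm_divide norm_mult)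
    show "\<psi> \<in> borel_measurable borel" unfolding \<psi>_def by measurable
  qed
  have fm: "f \<in> borel_measurable lebesgue" using \<open>f \<in> L2\<close> by (simp add: L2_def)
  obtain f0 where f0: "f0 \<in> borel_measurable lborel" "AE t in lebesgue. f t = f0 t"
    using lebesgue_complex_borel_version[OF fm] .
  note [measurable] = f0(1)
  \<comment> \<open>The part of the kernel phase that depends on \<open>t\<close> alone goes into
    the input, the part that depends on \<open>u\<close> alone is \<open>\<psi>\<close>, and only
    the Fourier phase \<open>- (t * (u / b))\<close> couples them. The input factor is unimodular,
    so the density changes at most on a null set.\<close>
  define F where "F t = f0 t * cis (a / (2 * b) * t\<^sup>2 + t * \<tau> / b)" for t
  have Fm [measurable]: "F \<in> borel_measurable lborel" unfolding F_def by measurable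
  have cF: "cmod (F t) = cmod (f0 t)" for t by (simp add: F_def norm_mult)
  have Fsq: "square_integrable lborel F"
    using \<open>f \<in> L2\<close> L2_iff_square_integrable[OF f0 fm] Fm by (simp add: square_integrable_def cF)
  have F1: "l2norm lborel F = 1"
    using \<open>L2_norm f = 1\<close> L2_norm_eq_l2norm[OF f0 fm] by (simp add: l2norm_def cF)
  have trunc_eq: "olct_trunc a b c d \<tau> \<eta> T f u = chirp (trunc T F) u" for T u
  proof -
    have K: "olct_kernel a b c d \<tau> \<eta> t u = \<kappa> * cis (\<psi> u) * (cis (a / (2 * b) * t\<^sup>2 + t * \<tau> / b) * cis (- (t * (u / b))))" for t
    proof -
      have "a / (2 * b) * t\<^sup>2 - 1 / b * t * (u - \<tau>) - 1 / b * u * (d * \<tau> - b * \<eta>) + d / (2 * b) * (u\<^sup>2 + \<tau>\<^sup>2)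
          = \<psi> u + (a / (2 * b) * t\<^sup>2 + t * \<tau> / b + - (t * (u / b)))"
        unfolding \<psi>_def by (simp add: algebra_simps diff_divide_distrib add_divide_distrib)
      then show ?thesis unfolding olct_kernel_def \<kappa>_def
        by (simp only: cis_conv_exp [symmetric] cis_mult [symmetric] mult.assoc)
    qed
    have "olct_trunc a b c d \<tau> \<eta> T f u = (\<integral>t. \<kappa> * cis (\<psi> u) * (trunc T F t * cis (- (t * (u / b)))) \<partial>lebesgue)"
      unfolding olct_trunc_def set_lebesgue_integral_def
    proof (rule integral_cong_AE)
      have [measurable]: "f0 \<in> borel_measurable lebesgue" "(\<lambda>t. cis (- (t * (u / b)))) \<in> borel_measurable lebesgue"
         "(\<lambda>t. cis (a / (2 * b) * t\<^sup>2 + t * \<tau> / b)) \<in> borel_measurable lebesgue" "indicator {-T..T} \<in> borel_measurable lebesgue"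
        by (rule measurable_completion, measurable)+
      note [measurable] = fm
      show "(\<lambda>t. indicat_real {- T..T} t *\<^sub>R (f t * olct_kernel a b c d \<tau> \<eta> t u)) \<in> borel_measurable lebesgue"
        unfolding K by measurable
      show "(\<lambda>t. \<kappa> * cis (\<psi> u) * (trunc T F t * cis (- (t * (u / b))))) \<in> borel_measurable lebesgue"
        by (rule measurable_completion) measurable
      show "AE t in lebesgue. indicat_real {- T..T} t *\<^sub>R (f t * olct_kernel a b c d \<tau> \<eta> t u)
          = \<kappa> * cis (\<psi> u) * (trunc T F t * cis (- (t * (u / b))))"
        using f0(2) by eventually_elim (simp add: K trunc_def F_def indicator_def mult_ac)
    qed
    also have "\<dots> = (LBINT t. \<kappa> * cis (\<psi> u) * (trunc T F t * cis (- (t * (u / b)))))"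
      by (rule integral_completion) measurable
    also have "\<dots> = chirp (trunc T F) u" by (simp add: chirp_def fourier_def)
    finally show ?thesis .
  qed
  have opm: "chirp (trunc T F) \<in> borel_measurable lborel" for T
    using borel_measurable_chirp[OF L1L2_measurable[OF L1L2_trunc[OF Fsq]]] by simp
  \<comment> \<open>Formulated for an arbitrary Borel version \<open>g0\<close> of \<open>g\<close>
    because it serves twice: to show that a transform exists, so that \<open>SOME\<close> is
    meaningful, and to treat the chosen representative, known only to be Lebesgue
    measurable.\<close>
  have is_iff: "is_olct a b c d \<tau> \<eta> f g \<longleftrightarrow> is_transform F g0"
    if g: "g \<in> borel_measurable lebesgue" and g0: "g0 \<in> borel_measurable lborel" "AE u in lebesgue. g u = g0 u" for g g0
  proof -
    have tL: "olct_trunc a b c d \<tau> \<eta> T f \<in> L2" for T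
    proof -
      have "chirp (trunc T F) \<in> L2 \<longleftrightarrow> square_integrable lborel (chirp (trunc T F))"
        by (rule L2_iff_square_integrable[OF opm _ measurable_completion[OF opm]]) simp
      then show ?thesis using chirp_isometry(1)[OF L1L2_trunc[OF Fsq]] unfolding trunc_eq[abs_def] by simp
    qed
    have "L2_norm (\<lambda>u. olct_trunc a b c d \<tau> \<eta> T f u - g u) = l2norm lborel (\<lambda>u. chirp (trunc T F) u - g0 u)" for T
      unfolding trunc_eq
    proof (rule L2_norm_eq_l2norm)
      show "(\<lambda>u. chirp (trunc T F) u - g0 u) \<in> borel_measurable lborel" using opm g0(1) by measurable
      show "AE u in lebesgue. chirp (trunc T F) u - g u = chirp (trunc T F) u - g0 u"
        using g0(2) by eventually_elim simp
      show "(\<lambda>u. chirp (trunc T F) u - g u) \<in> borel_measurable lebesgue"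
        using measurable_completion[OF opm] g by measurable
    qed
    then show ?thesis using tL Fsq L2_iff_square_integrable[OF g0 g] by (simp add: is_olct_def is_transform_def)
  qed
  obtain g1 where g1: "is_transform F g1" using is_transform_exists[OF Fsq] by blast
  then have g1m: "g1 \<in> borel_measurable lborel"
    using square_integrable_measurable[of lborel g1] unfolding is_transform_def by blast
  have "is_olct a b c d \<tau> \<eta> f g1" using is_iff[OF measurable_completion[OF g1m] g1m] g1 by simp
  then have olct: "is_olct a b c d \<tau> \<eta> f (olct a b c d \<tau> \<eta> f)" unfolding olct_def
    by (rule someI[where P = "is_olct a b c d \<tau> \<eta> f"])
  then have gm: "olct a b c d \<tau> \<eta> f \<in> borel_measurable lebesgue" by (simp add: is_olct_def L2_def)
  obtain g0 where g0: "g0 \<in> borel_measurable lborel" "AE u in lebesgue. olct a b c d \<tau> \<eta> f u = g0 u"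
    using lebesgue_complex_borel_version[OF gm] .
  have "shannon_entropy (\<lambda>t. (cmod (f t))\<^sup>2) = shannon_entropy (\<lambda>t. (cmod (F t))\<^sup>2)"
    using f0(2) by (intro shannon_entropy_cong_AE) (auto simp: cF)
  moreover have "shannon_entropy (\<lambda>u. (cmod (olct a b c d \<tau> \<eta> f u))\<^sup>2) = shannon_entropy (\<lambda>u. (cmod (g0 u))\<^sup>2)"
    using g0(2) by (intro shannon_entropy_cong_AE) auto
  ultimately show ?thesis
    using entropic_uncertainty[OF _ F1, of g0] is_iff[OF gm g0] olct by simp
qed

end
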